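(* Let $K \subset \mathbb{R}^n$ be a bounded convex domain (nonempty, open) whose boundary $\partial K$ is of class $C^2$. Let $\sigma_{\partial K} = \mathcal{H}^{n-1}|_{\partial K} / \mathcal{H}^{n-1}(\partial K)$ be the uniform probability measure on $\partial K$, and let $\mu_K$ be the Crofton (kinematic) probability measure on directed lines meeting $K$. For a directed line $\ell$ meeting $K$, let $X(\ell) \in \partial K$ and $Y(\ell)\in\partial K$ be its entry point and its exit point. Suppose that the measure induced by picking two points on $\partial K$ independently and uniformly coincides with the Crofton measure, i.e. that the law of $(X(\ell),Y(\ell))$ under $\mu_K$ equals the product measure $\sigma_{\partial K}\times\sigma_{\partial K}$ on $\partial K \times \partial K$. Then $n=3$ and $\partial K$ is $\mathbb{S}^2$ up to translation and dilation, i.e. there exist $c \in \mathbb{R}^3$ and $r>0$ such that $\partial K = \{c + r u : u \in \mathbb{S}^2\}$.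
   Context: $\mathcal{H}^{n-1}$ denotes $(n-1)$-dimensional Hausdorff measure, and $\mathbb{S}^{n-1}$ is the Euclidean unit sphere in $\mathbb{R}^n$. The boundary $\partial K$ is of class $C^2$ if near each of its points it is, after a rigid motion, the graph of a $C^2$ function of $n-1$ variables with $K$ lying locally on one side. Kinematic (Crofton) measure: this is the measure on directed lines in $\mathbb{R}^n$, unique up to a constant factor, that is invariant under rotations and translations. Concretely, a directed line is $\ell = \{p + t u : t \in \mathbb{R}\}$ with direction $u \in \mathbb{S}^{n-1}$ and $p \in u^{\perp}$; the measure is given by taking $u$ uniformly distributed on $\mathbb{S}^{n-1}$ and, given $u$, taking $p$ according to $(n-1)$-dimensional Lebesgue measure on the hyperplane $u^\perp$. The measure $\mu_K$ is the restriction of this measure to the directed lines meeting $K$, normalized to be a probability measure. Since $K$ is bounded, open and convex, a directed line $\ell$ meeting $K$ meets $\partial K$ in exactly two points. The entry point $X(\ell)$ is the first and the exit point $Y(\ell)$ is the second of these along the direction of $\ell$. Thus directed lines meeting $K$ are identified with ordered pairs of boundary points. *)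

theory Defs
  imports "HOL-Probability.Probability"
begin

section \<open>Hausdorff measure of integer dimension\<close>

text \<open>
  Normalised so that the \<open>m\<close>-dimensional measure agrees with Lebesgue measure on
  \<open>m\<close>-dimensional planes. The empty set gets weight \<open>0\<close> explicitly because
  \<open>0 ^ 0 = 1\<close>, so that for \<open>m = 0\<close> one obtains counting measure.
\<close>

definition hausdorff_weight :: "nat \<Rightarrow> 'a::metric_space set \<Rightarrow> ennreal" where
  "hausdorff_weight m U =
     (if U = {} then 0 else ennreal (unit_ball_vol (real m) * (diameter U / 2) ^ m))"

text \<open>Boundedness of the covering sets is required since \<^const>\<open>diameter\<close> is
  meaningful only for bounded sets.\<close>

definition hausdorff_content :: "nat \<Rightarrow> real \<Rightarrow> 'a::metric_space set \<Rightarrow> ennreal" where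
  "hausdorff_content m \<delta> A =
     (INF U\<in>{U :: nat \<Rightarrow> 'a set. (\<forall>i. bounded (U i) \<and> diameter (U i) \<le> \<delta>) \<and> A \<subseteq> (\<Union>i. U i)}.
        \<Sum>i. hausdorff_weight m (U i))"

definition hausdorff_measure :: "nat \<Rightarrow> 'a::metric_space measure" where
  "hausdorff_measure m =
     measure_of UNIV (sets borel) (\<lambda>A. SUP \<delta>\<in>{0<..}. hausdorff_content m \<delta> A)"

definition surface_prob :: "(real^'n) set \<Rightarrow> (real^'n) measure" where
  "surface_prob S = uniform_measure (hausdorff_measure (CARD('n) - 1)) S"


section \<open>Boundaries of class \<open>C\<^sup>2\<close>\<close>

text \<open>Intended for open \<open>S\<close>.\<close>

definition C2_on :: "('a::real_normed_vector \<Rightarrow> 'b::real_normed_vector) \<Rightarrow> 'a set \<Rightarrow> bool" where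
  "C2_on f S \<longleftrightarrow>
     (\<exists>(f' :: 'a \<Rightarrow> 'a \<Rightarrow>\<^sub>L 'b) (f'' :: 'a \<Rightarrow> 'a \<Rightarrow>\<^sub>L ('a \<Rightarrow>\<^sub>L 'b)).
        (\<forall>x\<in>S. (f has_derivative blinfun_apply (f' x)) (at x)) \<and>
        (\<forall>x\<in>S. (f' has_derivative blinfun_apply (f'' x)) (at x)) \<and>
        continuous_on S f'')"

definition rigid_motion :: "(real^'n \<Rightarrow> real^'n) \<Rightarrow> bool" where
  "rigid_motion T \<longleftrightarrow> (\<exists>f a. orthogonal_transformation f \<and> (\<forall>y. T y = f y + a))"

text \<open>
  A function of \<open>n - 1\<close> variables is represented as a function \<open>g\<close> on \<open>real^'n\<close> that does
  not depend on the \<open>k\<close>-th coordinate; its graph is the set of \<open>z\<close> with \<open>z $ k = g z\<close>.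
  The domain \<open>K\<close> lies locally below the graph.
\<close>

definition C2_boundary :: "(real^'n) set \<Rightarrow> bool" where
  "C2_boundary K \<longleftrightarrow>
     (\<forall>x\<in>frontier K. \<exists>T k g U.
        rigid_motion T \<and>
        (\<forall>y z. (\<forall>i. i \<noteq> k \<longrightarrow> y $ i = z $ i) \<longrightarrow> g y = g z) \<and>
        open U \<and> x \<in> U \<and> C2_on g (T ` U) \<and>
        (\<forall>y\<in>U. (y \<in> frontier K \<longleftrightarrow> T y $ k = g (T y)) \<and>
               (y \<in> K \<longleftrightarrow> T y $ k < g (T y))))"


section \<open>Crofton measure on directed lines\<close>

text \<open>
  Lebesgue measure on a linear subspace, as a Borel measure on the whole space, built from
  an orthonormal basis in the same way as \<^const>\<open>lborel\<close> is built from
  \<^const>\<open>Basis\<close>. By rotation invariance the choice of the basis is immaterial.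
\<close>

definition subspace_lborel :: "(real^'n) set \<Rightarrow> (real^'n) measure" where
  "subspace_lborel S =
     (let B = (SOME B. pairwise orthogonal B \<and> (\<forall>b\<in>B. norm b = 1) \<and> span B = S)
      in distr (\<Pi>\<^sub>M b\<in>B. lborel) borel (\<lambda>f. \<Sum>b\<in>B. f b *\<^sub>R b))"

text \<open>
  A pair \<open>(u, p)\<close> with \<open>norm u = 1\<close> and \<open>p \<bullet> u = 0\<close> stands for the directed line
  \<open>{p + t *\<^sub>R u | t. True}\<close> with direction \<open>u\<close>. The measure below is concentrated on such
  pairs.
\<close>

definition crofton_measure :: "((real^'n) \<times> (real^'n)) measure" where
  "crofton_measure =
     measure_of UNIV (sets borel)
       (\<lambda>A. \<integral>\<^sup>+ u. emeasure (subspace_lborel {p. p \<bullet> u = 0}) {p. (u, p) \<in> A}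
              \<partial>surface_prob (sphere 0 1))"

definition lines_meeting :: "(real^'n) set \<Rightarrow> ((real^'n) \<times> (real^'n)) set" where
  "lines_meeting K = {(u, p). norm u = 1 \<and> p \<bullet> u = 0 \<and> (\<exists>t. p + t *\<^sub>R u \<in> K)}"

text \<open>The space of this measure consists only of the lines meeting \<open>K\<close>, so that the
  entry and exit points of other lines play no role.\<close>

definition crofton_prob :: "(real^'n) set \<Rightarrow> ((real^'n) \<times> (real^'n)) measure" where
  "crofton_prob K =
     uniform_measure (restrict_space crofton_measure (lines_meeting K)) (lines_meeting K)"

text \<open>For a bounded open convex \<open>K\<close> and a line meeting \<open>K\<close>, the sets below have exactly
  two elements.\<close>

definition entry_point :: "(real^'n) set \<Rightarrow> (real^'n) \<times> (real^'n) \<Rightarrow> real^'n" where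
  "entry_point K = (\<lambda>(u, p). p + Min {t. p + t *\<^sub>R u \<in> frontier K} *\<^sub>R u)"

definition exit_point :: "(real^'n) set \<Rightarrow> (real^'n) \<times> (real^'n) \<Rightarrow> real^'n" where
  "exit_point K = (\<lambda>(u, p). p + Max {t. p + t *\<^sub>R u \<in> frontier K} *\<^sub>R u)"

end

theory Submission
  imports Defs
begin

text \<open>
  Let \<open>x\<close> be a boundary point with outer unit normal \<open>n\<close>. Conditioning on the entry point to
  lie in a shrinking neighbourhood of \<open>x\<close>, independence shows that the exit point of the line
  starting at \<open>x\<close> with cosine distributed direction is uniform on the boundary. On the other hand
  the uniform distribution is the law of the entry point of a random line, so its density is
  found by blowing up at the boundary point. Comparing the two on the patch that a small cone with
  apex \<open>x\<close> cuts out near \<open>y\<close> gives, with normals \<open>n\<close>, \<open>m\<close> at \<open>x\<close>, \<open>y\<close>,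
  \<open>(n \<bullet> (x - y)) * (m \<bullet> (y - x)) = c * norm (x - y) ^ (dim + 1)\<close>
  with a constant \<open>c > 0\<close>. (Only cones around varying directions are compared, so rotation
  invariance of the measure on the sphere suffices.)

  Now let \<open>x\<close> be a point of maximal norm. Both factors on the left are quadratic in
  \<open>norm (x - y)\<close> with the same coefficient as \<open>y\<close> tends to \<open>x\<close>, because the boundary is of class
  \<open>C\<^sup>2\<close>; hence the dimension is \<open>3\<close> and the coefficient is \<open>sqrt c\<close>. Where
  \<open>(n \<bullet> (x - y)) / norm (x - y)\<^sup>2\<close> is extremal, the sphere tangent at \<open>x\<close> and passing through
  \<open>y\<close> is inscribed or circumscribed, so it is also tangent at \<open>y\<close>, both factors agree, and the
  extremal value is again \<open>sqrt c\<close>. Thus the quotient is constant and the boundary is a sphere.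
\<close>

section \<open>Hausdorff measure\<close>

text \<open>The area of the boundary is never computed. The hypothesis turns the area of a piece
  into the Crofton mass of the lines entering through it, and that mass is found by blowing up.
  Hausdorff measure itself is estimated only on the sphere, where finiteness, positivity and
  rotation invariance are enough. The constant is universal because the area of the patch near
  \<open>y\<close> is known twice, as exit law from \<open>x\<close> and as entry law at
  \<open>y\<close>, and both times the points enter only through the two cosines and the distance.
  What remains is the measure of a small spherical cap, which by rotation does not depend on its
  centre. At a point of maximal norm the quotient of \<open>n \<bullet> (x - y)\<close> by the
  squared distance stays away from 0, because the body lies in a ball touching at \<open>x\<close>;
  this excludes dimensions above 3. The upper bound from the second derivative excludes dimension 2.
  In dimension 1 the boundary has no limit points, so that case needs a different argument: the
  blow-up would make \<open>x\<close> an atom.\<close>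

definition hausdorff_outer :: "nat \<Rightarrow> 'a::metric_space set \<Rightarrow> ennreal" where
  "hausdorff_outer m A = (SUP \<delta>\<in>{0<..}. hausdorff_content m \<delta> A)"

lemma hausdorff_content_le:
  fixes U :: "nat \<Rightarrow> 'a::metric_space set"
  assumes "\<And>i. bounded (U i)" "\<And>i. diameter (U i) \<le> \<delta>" "A \<subseteq> (\<Union>i. U i)"
  shows "hausdorff_content m \<delta> A \<le> (\<Sum>i. hausdorff_weight m (U i))"
  unfolding hausdorff_content_def by (rule INF_lower) (use assms in auto)

lemma hausdorff_content_greatest:
  fixes A :: "'a::metric_space set"
  assumes "\<And>U. \<lbrakk>\<And>i. bounded (U i); \<And>i. diameter (U i) \<le> \<delta>; A \<subseteq> (\<Union>i::nat. U i)\<rbrakk>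
             \<Longrightarrow> c \<le> (\<Sum>i. hausdorff_weight m (U i))"
  shows "c \<le> hausdorff_content m \<delta> A"
  unfolding hausdorff_content_def by (rule INF_greatest) (use assms in auto)

lemma hausdorff_content_mono: "A \<subseteq> B \<Longrightarrow> hausdorff_content m \<delta> A \<le> hausdorff_content m \<delta> B"
  by (rule hausdorff_content_greatest, rule hausdorff_content_le) auto

lemma hausdorff_content_antimono:
  "\<delta> \<le> \<delta>' \<Longrightarrow> hausdorff_content m \<delta>' A \<le> hausdorff_content m \<delta> A"
  by (rule hausdorff_content_greatest, rule hausdorff_content_le) (auto intro: order_trans)

lemma hausdorff_content_empty: "0 \<le> \<delta> \<Longrightarrow> hausdorff_content m \<delta> {} = 0"
  using hausdorff_content_le[of "\<lambda>_. {}" \<delta> "{}" m] by (simp add: hausdorff_weight_def)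

lemma hausdorff_content_UN:
  "hausdorff_content m \<delta> (\<Union>i. A i) \<le> (\<Sum>i::nat. hausdorff_content m \<delta> (A i))"
proof (rule ennreal_le_epsilon)
  fix e :: real
  assume fin: "(\<Sum>i. hausdorff_content m \<delta> (A i)) < top" and "0 < e"
  have "\<exists>U. (\<forall>j::nat. bounded (U j) \<and> diameter (U j) \<le> \<delta>) \<and> A i \<subseteq> (\<Union>j. U j) \<and>
      (\<Sum>j. hausdorff_weight m (U j)) \<le> hausdorff_content m \<delta> (A i) + ennreal (e * (1/2)^Suc i)" for i
  proof -
    have "hausdorff_content m \<delta> (A i) \<noteq> top"
      using fin by (metis ennreal_suminf_lessD less_irrefl)
    then have "hausdorff_content m \<delta> (A i)
        < hausdorff_content m \<delta> (A i) + ennreal (e * (1/2)^Suc i)"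
      using \<open>0 < e\<close> by (simp add: ennreal_less_zero_iff less_top)
    then show ?thesis
      unfolding hausdorff_content_def
      by (subst (asm) INF_less_iff) (auto intro: less_imp_le)
  qed
  then obtain U :: "nat \<Rightarrow> nat \<Rightarrow> 'a set" where
    U: "\<And>i j. bounded (U i j)" "\<And>i j. diameter (U i j) \<le> \<delta>" "\<And>i. A i \<subseteq> (\<Union>j. U i j)"
      "\<And>i. (\<Sum>j. hausdorff_weight m (U i j))
        \<le> hausdorff_content m \<delta> (A i) + ennreal (e * (1/2)^Suc i)"
    by metis
  have "hausdorff_content m \<delta> (\<Union>i. A i)
      \<le> (\<Sum>k. hausdorff_weight m (case_prod U (prod_decode k)))"
  proof (rule hausdorff_content_le)
    show "(\<Union>i. A i) \<subseteq> (\<Union>k. case_prod U (prod_decode k))"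
    proof
      fix x assume "x \<in> (\<Union>i. A i)"
      then obtain i j where "x \<in> U i j" using U(3) by blast
      then show "x \<in> (\<Union>k. case_prod U (prod_decode k))"
        by (intro UN_I[of "prod_encode (i, j)"]) simp_all
    qed
  qed (use U in \<open>auto split: prod.split\<close>)
  also have "\<dots> = (\<Sum>i. \<Sum>j. hausdorff_weight m (U i j))"
    using suminf_ennreal_2dimen[of "\<lambda>i. \<Sum>j. hausdorff_weight m (U i j)" "\<lambda>p. hausdorff_weight m (case_prod U p)"]
    by simp
  also have "\<dots> \<le> (\<Sum>i. hausdorff_content m \<delta> (A i) + ennreal (e * (1/2)^Suc i))"
    by (intro suminf_le U) auto
  also have "\<dots> = (\<Sum>i. hausdorff_content m \<delta> (A i)) + (\<Sum>i. ennreal (e * (1/2)^Suc i))"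
    by (rule suminf_add[symmetric]) auto
  also have "(\<Sum>i. ennreal (e * (1/2)^Suc i)) = ennreal e"
    using sums_mult[OF power_half_series, of e] \<open>0 < e\<close> by (intro suminf_ennreal_eq) auto
  finally show "hausdorff_content m \<delta> (\<Union>i. A i)
      \<le> (\<Sum>i. hausdorff_content m \<delta> (A i)) + ennreal e" .
qed

lemma hausdorff_content_le_outer: "0 < \<delta> \<Longrightarrow> hausdorff_content m \<delta> A \<le> hausdorff_outer m A"
  unfolding hausdorff_outer_def by (rule SUP_upper) auto

lemma hausdorff_outer_mono: "A \<subseteq> B \<Longrightarrow> hausdorff_outer m A \<le> hausdorff_outer m B"
  unfolding hausdorff_outer_def by (intro SUP_mono') (rule hausdorff_content_mono)

lemma hausdorff_outer_empty [simp]: "hausdorff_outer m {} = 0"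
  unfolding hausdorff_outer_def by (auto simp: hausdorff_content_empty intro!: SUP_eq_const)

lemma hausdorff_outer_UN: "hausdorff_outer m (\<Union>i. A i) \<le> (\<Sum>i::nat. hausdorff_outer m (A i))"
  unfolding hausdorff_outer_def[of m "\<Union>i. A i"]
  by (intro SUP_least order_trans[OF hausdorff_content_UN] suminf_le)
     (auto intro: hausdorff_content_le_outer)

lemma hausdorff_outer_Un: "hausdorff_outer m (A \<union> B) \<le> hausdorff_outer m A + hausdorff_outer m B"
proof -
  have "(\<Union>i. case i of 0 \<Rightarrow> A | Suc 0 \<Rightarrow> B | _ \<Rightarrow> {}) = A \<union> B"
    by (auto split: nat.splits)
  then have "hausdorff_outer m (A \<union> B)
      \<le> (\<Sum>i. hausdorff_outer m (case i of 0 \<Rightarrow> A | Suc 0 \<Rightarrow> B | _ \<Rightarrow> {}))"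
    by (metis hausdorff_outer_UN)
  also have "\<dots> = (\<Sum>i<2. hausdorff_outer m (case i of 0 \<Rightarrow> A | Suc 0 \<Rightarrow> B | _ \<Rightarrow> {}))"
    by (intro suminf_finite) (auto split: nat.splits)
  finally show ?thesis by (simp add: numeral_2_eq_2)
qed

section \<open>Caratheodory's criterion for the Hausdorff outer measure\<close>

text \<open>A covering set of diameter below \<open>d\<close> meets at most one of \<open>A\<close>
  and \<open>B\<close>, so a fine cover of the union splits into two disjoint subfamilies covering
  \<open>A\<close> and \<open>B\<close>.\<close>

lemma hausdorff_outer_separated:
  fixes A B :: "'a::metric_space set"
  assumes "0 < d" and sep: "\<And>a b. a \<in> A \<Longrightarrow> b \<in> B \<Longrightarrow> d \<le> dist a b"
  shows "hausdorff_outer m A + hausdorff_outer m B \<le> hausdorff_outer m (A \<union> B)"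
proof -
  have *: "hausdorff_content m \<delta> A + hausdorff_content m \<delta>' B \<le> hausdorff_outer m (A \<union> B)"
    if "0 < \<delta>" "0 < \<delta>'" for \<delta> \<delta>'
  proof -
    define \<eta> where "\<eta> = min (min \<delta> \<delta>') (d/2)"
    have \<eta>: "0 < \<eta>" "\<eta> \<le> \<delta>" "\<eta> \<le> \<delta>'" "\<eta> < d" using that \<open>0 < d\<close> by (auto simp: \<eta>_def)
    have "hausdorff_content m \<eta> A + hausdorff_content m \<eta> B \<le> hausdorff_content m \<eta> (A \<union> B)"
    proof (rule hausdorff_content_greatest)
      fix U :: "nat \<Rightarrow> 'a set"
      assume U: "\<And>i. bounded (U i)" "\<And>i. diameter (U i) \<le> \<eta>" "A \<union> B \<subseteq> (\<Union>i. U i)"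
      define V where "V C i = (if U i \<inter> C = {} then {} else U i)" for C i
      have V: "hausdorff_content m \<eta> C \<le> (\<Sum>i. hausdorff_weight m (V C i))" if "C \<subseteq> A \<union> B" for C
        by (rule hausdorff_content_le) (use U \<eta>(1) that in \<open>auto simp: V_def subset_eq\<close>, force)
      have "U i \<inter> A = {} \<or> U i \<inter> B = {}" for i
        using diameter_bounded_bound[OF U(1)[of i]] U(2)[of i] sep \<eta>(4) by fastforce
      then have "hausdorff_weight m (V A i) + hausdorff_weight m (V B i) \<le> hausdorff_weight m (U i)" for i
        by (auto simp: V_def hausdorff_weight_def)
      then have "(\<Sum>i. hausdorff_weight m (V A i)) + (\<Sum>i. hausdorff_weight m (V B i))
          \<le> (\<Sum>i. hausdorff_weight m (U i))"
        by (subst suminf_add) (auto intro!: suminf_le)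
      with V[of A] V[of B] show "hausdorff_content m \<eta> A + hausdorff_content m \<eta> B
          \<le> (\<Sum>i. hausdorff_weight m (U i))"
        by (meson Un_upper1 Un_upper2 add_mono order_trans)
    qed
    then show ?thesis
      using hausdorff_content_antimono[OF \<eta>(2), of m A] hausdorff_content_antimono[OF \<eta>(3), of m B]
        hausdorff_content_le_outer[OF \<eta>(1), of m "A \<union> B"]
      by (meson add_mono order_trans)
  qed
  have "hausdorff_outer m A + hausdorff_content m \<delta>' B \<le> hausdorff_outer m (A \<union> B)" if "0 < \<delta>'" for \<delta>'
    unfolding hausdorff_outer_def[of m A]
    using * that by (subst ennreal_SUP_add_left[symmetric]) (auto simp: SUP_le_iff)
  then show ?thesis
    unfolding hausdorff_outer_def[of m B]
    by (subst ennreal_SUP_add_right) (auto simp: SUP_le_iff)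
qed

text \<open>Only shells whose indices differ by at least 2 are assumed apart. Shells of equal parity
  satisfy this, so each parity class sums to at most the outer measure of \<open>X\<close>; hence
  the factor 2.\<close>

lemma hausdorff_outer_shells:
  fixes R :: "nat \<Rightarrow> 'a::metric_space set"
  assumes sub: "\<And>j. R j \<subseteq> X"
    and sep: "\<And>k. \<exists>d>0. \<forall>j x y. j + 1 < k \<longrightarrow> x \<in> R j \<longrightarrow> y \<in> R k \<longrightarrow> d \<le> dist x y"
  shows "(\<Sum>j. hausdorff_outer m (R j)) \<le> 2 * hausdorff_outer m X"
proof -
  have part: "(\<Sum>j<N. hausdorff_outer m (R (2*j+p))) \<le> hausdorff_outer m (\<Union>j<N. R (2*j+p))" for N p
  proof (induction N)
    case (Suc N)
    obtain d where d: "d > 0" "\<And>j x y. j + 1 < 2*N+p \<Longrightarrow> x \<in> R j \<Longrightarrow> y \<in> R (2*N+p) \<Longrightarrow> d \<le> dist x y"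
      using sep[of "2*N+p"] by blast
    have step: "hausdorff_outer m (\<Union>j<N. R (2*j+p)) + hausdorff_outer m (R (2*N+p))
        \<le> hausdorff_outer m ((\<Union>j<N. R (2*j+p)) \<union> R (2*N+p))"
    proof (rule hausdorff_outer_separated[OF d(1)])
      fix a b assume "a \<in> (\<Union>j<N. R (2*j+p))" and b: "b \<in> R (2*N+p)"
      then obtain j where "j < N" "a \<in> R (2*j+p)" by auto
      then show "d \<le> dist a b" using d(2)[of "2*j+p" a b] b by auto
    qed
    have un: "(\<Union>j<Suc N. R (2*j+p)) = (\<Union>j<N. R (2*j+p)) \<union> R (2*N+p)"
      by (auto simp: less_Suc_eq)
    show ?case
      unfolding un sum.lessThan_Suc by (rule order_trans[OF add_right_mono[OF Suc] step])
  qed simp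
  have le: "(\<Sum>j<N. hausdorff_outer m (R (2*j+p))) \<le> hausdorff_outer m X" for N p
    by (rule order_trans[OF part hausdorff_outer_mono]) (use sub in blast)
  have "(\<Sum>j<N. hausdorff_outer m (R j)) \<le> 2 * hausdorff_outer m X" for N
  proof -
    have "(\<Sum>j<N. hausdorff_outer m (R j)) \<le> (\<Sum>j<2*N. hausdorff_outer m (R j))"
      by (intro sum_mono2) auto
    also have "\<dots> = (\<Sum>j<N. hausdorff_outer m (R (2*j))) + (\<Sum>j<N. hausdorff_outer m (R (2*j+1)))"
      by (induction N) (auto simp: algebra_simps)
    also have "\<dots> \<le> hausdorff_outer m X + hausdorff_outer m X"
      using le[where N=N and p=0] le[where N=N and p=1] by (intro add_mono) auto
    finally show ?thesis by (simp add: mult_2)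
  qed
  then show ?thesis by (simp add: suminf_eq_SUP SUP_le_iff)
qed

text \<open>Off \<open>C\<close>, a set is exhausted by its parts \<open>Y k\<close> at distance at
  least 1/(k+1) from \<open>C\<close>. These are separated from \<open>C\<close>, so additivity
  holds for them, and the remainder is covered by the shells \<open>R j\<close>, whose measures have
  a finite sum and hence a small tail.\<close>

lemma closed_in_lambda_system:
  fixes C :: "'a::metric_space set"
  assumes "closed C"
  shows "C \<in> lambda_system UNIV UNIV (hausdorff_outer m)"
proof -
  have "hausdorff_outer m (C \<inter> X) + hausdorff_outer m (-C \<inter> X) \<le> hausdorff_outer m X" for X
  proof (cases "C = {} \<or> hausdorff_outer m X = top")
    case True then show ?thesis by auto
  next
    case False
    then have C: "C \<noteq> {}" and fin: "hausdorff_outer m X \<noteq> top" by auto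
    define Y where "Y k = {x\<in>X. 1 / (real k + 1) \<le> infdist x C}" for k :: nat
    define R where "R k = Y (Suc k) - Y k" for k
    have lip: "infdist x C - infdist y C \<le> dist x y" for x y
      using infdist_triangle[of x C y] by simp
    have Ymono: "Y j \<subseteq> Y k" if "j \<le> k" for j k
    proof -
      have "1 / (real k + 1) \<le> 1 / (real j + 1)" using that by (intro frac_le) auto
      then show ?thesis unfolding Y_def by fastforce
    qed
    have "(\<Sum>j. hausdorff_outer m (R j)) \<le> 2 * hausdorff_outer m X"
    proof (rule hausdorff_outer_shells)
      show "R j \<subseteq> X" for j by (auto simp: R_def Y_def)
      fix k
      show "\<exists>d>0. \<forall>j x y. j + 1 < k \<longrightarrow> x \<in> R j \<longrightarrow> y \<in> R k \<longrightarrow> d \<le> dist x y"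
      proof (cases "k = 0")
        case False
        have "1 / real k - 1 / (real k + 1) \<le> dist x y" if "j + 1 < k" "x \<in> R j" "y \<in> R k" for j x y
        proof -
          have "x \<in> Y (k - 1)" using that Ymono[of "Suc j" "k - 1"] by (force simp: R_def)
          then have "1 / real k \<le> infdist x C" using False by (simp add: Y_def of_nat_diff)
          moreover have "infdist y C < 1 / (real k + 1)" using that by (auto simp: R_def Y_def)
          ultimately show ?thesis using lip[of x y] by linarith
        qed
        moreover have "1 / real k - 1 / (real k + 1) > 0" using False by (simp add: frac_less2)
        ultimately show ?thesis by blast
      qed (auto intro: exI[of _ 1])
    qed
    then have sfin: "(\<Sum>j. hausdorff_outer m (R j)) \<noteq> top"
      using fin by (auto simp: top_unique ennreal_mult_eq_top_iff)
    show ?thesis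
    proof (rule ennreal_le_epsilon)
      fix e :: real assume "0 < e"
      have "(SUP n. \<Sum>j<n. hausdorff_outer m (R j)) \<noteq> top"
        using sfin by (simp add: suminf_eq_SUP)
      then obtain k where k: "(\<Sum>j. hausdorff_outer m (R j))
          < (\<Sum>j<k. hausdorff_outer m (R j)) + ennreal e"
        using SUP_approx_ennreal[of e UNIV "\<Sum>j. hausdorff_outer m (R j)" "\<lambda>n. \<Sum>j<n. hausdorff_outer m (R j)"]
          \<open>0 < e\<close> sfin by (auto simp: suminf_eq_SUP)
      have "(\<Sum>j. hausdorff_outer m (R j))
          = (\<Sum>j. hausdorff_outer m (R (j + k))) + (\<Sum>j<k. hausdorff_outer m (R j))"
        by (rule suminf_offset) auto
      moreover from this have "(\<Sum>j<k. hausdorff_outer m (R j)) \<noteq> top"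
        using sfin by (metis ennreal_add_eq_top)
      ultimately have tail: "(\<Sum>j. hausdorff_outer m (R (j + k))) \<le> ennreal e"
        using k ennreal_add_left_cancel_le[of "\<Sum>j<k. hausdorff_outer m (R j)"
            "\<Sum>j. hausdorff_outer m (R (j + k))" "ennreal e"]
        by (simp add: add.commute less_imp_le)
      have cover: "-C \<inter> X \<subseteq> Y k \<union> (\<Union>j. R (j + k))"
      proof
        fix x assume x: "x \<in> -C \<inter> X"
        then have "infdist x C > 0"
          using assms C by (simp add: infdist_pos_not_in_closed)
        then obtain l where "1 / real (Suc l) < infdist x C" by (rule nat_approx_posE)
        then have "1 / (real l + 1) \<le> infdist x C" by (simp add: add.commute)
        then have l: "x \<in> Y l" using x by (auto simp: Y_def)
        define l' where "l' = (LEAST l. x \<in> Y l)"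
        have l': "x \<in> Y l'" unfolding l'_def using LeastI[of "\<lambda>l. x \<in> Y l" l] l by simp
        show "x \<in> Y k \<union> (\<Union>j. R (j + k))"
        proof (cases "l' \<le> k")
          case True then show ?thesis using l' Ymono by auto
        next
          case False
          then obtain j where j: "l' = Suc (j + k)"
            by (metis add.commute less_imp_Suc_add not_le)
          have "x \<notin> Y (j + k)" using not_less_Least[of "j+k" "\<lambda>l. x \<in> Y l"] j
            unfolding l'_def by simp
          then show ?thesis using l' j by (auto simp: R_def)
        qed
      qed
      have "hausdorff_outer m (-C \<inter> X) \<le> hausdorff_outer m (Y k) + hausdorff_outer m (\<Union>j. R (j + k))"
        by (rule order_trans[OF hausdorff_outer_mono[OF cover] hausdorff_outer_Un])
      also have "\<dots> \<le> hausdorff_outer m (Y k) + ennreal e"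
        using tail hausdorff_outer_UN[of m "\<lambda>j. R (j + k)"] by (meson add_left_mono order_trans)
      finally have 1: "hausdorff_outer m (-C \<inter> X) \<le> hausdorff_outer m (Y k) + ennreal e" .
      have "hausdorff_outer m (C \<inter> X) + hausdorff_outer m (Y k) \<le> hausdorff_outer m (C \<inter> X \<union> Y k)"
      proof (rule hausdorff_outer_separated[of "1 / (real k + 1)"])
        fix a b assume "a \<in> C \<inter> X" "b \<in> Y k"
        then show "1 / (real k + 1) \<le> dist a b"
          using lip[of b a] by (auto simp: Y_def dist_commute)
      qed auto
      also have "\<dots> \<le> hausdorff_outer m X" by (rule hausdorff_outer_mono) (auto simp: Y_def)
      finally have 2: "hausdorff_outer m (C \<inter> X) + hausdorff_outer m (Y k) \<le> hausdorff_outer m X" .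
      have "hausdorff_outer m (C \<inter> X) + hausdorff_outer m (-C \<inter> X)
          \<le> hausdorff_outer m (C \<inter> X) + (hausdorff_outer m (Y k) + ennreal e)"
        by (rule add_left_mono[OF 1])
      also have "\<dots> = hausdorff_outer m (C \<inter> X) + hausdorff_outer m (Y k) + ennreal e"
        by (rule add.assoc[symmetric])
      also have "\<dots> \<le> hausdorff_outer m X + ennreal e"
        by (rule add_right_mono[OF 2])
      finally show "hausdorff_outer m (C \<inter> X) + hausdorff_outer m (- C \<inter> X)
          \<le> hausdorff_outer m X + ennreal e" .
    qed
  qed
  moreover have "hausdorff_outer m X \<le> hausdorff_outer m (C \<inter> X) + hausdorff_outer m (-C \<inter> X)" for X
    using hausdorff_outer_Un[of m "C \<inter> X" "-C \<inter> X"] by (simp add: Int_Un_distrib2[symmetric])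
  ultimately show ?thesis
    by (auto simp: lambda_system_def Compl_eq_Diff_UNIV[symmetric] intro!: antisym)
qed

text \<open>A measure declared by \<open>measure_of\<close> takes the given values only once
  countable additivity is proved. Here it is inherited from the lambda system, a sigma algebra
  containing the closed sets.\<close>

lemma measure_space_hausdorff_outer:
  "measure_space UNIV (sets borel) (hausdorff_outer m :: 'a::metric_space set \<Rightarrow> ennreal)"
proof -
  interpret sigma_algebra "UNIV :: 'a set" UNIV by (metis Pow_UNIV sigma_algebra_Pow)
  have "outer_measure_space UNIV (hausdorff_outer m :: 'a set \<Rightarrow> ennreal)"
    unfolding outer_measure_space_def positive_def increasing_def countably_subadditive_def
    by (auto intro: hausdorff_outer_mono hausdorff_outer_UN)
  from caratheodory_lemma[OF this]
  have ms: "measure_space UNIV (lambda_system UNIV UNIV (hausdorff_outer m)) (hausdorff_outer m :: 'a set \<Rightarrow> ennreal)" .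
  then have "sigma_algebra UNIV (lambda_system UNIV UNIV (hausdorff_outer m :: 'a set \<Rightarrow> ennreal))"
    by (simp add: measure_space_def)
  then have "sigma_sets UNIV (Collect closed)
      \<subseteq> lambda_system UNIV UNIV (hausdorff_outer m :: 'a set \<Rightarrow> ennreal)"
    by (rule sigma_algebra.sigma_sets_subset) (use closed_in_lambda_system in blast)
  then have sub: "sets borel \<subseteq> lambda_system UNIV UNIV (hausdorff_outer m :: 'a set \<Rightarrow> ennreal)"
    by (simp add: borel_eq_closed sets_measure_of)
  show ?thesis
    unfolding measure_space_def
  proof (intro conjI)
    show "sigma_algebra UNIV (sets (borel::'a measure))" by (metis sets.sigma_algebra_axioms space_borel)
    show "positive (sets borel) (hausdorff_outer m)" by (simp add: positive_def)
    show "countably_additive (sets borel) (hausdorff_outer m :: 'a set \<Rightarrow> ennreal)"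
      unfolding countably_additive_def
    proof (intro allI impI)
      fix A :: "nat \<Rightarrow> 'a set"
      assume A: "range A \<subseteq> sets borel" "disjoint_family A" "\<Union> (range A) \<in> sets borel"
      have "countably_additive (lambda_system UNIV UNIV (hausdorff_outer m)) (hausdorff_outer m :: 'a set \<Rightarrow> ennreal)"
        using ms by (simp add: measure_space_def)
      then show "(\<Sum>i. hausdorff_outer m (A i)) = hausdorff_outer m (\<Union> (range A))"
        unfolding countably_additive_def using A sub by (meson order_trans subsetD)
    qed
  qed
qed

lemma sets_hausdorff_measure [simp, measurable_cong]: "sets (hausdorff_measure m) = sets borel"
  unfolding hausdorff_measure_def by (metis sets.sets_measure_of_eq space_borel)

lemma space_hausdorff_measure [simp]: "space (hausdorff_measure m) = UNIV"
  unfolding hausdorff_measure_def by (metis sets.space_measure_of_eq space_borel)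

lemma emeasure_hausdorff_measure:
  fixes A :: "'a::metric_space set"
  assumes "A \<in> sets borel"
  shows "emeasure (hausdorff_measure m) A = hausdorff_outer m A"
proof -
  have eq: "hausdorff_measure m = measure_of UNIV (sets borel) (hausdorff_outer m :: 'a set \<Rightarrow> ennreal)"
    by (simp add: hausdorff_measure_def hausdorff_outer_def[abs_def])
  show ?thesis
    using measure_space_hausdorff_outer[of m] assms unfolding eq measure_space_def
    by (intro emeasure_measure_of_sigma) auto
qed

section \<open>The rotation invariant probability measure on the sphere\<close>

lemma hausdorff_content_finite_cover:
  fixes U :: "'i \<Rightarrow> 'a::metric_space set"
  assumes I: "finite I" and cov: "A \<subseteq> (\<Union>i\<in>I. U i)"
    and U: "\<And>i. i \<in> I \<Longrightarrow> bounded (U i)" "\<And>i. i \<in> I \<Longrightarrow> diameter (U i) \<le> d"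
    and d: "0 \<le> d" "d \<le> \<delta>"
  shows "hausdorff_content m \<delta> A \<le> ennreal (real (card I) * (unit_ball_vol (real m) * (d / 2) ^ m))"
proof -
  obtain f where f: "bij_betw f {..<card I} I"
    using ex_bij_betw_nat_finite[OF I] by (auto simp: lessThan_atLeast0)
  define V where "V j = (if j < card I then U (f j) else {})" for j
  have fI: "f j \<in> I" if "j < card I" for j using f that by (auto simp: bij_betw_def)
  have w: "hausdorff_weight m (V j) \<le> ennreal (unit_ball_vol (real m) * (d / 2) ^ m)" for j
    using U[OF fI] by (auto simp: V_def hausdorff_weight_def diameter_ge_0
        intro!: ennreal_leI mult_left_mono power_mono)
  have "hausdorff_content m \<delta> A \<le> (\<Sum>j. hausdorff_weight m (V j))"
  proof (rule hausdorff_content_le)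
    show "A \<subseteq> (\<Union>j. V j)"
    proof
      fix x assume "x \<in> A"
      then obtain i where "i \<in> I" "x \<in> U i" using cov by blast
      moreover from this have "i \<in> f ` {..<card I}" using f by (simp add: bij_betw_def)
      ultimately obtain j where "j < card I" "x \<in> U (f j)" by auto
      then show "x \<in> (\<Union>j. V j)" by (auto simp: V_def intro!: exI[of _ j])
    qed
    show "bounded (V i)" "diameter (V i) \<le> \<delta>" for i
      using U[OF fI, of i] d by (auto simp: V_def intro: order_trans)
  qed
  also have "\<dots> = (\<Sum>j<card I. hausdorff_weight m (V j))"
    by (intro suminf_finite) (auto simp: V_def hausdorff_weight_def)
  also have "\<dots> \<le> (\<Sum>j<card I. ennreal (unit_ball_vol (real m) * (d / 2) ^ m))"
    by (intro sum_mono w)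
  also have "\<dots> = ennreal (real (card I) * (unit_ball_vol (real m) * (d / 2) ^ m))"
    using d by (simp add: ennreal_mult ennreal_of_nat_eq_real_of_nat)
  finally show ?thesis .
qed

text \<open>The piece \<open>U (k, s, j)\<close> consists of the unit vectors whose dominant
  coordinate is \<open>k\<close> with sign \<open>s\<close> and whose other coordinates lie in one
  cell of a grid of mesh 1/N. On it the norm condition also pins down coordinate \<open>k\<close>,
  so of order N^m pieces of diameter of order 1/N suffice, and the bound \<open>c\<close> does not
  depend on the scale.\<close>

lemma hausdorff_outer_sphere_finite:
  "hausdorff_outer (CARD('n) - 1) (sphere 0 1 :: (real^'n) set) < top"
proof -
  define n where "n = CARD('n)"
  define m where "m = n - 1"
  have n1: "1 \<le> real n" by (simp add: n_def)
  define c where "c = real (n * 2 * 3 ^ m) * (unit_ball_vol (real m) * (real n ^ 2 / 2) ^ m)"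
  have "hausdorff_content m \<delta> (sphere 0 1 :: (real^'n) set) \<le> ennreal c" if "0 < \<delta>" for \<delta>
  proof -
    obtain N :: nat where N: "real n ^ 2 / \<delta> < real N" using reals_Archimedean2 by blast
    have N0: "0 < real N" by (rule order_le_less_trans[OF _ N]) (use that in simp)
    define U where "U = (\<lambda>(k, s, j). {x :: real^'n. norm x = 1 \<and> (\<forall>i. \<bar>x $ i\<bar> \<le> s * x $ k)
                          \<and> (\<forall>i. i \<noteq> k \<longrightarrow> \<lfloor>real N * x $ i\<rfloor> = j i)})"
    define I where "I = (SIGMA k:(UNIV::'n set). {1, -1 :: real} \<times>
                          PiE (UNIV - {k}) (\<lambda>_. {- int N..int N}))"
    have finI: "finite I" by (auto simp: I_def intro!: finite_SigmaI finite_PiE)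
    have cardI: "card I = n * 2 * (2 * N + 1) ^ m"
    proof -
      have "nat (int N - - int N + 1) = 2 * N + 1" by linarith
      then show ?thesis
        unfolding I_def by (subst card_SigmaI) (auto simp: card_cartesian_product card_PiE finite_PiE n_def m_def)
    qed
    have dm: "dist x y \<le> real n ^ 2 / N" if "x \<in> U (k, s, j)" "y \<in> U (k, s, j)" "s \<in> {1, -1}" for x y k s j
    proof -
      have x: "norm x = 1" "\<And>i. \<bar>x $ i\<bar> \<le> s * x $ k" "\<And>i. i \<noteq> k \<Longrightarrow> \<lfloor>real N * x $ i\<rfloor> = j i"
        and y: "norm y = 1" "\<And>i. \<bar>y $ i\<bar> \<le> s * y $ k" "\<And>i. i \<noteq> k \<Longrightarrow> \<lfloor>real N * y $ i\<rfloor> = j i"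
        using that by (auto simp: U_def)
      have small: "\<bar>x $ i - y $ i\<bar> \<le> 1 / N" if "i \<noteq> k" for i
      proof -
        have "\<bar>real N * x $ i - real N * y $ i\<bar> \<le> 1" using x(3)[OF that] y(3)[OF that] by linarith
        then have "real N * \<bar>x $ i - y $ i\<bar> \<le> 1"
          using N0 by (simp add: right_diff_distrib[symmetric] abs_mult)
        then show ?thesis using N0 by (simp add: field_simps)
      qed
      \<comment> \<open>The difference of the squares of the \<open>k\<close>-th coordinates is, up
        to sign, their difference times \<open>t\<close>, while dominance of \<open>k\<close> gives
        \<open>\<bar>x $ i + y $ i\<bar> \<le> t\<close>. Dividing by \<open>t\<close> bounds the
        difference of the coordinates.\<close>
      define t where "t = s * x $ k + s * y $ k"
      have "x $ k \<noteq> 0"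
      proof
        assume "x $ k = 0"
        then have "x = 0" using x(2) by (auto simp: vec_eq_iff)
        then show False using x(1) by simp
      qed
      then have t: "t > 0" using x(2)[of k] y(2)[of k] unfolding t_def by linarith
      have "(\<Sum>i\<in>UNIV. (x $ i)^2) = 1" "(\<Sum>i\<in>UNIV. (y $ i)^2) = 1"
        using x(1) y(1) by (simp_all add: norm_vec_def L2_set_def real_sqrt_eq_1_iff)
      then have "(x $ k)^2 - (y $ k)^2 = (\<Sum>i\<in>UNIV-{k}. (y $ i)^2 - (x $ i)^2)"
        by (simp add: sum.remove[of UNIV k] sum_subtractf)
      also have "\<dots> \<le> \<bar>\<dots>\<bar>" by simp
      finally have "\<bar>(x $ k)^2 - (y $ k)^2\<bar> \<le> \<bar>\<Sum>i\<in>UNIV-{k}. (y $ i)^2 - (x $ i)^2\<bar>"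
        using \<open>(x $ k)^2 - (y $ k)^2 = _\<close> by simp
      also have "\<dots> \<le> (\<Sum>i\<in>UNIV-{k}. \<bar>(y $ i)^2 - (x $ i)^2\<bar>)" by (rule sum_abs)
      also have "\<dots> \<le> (\<Sum>i\<in>UNIV-{k}. 1 / N * t)"
      proof (rule sum_mono)
        fix i assume i: "i \<in> UNIV - {k}"
        have "\<bar>(y $ i)^2 - (x $ i)^2\<bar> = \<bar>x $ i - y $ i\<bar> * \<bar>x $ i + y $ i\<bar>"
          by (simp add: abs_mult[symmetric] power2_eq_square algebra_simps abs_minus_commute)
        also have "\<dots> \<le> 1 / N * t"
          using small[of i] i x(2)[of i] y(2)[of i] t by (intro mult_mono) (auto simp: t_def)
        finally show "\<bar>(y $ i)^2 - (x $ i)^2\<bar> \<le> 1 / N * t" .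
      qed
      also have "\<dots> \<le> real n * (1 / N * t)"
        using t N0 by (simp add: n_def divide_right_mono mult_right_mono)
      also have "\<bar>(x $ k)^2 - (y $ k)^2\<bar> = \<bar>x $ k - y $ k\<bar> * t"
      proof -
        have "t = \<bar>x $ k + y $ k\<bar>" using t that(3) by (auto simp: t_def)
        then show ?thesis by (simp add: abs_mult[symmetric] power2_eq_square algebra_simps)
      qed
      finally have "\<bar>x $ k - y $ k\<bar> * t \<le> real n / N * t" by simp
      then have big: "\<bar>x $ k - y $ k\<bar> \<le> real n / N" using t by (rule mult_right_le_imp_le)
      have "\<bar>(x - y) $ i\<bar> \<le> real n / N" for i
        using big small[of i] n1 N0 by (cases "i = k") (auto intro: order_trans[OF _ divide_right_mono])
      then have "(\<Sum>i\<in>UNIV. \<bar>(x - y) $ i\<bar>) \<le> (\<Sum>i\<in>(UNIV::'n set). real n / N)" by (intro sum_mono)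
      then show ?thesis
        using norm_le_l1_cart[of "x - y"] by (simp add: dist_norm n_def power2_eq_square)
    qed
    have "hausdorff_content m \<delta> (sphere 0 1 :: (real^'n) set)
        \<le> ennreal (real (card I) * (unit_ball_vol (real m) * ((real n ^ 2 / N) / 2) ^ m))"
    proof (rule hausdorff_content_finite_cover[OF finI])
      show "sphere 0 1 \<subseteq> (\<Union>i\<in>I. U i)"
      proof
        fix x :: "real^'n" assume "x \<in> sphere 0 1"
        then have x: "norm x = 1" by simp
        define M where "M = Max (range (\<lambda>i. \<bar>x $ i\<bar>))"
        have "M \<in> range (\<lambda>i. \<bar>x $ i\<bar>)" unfolding M_def by (rule Max_in) auto
        then obtain k where "M = \<bar>x $ k\<bar>" by auto
        then have k: "\<bar>x $ i\<bar> \<le> \<bar>x $ k\<bar>" for i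
          unfolding M_def by (metis Max_ge finite finite_imageI rangeI)
        define s where "s = (if x $ k \<ge> 0 then 1 else -1 :: real)"
        define j where "j = restrict (\<lambda>i. \<lfloor>real N * x $ i\<rfloor>) (UNIV - {k})"
        have "- int N \<le> \<lfloor>real N * x $ i\<rfloor> \<and> \<lfloor>real N * x $ i\<rfloor> \<le> int N" for i
        proof -
          have "\<bar>x $ i\<bar> \<le> 1" using component_le_norm_cart[of x i] x by simp
          then have "\<bar>real N * x $ i\<bar> \<le> real N * 1" unfolding abs_mult by (intro mult_mono) auto
          then show ?thesis by (auto simp: le_floor_iff floor_le_iff)
        qed
        then have "(k, s, j) \<in> I" by (auto simp: I_def s_def j_def)
        moreover have "x \<in> U (k, s, j)"
          using k x by (auto simp: U_def s_def j_def)
        ultimately show "x \<in> (\<Union>i\<in>I. U i)" by blast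
      qed
      show "0 \<le> real n ^ 2 / N" by simp
      show "real n ^ 2 / N \<le> \<delta>" using N N0 that by (simp add: field_simps)
      fix i assume i: "i \<in> I"
      have "norm x \<le> 1" if "x \<in> U i" for x using that by (auto simp: U_def split: prod.splits)
      then show "bounded (U i)" by (auto simp: bounded_iff)
      show "diameter (U i) \<le> real n ^ 2 / N"
      proof (rule diameter_le)
        obtain k s j where ksj: "i = (k, s, j)" by (cases i)
        then have "s \<in> {1, -1}" using i by (simp add: I_def)
        then show "norm (x - y) \<le> real n ^ 2 / N" if "x \<in> U i" "y \<in> U i" for x y
          using that unfolding ksj dist_norm[symmetric] by (intro dm)
      qed (use N0 in simp)
    qed
    also have "\<dots> \<le> ennreal c"
    proof (rule ennreal_leI)
      have "real (card I) \<le> real (n * 2 * 3 ^ m) * N ^ m"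
      proof -
        have "2 * N + 1 \<le> 3 * N" using N0 by auto
        then have "card I \<le> n * 2 * (3 * N) ^ m" unfolding cardI by (intro mult_left_mono power_mono) auto
        then have "real (card I) \<le> real (n * 2 * (3 * N) ^ m)" by (rule of_nat_mono)
        then show ?thesis by (simp add: power_mult_distrib)
      qed
      then have "real (card I) * (unit_ball_vol (real m) * ((real n ^ 2 / N) / 2) ^ m)
         \<le> real (n * 2 * 3 ^ m) * N ^ m * (unit_ball_vol (real m) * ((real n ^ 2 / N) / 2) ^ m)"
        by (intro mult_right_mono) auto
      also have "\<dots> = c" using N0 by (simp add: c_def power_divide field_simps)
      finally show "real (card I) * (unit_ball_vol (real m) * ((real n ^ 2 / N) / 2) ^ m) \<le> c" .
    qed
    finally show ?thesis .
  qed
  then have "hausdorff_outer m (sphere 0 1 :: (real^'n) set) \<le> ennreal c"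
    unfolding hausdorff_outer_def by (auto intro!: SUP_least)
  then show ?thesis
    by (auto simp: m_def n_def less_top[symmetric] top_unique)
qed

lemma emeasure_lborel_cbox_cart:
  fixes a b :: "real^'n"
  assumes "\<And>i. a $ i \<le> b $ i"
  shows "emeasure lborel (cbox a b) = ennreal (\<Prod>i\<in>UNIV. b $ i - a $ i)"
proof -
  have ne: "cbox a b \<noteq> {}" using assms by (auto simp: interval_eq_empty_cart not_less)
  have "emeasure lborel (cbox a b) = ennreal (measure lborel (cbox a b))"
    by (rule emeasure_eq_ennreal_measure) (auto simp: emeasure_lborel_cbox_eq)
  with content_cbox_cart[OF ne] show ?thesis by simp
qed

lemma prod_UNIV_except:
  fixes k :: "'n::finite"
  shows "(\<Prod>i\<in>UNIV. if i = k then 1 else c) = (c::real) ^ (CARD('n) - 1)"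
  by (simp add: prod.remove[of UNIV k])

text \<open>A covering of the sphere yields, via cylinders over the coordinate hyperplane,
  a covering of a box.\<close>

lemma hausdorff_outer_sphere_pos:
  "0 < hausdorff_outer (CARD('n) - 1) (sphere 0 1 :: (real^'n) set)"
proof -
  define m where "m = CARD('n) - 1"
  \<comment> \<open>With side 1/n the squares of the coordinates other than \<open>k\<close> sum to
    at most 1, so every point of the box lifts to the sphere.\<close>
  define q where "q = 1 / real CARD('n)"
  obtain k :: 'n where True by simp
  have q: "0 < q" "q \<le> 1" by (auto simp: q_def)
  \<comment> \<open>The box over \<open>U i\<close> has base side \<open>2 * d i\<close> while the
    Hausdorff weight contains \<open>d i / 2\<close>, a ratio of 4 in each of \<open>m\<close>
    directions. Its extent along \<open>k\<close> is 1, so its volume is that of the base.\<close>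
  define c where "c = unit_ball_vol (real m) / 4 ^ m"
  have c: "0 < c" by (simp add: c_def)
  have "ennreal (c * q ^ m) \<le> hausdorff_content m 1 (sphere 0 1 :: (real^'n) set)"
  proof (rule hausdorff_content_greatest)
    fix U :: "nat \<Rightarrow> (real^'n) set"
    assume U: "\<And>i. bounded (U i)" "\<And>i. diameter (U i) \<le> 1" "sphere 0 1 \<subseteq> (\<Union>i. U i)"
    define p where "p i = (SOME x. x \<in> U i)" for i
    define d where "d i = diameter (U i)" for i
    have d: "0 \<le> d i" for i using U by (simp add: d_def diameter_ge_0)
    define B where "B i = (if U i = {} then {} else
      cbox (\<chi> j. if j = k then 0 else p i $ j - d i) (\<chi> j. if j = k then 1 else p i $ j + d i))" for i
    have B: "ennreal c * emeasure lborel (B i) \<le> hausdorff_weight m (U i)" for i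
    proof (cases "U i = {}")
      case False
      have "emeasure lborel (B i) = ennreal (\<Prod>j\<in>UNIV. if j = k then 1 else 2 * d i)"
        using False d[of i] unfolding B_def
        by (simp, subst emeasure_lborel_cbox_cart)
           (auto intro!: arg_cong[where f=ennreal] prod.cong split: if_splits)
      also have "\<dots> = ennreal ((2 * d i) ^ m)" unfolding m_def prod_UNIV_except ..
      finally have "ennreal c * emeasure lborel (B i) = ennreal (c * (2 * d i) ^ m)"
        using c d[of i] by (simp add: ennreal_mult)
      also have "c * (2 * d i) ^ m = unit_ball_vol (real m) * (d i / 2) ^ m"
      proof -
        have "(2 * d i) ^ m = (4 * (d i / 2)) ^ m" by simp
        also have "\<dots> = 4 ^ m * (d i / 2) ^ m" by (rule power_mult_distrib)
        finally show ?thesis by (simp add: c_def)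
      qed
      finally show ?thesis using False by (simp add: hausdorff_weight_def d_def)
    qed (simp add: B_def hausdorff_weight_def)
    define Q where "Q = cbox (0::real^'n) (\<chi> j. if j = k then 1 else q)"
    have "Q \<subseteq> (\<Union>i. B i)"
    proof
      fix z assume "z \<in> Q"
      then have "\<forall>j. 0 \<le> z $ j \<and> z $ j \<le> (if j = k then 1 else q)"
        by (simp add: Q_def mem_box_cart)
      then have z: "0 \<le> z $ j" "z $ k \<le> 1" "j \<noteq> k \<Longrightarrow> z $ j \<le> q" for j
        by (metis (full_types))+
      define w where "w = (\<Sum>j\<in>UNIV-{k}. (z $ j)^2)"
      have "w \<le> (\<Sum>j\<in>UNIV-{k}. q)"
        unfolding w_def
      proof (rule sum_mono)
        fix j assume "j \<in> UNIV - {k}"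
        then have "z $ j \<le> q" using z by auto
        then have "(z $ j)^2 \<le> q * 1" unfolding power2_eq_square using z(1)[of j] q by (intro mult_mono) auto
        then show "(z $ j)^2 \<le> q" by simp
      qed
      also have "\<dots> \<le> (\<Sum>j\<in>(UNIV::'n set). q)" using q by (intro sum_mono2) auto
      also have "\<dots> = 1" by (simp add: q_def)
      finally have w: "w \<le> 1" .
      define x where "x = (\<chi> j. if j = k then sqrt (1 - w) else z $ j)"
      have "(\<Sum>j\<in>UNIV. (x $ j)^2) = (1 - w) + (\<Sum>j\<in>UNIV-{k}. (x $ j)^2)"
        using w by (simp add: sum.remove[of UNIV k] x_def)
      also have "(\<Sum>j\<in>UNIV-{k}. (x $ j)^2) = w" unfolding w_def x_def by (intro sum.cong) auto
      finally have "norm x = 1" by (simp add: norm_vec_def L2_set_def)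
      then obtain i where i: "x \<in> U i" using U(3) by auto
      then have "p i \<in> U i" unfolding p_def by (rule someI)
      then have "norm (x - p i) \<le> d i"
        using diameter_bounded_bound[OF U(1) i] by (simp add: d_def dist_norm)
      then have "\<bar>z $ j - p i $ j\<bar> \<le> d i" if "j \<noteq> k" for j
        using component_le_norm_cart[of "x - p i" j] that by (simp add: x_def)
      then have "(if j = k then 0 else p i $ j - d i) \<le> z $ j \<and>
          z $ j \<le> (if j = k then 1 else p i $ j + d i)" for j
        using z(1)[of k] z(2) by (cases "j = k") (force simp: abs_le_iff)+
      then have "z \<in> B i" using i by (auto simp: B_def mem_box_cart)
      then show "z \<in> (\<Union>i. B i)" by blast
    qed
    moreover have Bs: "B i \<in> sets borel" for i by (simp add: B_def)
    ultimately have "emeasure lborel Q \<le> (\<Sum>i. emeasure lborel (B i))"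
      by (intro order_trans[OF emeasure_mono emeasure_subadditive_countably]) auto
    then have "ennreal c * emeasure lborel Q \<le> (\<Sum>i. ennreal c * emeasure lborel (B i))"
      by (simp add: mult_left_mono)
    also have "\<dots> \<le> (\<Sum>i. hausdorff_weight m (U i))" by (intro suminf_le B) auto
    also have "emeasure lborel Q = ennreal (\<Prod>j\<in>UNIV. if j = k then 1 else q)"
      unfolding Q_def using q by (subst emeasure_lborel_cbox_cart) (auto intro!: arg_cong[where f=ennreal] prod.cong)
    finally show "ennreal (c * q ^ m) \<le> (\<Sum>i. hausdorff_weight m (U i))"
      using c q unfolding prod_UNIV_except by (simp add: ennreal_mult m_def)
  qed
  also have "\<dots> \<le> hausdorff_outer m (sphere 0 1 :: (real^'n) set)" by (rule hausdorff_content_le_outer) simp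
  finally show ?thesis
    using c q unfolding m_def[symmetric] by (metis ennreal_less_zero_iff mult_pos_pos order_less_le_trans zero_less_power)
qed

section \<open>Invariance under rotations\<close>

lemma hausdorff_outer_isometry_le:
  fixes f :: "'a::real_normed_vector \<Rightarrow> 'a"
  assumes f: "\<And>x y. norm (f x - f y) = norm (x - y)"
  shows "hausdorff_outer m (f ` A) \<le> hausdorff_outer m A"
  unfolding hausdorff_outer_def
proof (rule SUP_mono')
  fix \<delta>
  show "hausdorff_content m \<delta> (f ` A) \<le> hausdorff_content m \<delta> A"
  proof (rule hausdorff_content_greatest)
    fix U :: "nat \<Rightarrow> 'a set"
    assume U: "\<And>i. bounded (U i)" "\<And>i. diameter (U i) \<le> \<delta>" "A \<subseteq> (\<Union>i. U i)"
    have b: "bounded (f ` U i)" for i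
    proof -
      obtain x e where "\<forall>y\<in>U i. dist x y \<le> e" using U(1)[of i] by (auto simp: bounded_def)
      then have "\<forall>y\<in>f ` U i. dist (f x) y \<le> e" using f by (auto simp: dist_norm)
      then show ?thesis unfolding bounded_def by blast
    qed
    have d: "diameter (f ` U i) \<le> diameter (U i)" for i
      using diameter_bounded_bound[OF U(1)] diameter_ge_0[OF U(1)] f
      by (intro diameter_le) (auto simp: dist_norm)
    have "hausdorff_content m \<delta> (f ` A) \<le> (\<Sum>i. hausdorff_weight m (f ` U i))"
    proof (rule hausdorff_content_le)
      show "diameter (f ` U i) \<le> \<delta>" for i using order_trans[OF d U(2)] .
      show "f ` A \<subseteq> (\<Union>i. f ` U i)" using U(3) by blast
    qed (rule b)
    also have "\<dots> \<le> (\<Sum>i. hausdorff_weight m (U i))"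
      using b d by (intro suminf_le)
        (auto simp: hausdorff_weight_def diameter_ge_0 intro!: ennreal_leI mult_left_mono power_mono)
    finally show "hausdorff_content m \<delta> (f ` A) \<le> (\<Sum>i. hausdorff_weight m (U i))" .
  qed
qed

lemma hausdorff_outer_orthogonal:
  fixes f :: "real^'n \<Rightarrow> real^'n"
  assumes f: "orthogonal_transformation f"
  shows "hausdorff_outer m (f -` A) = hausdorff_outer m A"
proof -
  have lin: "linear f" using f by (rule orthogonal_transformation_linear)
  have iso: "norm (f x - f y) = norm (x - y)" for x y
    using f lin by (metis linear_diff orthogonal_transformation_norm)
  have bij: "bij f" using f by (rule orthogonal_transformation_bij)
  have inv: "norm (inv f x - inv f y) = norm (x - y)" for x y
    using iso[of "inv f x" "inv f y"] bij by (simp add: surj_f_inv_f bij_is_surj)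
  have "f ` (f -` A) = A" using bij by (simp add: surj_image_vimage_eq bij_is_surj)
  moreover have "inv f ` A = f -` A" using bij by (simp add: bij_vimage_eq_inv_image)
  ultimately show ?thesis
    using hausdorff_outer_isometry_le[OF iso, of m "f -` A"] hausdorff_outer_isometry_le[OF inv, of m A]
    by simp
qed

abbreviation sphere_prob :: "(real^'n) measure" where
  "sphere_prob \<equiv> surface_prob (sphere 0 1)"

lemma sets_surface_prob [simp, measurable_cong]: "sets (surface_prob A) = sets borel"
  by (simp add: surface_prob_def)

lemma space_surface_prob [simp]: "space (surface_prob A) = UNIV"
  by (simp add: surface_prob_def)

lemma emeasure_surface_prob:
  fixes S A :: "(real^'n) set"
  assumes "S \<in> sets borel" "A \<in> sets borel"
  shows "emeasure (surface_prob S) A =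
    hausdorff_outer (CARD('n) - 1) (S \<inter> A) / hausdorff_outer (CARD('n) - 1) S"
  using assms by (simp add: surface_prob_def emeasure_hausdorff_measure)

lemma prob_space_sphere_prob: "prob_space (sphere_prob :: (real^'n) measure)"
proof
  show "emeasure (sphere_prob :: (real^'n) measure) (space sphere_prob) = 1"
    using hausdorff_outer_sphere_finite[where 'n='n] hausdorff_outer_sphere_pos[where 'n='n]
    by (simp add: emeasure_surface_prob ennreal_divide_self)
qed

lemma sigma_finite_sphere_prob: "sigma_finite_measure (sphere_prob :: (real^'n) measure)"
  by (rule prob_space_imp_sigma_finite[OF prob_space_sphere_prob])

lemma AE_sphere_prob: "AE u in (sphere_prob :: (real^'n) measure). norm u = 1"
proof (rule AE_I)
  show "emeasure (sphere_prob :: (real^'n) measure) (- sphere 0 1) = 0"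
    by (simp add: emeasure_surface_prob)
qed auto

lemma orthogonal_transformation_measurable:
  fixes f :: "real^'n \<Rightarrow> real^'n"
  assumes "orthogonal_transformation f"
  shows "f \<in> borel_measurable borel"
  by (intro borel_measurable_continuous_onI linear_continuous_on)
    (use orthogonal_transformation_linear[OF assms] in \<open>simp add: linear_conv_bounded_linear\<close>)

lemma distr_sphere_prob:
  fixes f :: "real^'n \<Rightarrow> real^'n"
  assumes f: "orthogonal_transformation f"
  shows "distr sphere_prob borel f = sphere_prob"
proof (rule measure_eqI)
  fix A assume "A \<in> sets (distr sphere_prob borel f)"
  then have A: "A \<in> sets borel" by simp
  have [measurable]: "f \<in> borel_measurable borel" using f by (rule orthogonal_transformation_measurable)
  have vA: "f -` A \<in> sets borel" using measurable_sets[OF _ A, of f borel] by simp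
  have "sphere 0 1 \<inter> f -` A = f -` (sphere 0 1 \<inter> A)"
    using f by (auto simp: orthogonal_transformation_norm)
  then show "emeasure (distr sphere_prob borel f) A = emeasure sphere_prob A"
    using A vA f by (simp add: emeasure_distr emeasure_surface_prob hausdorff_outer_orthogonal del: vimage_Int)
qed simp

lemma nn_integral_sphere_prob_orthogonal:
  fixes f :: "real^'n \<Rightarrow> real^'n"
  assumes "orthogonal_transformation f" "g \<in> borel_measurable borel"
  shows "(\<integral>\<^sup>+u. g (f u) \<partial>sphere_prob) = (\<integral>\<^sup>+u. g u \<partial>sphere_prob)"
proof -
  have "(\<integral>\<^sup>+u. g u \<partial>distr sphere_prob borel f) = (\<integral>\<^sup>+u. g (f u) \<partial>sphere_prob)"
    using assms orthogonal_transformation_measurable[OF assms(1)] by (intro nn_integral_distr) auto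
  then show ?thesis using distr_sphere_prob[OF assms(1)] by simp
qed

lemma nn_integral_sphere_prob_inner:
  fixes a b :: "real^'n"
  assumes "norm a = norm b" "g \<in> borel_measurable borel"
  shows "(\<integral>\<^sup>+u. g (u \<bullet> a) \<partial>sphere_prob) = (\<integral>\<^sup>+u. g (u \<bullet> b) \<partial>sphere_prob)"
proof -
  obtain f where f: "orthogonal_transformation f" "f a = b"
    using orthogonal_transformation_exists[OF assms(1)] by blast
  have "(\<integral>\<^sup>+u. g (u \<bullet> b) \<partial>sphere_prob) = (\<integral>\<^sup>+u. g (f u \<bullet> b) \<partial>sphere_prob)"
    using assms f by (subst nn_integral_sphere_prob_orthogonal[OF f(1), of "\<lambda>u. g (u \<bullet> b)"]) auto
  also have "(\<lambda>u. f u \<bullet> b) = (\<lambda>u. u \<bullet> a)"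
    using f unfolding orthogonal_transformation_def by auto
  finally show ?thesis by (simp add: fun_eq_iff)
qed

text \<open>Makes the size of a small cap independent of its centre, so that blow-ups along
  different chords can be compared without knowing the measure of a cap.\<close>

lemma emeasure_sphere_prob_ball:
  fixes a b :: "real^'n"
  assumes "norm a = norm b"
  shows "emeasure sphere_prob {u. norm (u - a) < r} = emeasure sphere_prob {u. norm (u - b) < r}"
proof -
  obtain f where f: "orthogonal_transformation f" "f a = b"
    using orthogonal_transformation_exists[OF assms] by blast
  have [measurable]: "f \<in> borel_measurable borel" using f by (intro orthogonal_transformation_measurable)
  have "f -` {u. norm (u - b) < r} = {u. norm (u - a) < r}"
    using f by (auto simp: orthogonal_transformation_linear linear_diff[symmetric] orthogonal_transformation_norm)
  then show ?thesis
    using emeasure_distr[of f sphere_prob borel "{u. norm (u - b) < r}"] distr_sphere_prob[OF f(1)]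
    by simp
qed

text \<open>All great subspheres have the same measure, and by Fubini almost all of them are null.\<close>

lemma AE_sphere_prob_inner_nonzero:
  fixes n :: "real^'n"
  assumes n: "n \<noteq> 0"
  shows "AE u in sphere_prob. u \<bullet> n \<noteq> 0"
proof -
  interpret S: sigma_finite_measure "sphere_prob :: (real^'n) measure" by (rule sigma_finite_sphere_prob)
  interpret P: pair_sigma_finite "sphere_prob :: (real^'n) measure" "lborel :: (real^'n) measure"
    by unfold_locales
  have "(\<integral>\<^sup>+z. \<integral>\<^sup>+u. indicator {0} (u \<bullet> z) \<partial>(sphere_prob :: (real^'n) measure) \<partial>lborel)
      = (\<integral>\<^sup>+u. \<integral>\<^sup>+(z::real^'n). indicator {0} (u \<bullet> z) \<partial>lborel \<partial>(sphere_prob :: (real^'n) measure))"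
    by (rule P.Fubini') measurable
  also have "\<dots> = (\<integral>\<^sup>+(u::real^'n). 0 \<partial>sphere_prob)"
  proof (rule nn_integral_cong_AE, rule AE_mp[OF AE_sphere_prob], rule AE_I2, rule impI)
    fix u :: "real^'n" assume "norm u = 1"
    then have "u \<noteq> 0" by auto
    then have "negligible {z. u \<bullet> z = 0}" by (rule negligible_hyperplane[OF disjI1])
    moreover have "{z. u \<bullet> z = 0} \<in> sets borel" by measurable
    ultimately have "emeasure lborel {z. u \<bullet> z = 0} = 0"
      by (auto simp: negligible_iff_null_sets null_sets_completion_iff intro: null_setsD1)
    moreover have "(\<integral>\<^sup>+z. indicator {0} (u \<bullet> z) \<partial>lborel) = (\<integral>\<^sup>+z. indicator {z. u \<bullet> z = 0} z \<partial>lborel)"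
      by (intro nn_integral_cong) (auto split: split_indicator)
    ultimately show "(\<integral>\<^sup>+z. indicator {0} (u \<bullet> z) \<partial>lborel) = (0::ennreal)" by simp
  qed
  finally have "(\<integral>\<^sup>+z. \<integral>\<^sup>+(u::real^'n). indicator {0} (u \<bullet> z) \<partial>sphere_prob \<partial>lborel) = (0::ennreal)"
    by simp
  moreover have "(\<lambda>z. \<integral>\<^sup>+(u::real^'n). indicator {0} (u \<bullet> z) \<partial>sphere_prob) \<in> borel_measurable (lborel :: (real^'n) measure)"
    by measurable
  ultimately have "AE z in lborel. (\<integral>\<^sup>+(u::real^'n). indicator {0} (u \<bullet> z) \<partial>sphere_prob) = (0::ennreal)"
    by (simp add: nn_integral_0_iff_AE)
  then have "AE z in lborel. (\<integral>\<^sup>+(u::real^'n). indicator {0} (u \<bullet> z) \<partial>sphere_prob) = 0 \<and> z \<noteq> 0"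
    using AE_lborel_singleton[of 0] by eventually_elim auto
  then have "\<exists>z::real^'n. (\<integral>\<^sup>+u. indicator {0} (u \<bullet> z) \<partial>sphere_prob) = (0::ennreal) \<and> z \<noteq> 0"
    by (rule eventually_happens'[rotated]) (simp add: ae_filter_eq_bot_iff)
  then obtain z :: "real^'n" where z: "(\<integral>\<^sup>+u. indicator {0} (u \<bullet> z) \<partial>sphere_prob) = (0::ennreal)" "z \<noteq> 0"
    by blast
  define n' where "n' = (norm z / norm n) *\<^sub>R n"
  have "(\<integral>\<^sup>+u. indicator {0} (u \<bullet> n') \<partial>sphere_prob) = (0::ennreal)"
    using nn_integral_sphere_prob_inner[of n' z "indicator {0}"] z n by (simp add: n'_def)
  then have "AE u in sphere_prob. indicator {0} (u \<bullet> n') = (0::ennreal)"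
    by (subst (asm) nn_integral_0_iff_AE) auto
  then show ?thesis
    by eventually_elim (auto simp: n'_def split: split_indicator_asm)
qed

text \<open>\<open>ennreal\<close> sends negative reals to 0, so only the directions contribute that
  point inward at a boundary point with outer normal \<open>n\<close>.\<close>

definition cosine_mean :: "real^'n \<Rightarrow> ennreal" where
  "cosine_mean n = (\<integral>\<^sup>+u. ennreal (- (u \<bullet> n)) \<partial>sphere_prob)"

lemma cosine_mean_eq:
  fixes a b :: "real^'n"
  shows "norm a = norm b \<Longrightarrow> cosine_mean a = cosine_mean b"
  unfolding cosine_mean_def using nn_integral_sphere_prob_inner[of a b "\<lambda>t. ennreal (- t)"] by simp

text \<open>If the mean vanished for \<open>n\<close>, rotation would make it vanish for
  \<open>- n\<close> too, and then almost every \<open>u\<close> would be orthogonal to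
  \<open>n\<close>.\<close>

lemma cosine_mean_pos:
  fixes n :: "real^'n"
  assumes "n \<noteq> 0"
  shows "0 < cosine_mean n"
proof (rule ccontr)
  interpret prob_space "sphere_prob :: (real^'n) measure" by (rule prob_space_sphere_prob)
  assume "\<not> 0 < cosine_mean n"
  then have "cosine_mean n = 0" "cosine_mean (-n) = 0"
    using cosine_mean_eq[of n "-n"] by auto
  then have "AE u in sphere_prob. ennreal (- (u \<bullet> n)) = 0" "AE u in sphere_prob. ennreal (- (u \<bullet> - n)) = 0"
    unfolding cosine_mean_def by (auto simp: nn_integral_0_iff_AE)
  with AE_sphere_prob_inner_nonzero[OF assms] have "AE u in (sphere_prob :: (real^'n) measure). False"
    by eventually_elim (auto simp: ennreal_eq_0_iff)
  then show False by simp
qed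

lemma cosine_mean_le_1:
  fixes n :: "real^'n"
  assumes "norm n = 1"
  shows "cosine_mean n \<le> 1"
proof -
  interpret prob_space "sphere_prob :: (real^'n) measure" by (rule prob_space_sphere_prob)
  have "cosine_mean n \<le> (\<integral>\<^sup>+u. 1 \<partial>(sphere_prob :: (real^'n) measure))"
    unfolding cosine_mean_def
  proof (rule nn_integral_mono_AE, rule AE_mp[OF AE_sphere_prob], rule AE_I2, rule impI)
    fix u :: "real^'n" assume "norm u = 1"
    then have "- (u \<bullet> n) \<le> 1" using Cauchy_Schwarz_ineq2[of u n] assms by auto
    then show "ennreal (- (u \<bullet> n)) \<le> 1" by (metis ennreal_1 ennreal_leI)
  qed
  then show ?thesis using emeasure_space_1 by simp
qed

section \<open>Lebesgue measure on hyperplanes\<close>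

lemma nn_integral_lborel_translate:
  fixes f :: "'a::euclidean_space \<Rightarrow> ennreal"
  assumes [measurable]: "f \<in> borel_measurable borel"
  shows "(\<integral>\<^sup>+z. f (c + z) \<partial>lborel) = (\<integral>\<^sup>+z. f z \<partial>lborel)"
  using nn_integral_distr[of "(+) c" lborel borel f] by (simp add: lborel_distr_plus)

section \<open>Lebesgue measure in an arbitrary orthonormal basis\<close>

text \<open>A uniqueness argument for invariant measures. The indicator of \<open>A\<close> at
  \<open>x + f y\<close>, integrated over all \<open>x\<close> and over \<open>y\<close> in the unit
  ball, gives \<open>b\<close> times the measure of \<open>A\<close> in one order and, because
  \<open>f\<close> preserves distances, \<open>b\<close> times the measure of the preimage in the
  other.\<close>

lemma distr_lborel_orthogonal:
  fixes f :: "real^'n \<Rightarrow> real^'n"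
  assumes f: "orthogonal_transformation f"
  shows "distr lborel borel f = lborel"
proof (rule measure_eqI)
  fix A assume "A \<in> sets (distr lborel borel f)"
  then have A[measurable]: "A \<in> sets borel" by simp
  have [measurable]: "f \<in> borel_measurable borel" using f by (rule orthogonal_transformation_measurable)
  define b where "b = emeasure lborel (ball (0::real^'n) 1)"
  have b: "emeasure lborel (ball (c::real^'n) 1) = b" for c by (simp add: b_def emeasure_ball)
  have bI: "(\<integral>\<^sup>+x. indicator {..<1} (norm (c - x)) \<partial>lborel) = b" for c :: "real^'n"
  proof -
    have "(\<integral>\<^sup>+x. indicator {..<1} (norm (c - x)) \<partial>lborel) = (\<integral>\<^sup>+x. indicator (ball c 1) x \<partial>lborel)"
      by (intro nn_integral_cong) (auto simp: indicator_def dist_norm)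
    then show ?thesis by (simp add: b)
  qed
  have b0: "b \<noteq> 0" "b \<noteq> top"
    using less_imp_neq[OF unit_ball_vol_pos[of "real CARD('n)", OF of_nat_0_le_iff]]
    by (auto simp: b_def emeasure_ball)
  have lin: "linear f" using f by (rule orthogonal_transformation_linear)
  define g where "g = inv f"
  have fg: "f (g x) = x" for x
    unfolding g_def using orthogonal_transformation_bij[OF f] by (simp add: surj_f_inv_f bij_is_surj)
  define I where "I = (\<integral>\<^sup>+y. \<integral>\<^sup>+x. indicator A (x + f y) * indicator {..<1} (norm y) \<partial>lborel \<partial>(lborel :: (real^'n) measure))"
  have "I = (\<integral>\<^sup>+y. emeasure lborel A * indicator {..<1} (norm (y::real^'n)) \<partial>lborel)"
    unfolding I_def
  proof (intro nn_integral_cong)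
    fix y
    have "(\<integral>\<^sup>+x. indicator A (x + f y) * indicator {..<1} (norm y) \<partial>lborel)
        = (\<integral>\<^sup>+x. indicator A (f y + x) \<partial>lborel) * indicator {..<1} (norm y)"
      by (subst nn_integral_multc) (auto simp: add.commute)
    also have "(\<integral>\<^sup>+x. indicator A (f y + x) \<partial>lborel) = (\<integral>\<^sup>+x. indicator A x \<partial>lborel)"
      by (rule nn_integral_lborel_translate) measurable
    finally show "(\<integral>\<^sup>+x. indicator A (x + f y) * indicator {..<1} (norm y) \<partial>lborel)
        = emeasure lborel A * indicator {..<1} (norm y)" by simp
  qed
  also have "\<dots> = emeasure lborel A * b"
    using bI[of 0] by (subst nn_integral_cmult) (auto simp: norm_minus_commute)
  finally have 1: "I = emeasure lborel A * b" .
  have "I = (\<integral>\<^sup>+x. \<integral>\<^sup>+y. indicator A (x + f y) * indicator {..<1} (norm y) \<partial>lborel \<partial>(lborel :: (real^'n) measure))"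
    unfolding I_def by (rule lborel_pair.Fubini') measurable
  also have "\<dots> = (\<integral>\<^sup>+x. \<integral>\<^sup>+y. indicator A (f y) * indicator {..<1} (norm (y - g x)) \<partial>lborel \<partial>(lborel :: (real^'n) measure))"
  proof (rule nn_integral_cong)
    fix x
    have "(\<integral>\<^sup>+y. indicator A (x + f y) * indicator {..<1} (norm y) \<partial>lborel)
        = (\<integral>\<^sup>+y. indicator A (x + f (- g x + y)) * indicator {..<1} (norm (- g x + y)) \<partial>lborel)"
      by (rule nn_integral_lborel_translate[symmetric]) measurable
    then show "(\<integral>\<^sup>+y. indicator A (x + f y) * indicator {..<1} (norm y) \<partial>lborel)
        = (\<integral>\<^sup>+y. indicator A (f y) * indicator {..<1} (norm (y - g x)) \<partial>lborel)"
      using lin by (simp add: linear_add linear_neg linear_diff fg)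
  qed
  also have "\<dots> = (\<integral>\<^sup>+x. \<integral>\<^sup>+y. indicator A (f y) * indicator {..<1} (norm (f y - x)) \<partial>lborel \<partial>(lborel :: (real^'n) measure))"
  proof (intro nn_integral_cong arg_cong2[where f="(*)"] refl)
    fix x y
    have "norm (y - g x) = norm (f y - x)"
      using f lin by (metis fg linear_diff orthogonal_transformation_norm)
    then show "indicator {..<1} (norm (y - g x)) = (indicator {..<1} (norm (f y - x)) :: ennreal)"
      by simp
  qed
  also have "\<dots> = (\<integral>\<^sup>+y. \<integral>\<^sup>+x. indicator A (f y) * indicator {..<1} (norm (f y - x)) \<partial>lborel \<partial>(lborel :: (real^'n) measure))"
  proof (rule lborel_pair.Fubini')
    show "(\<lambda>(y, x). indicator A (f y) * indicator {..<1} (norm (f y - x)) :: ennreal) \<in> borel_measurable (lborel \<Otimes>\<^sub>M lborel)"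
      by measurable
  qed
  also have "\<dots> = (\<integral>\<^sup>+y. indicator A (f y) * b \<partial>lborel)"
    by (intro nn_integral_cong) (simp add: nn_integral_cmult bI)
  also have "\<dots> = (\<integral>\<^sup>+y. indicator A (f y) \<partial>lborel) * b" by (rule nn_integral_multc) measurable
  also have "(\<integral>\<^sup>+y. indicator A (f y) \<partial>lborel) = (\<integral>\<^sup>+y. indicator A y \<partial>distr lborel borel f)"
    by (rule nn_integral_distr[symmetric]) auto
  also have "\<dots> = emeasure (distr lborel borel f) A" by simp
  finally have "I = emeasure (distr lborel borel f) A * b" .
  with 1 have "b * emeasure (distr lborel borel f) A = b * emeasure lborel A"
    by (simp only: mult.commute)
  then show "emeasure (distr lborel borel f) A = emeasure lborel A"
    using b0 by (simp add: ennreal_mult_cancel_left)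
qed simp

lemma nn_integral_lborel_orthogonal:
  fixes f :: "real^'n \<Rightarrow> real^'n"
  assumes "orthogonal_transformation f" "g \<in> borel_measurable borel"
  shows "(\<integral>\<^sup>+z. g (f z) \<partial>lborel) = (\<integral>\<^sup>+z. g z \<partial>lborel)"
proof -
  have "(\<integral>\<^sup>+z. g z \<partial>distr lborel borel f) = (\<integral>\<^sup>+z. g (f z) \<partial>lborel)"
    using assms orthogonal_transformation_measurable[OF assms(1)] by (intro nn_integral_distr) auto
  then show ?thesis using distr_lborel_orthogonal[OF assms(1)] by simp
qed

lemma product_sigma_finite_lborel: "product_sigma_finite (\<lambda>_. lborel :: real measure)"
  by standard

lemma distr_PiM_lborel_reindex:
  fixes \<phi> :: "'j \<Rightarrow> 'i"
  assumes fin: "finite J" and bij: "bij_betw \<phi> J I"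
  shows "distr (\<Pi>\<^sub>M i\<in>I. lborel) (\<Pi>\<^sub>M j\<in>J. lborel) (\<lambda>x. \<lambda>j\<in>J. x (\<phi> j)) = (\<Pi>\<^sub>M j\<in>J. lborel :: real measure)"
proof -
  interpret I: product_sigma_finite "\<lambda>_::'i. lborel :: real measure" by (rule product_sigma_finite_lborel)
  interpret J: product_sigma_finite "\<lambda>_::'j. lborel :: real measure" by (rule product_sigma_finite_lborel)
  have \<phi>: "\<phi> j \<in> I" if "j \<in> J" for j using bij that by (auto simp: bij_betw_def)
  have finI: "finite I" using fin bij bij_betw_finite by blast
  have m[measurable]: "(\<lambda>x. \<lambda>j\<in>J. x (\<phi> j)) \<in> (\<Pi>\<^sub>M i\<in>I. lborel :: real measure) \<rightarrow>\<^sub>M (\<Pi>\<^sub>M j\<in>J. lborel :: real measure)"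
    by (intro measurable_restrict measurable_component_singleton \<phi>)
  show ?thesis
  proof (rule J.PiM_eqI[OF fin])
    fix A :: "'j \<Rightarrow> real set" assume A: "\<And>j. j \<in> J \<Longrightarrow> A j \<in> sets lborel"
    define \<psi> where "\<psi> = the_inv_into J \<phi>"
    have \<psi>: "\<psi> (\<phi> j) = j" if "j \<in> J" for j
      using bij that by (simp add: \<psi>_def bij_betw_def the_inv_into_f_f)
    have \<psi>J: "\<psi> i \<in> J" "\<phi> (\<psi> i) = i" if "i \<in> I" for i
      using bij that \<psi> by (auto simp: bij_betw_def)
    have "(\<lambda>x. \<lambda>j\<in>J. x (\<phi> j)) -` Pi\<^sub>E J A \<inter> space (\<Pi>\<^sub>M i\<in>I. lborel :: real measure) = Pi\<^sub>E I (\<lambda>i. A (\<psi> i))"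
    proof (intro set_eqI iffI)
      fix x assume "x \<in> (\<lambda>x. \<lambda>j\<in>J. x (\<phi> j)) -` Pi\<^sub>E J A \<inter> space (\<Pi>\<^sub>M i\<in>I. lborel :: real measure)"
      then have x: "\<And>j. j \<in> J \<Longrightarrow> x (\<phi> j) \<in> A j" "x \<in> extensional I"
        by (auto simp: space_PiM PiE_def Pi_iff)
      then have "x i \<in> A (\<psi> i)" if "i \<in> I" for i using \<psi>J[OF that] x(1)[of "\<psi> i"] by simp
      then show "x \<in> Pi\<^sub>E I (\<lambda>i. A (\<psi> i))" using x(2) by (auto simp: PiE_def)
    next
      fix x assume x: "x \<in> Pi\<^sub>E I (\<lambda>i. A (\<psi> i))"
      then have "x (\<phi> j) \<in> A j" if "j \<in> J" for j using PiE_mem[OF x \<phi>[OF that]] \<psi>[OF that] by simp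
      then show "x \<in> (\<lambda>x. \<lambda>j\<in>J. x (\<phi> j)) -` Pi\<^sub>E J A \<inter> space (\<Pi>\<^sub>M i\<in>I. lborel :: real measure)"
        using x by (auto simp: space_PiM PiE_def)
    qed
    moreover have "Pi\<^sub>E J A \<in> sets (\<Pi>\<^sub>M j\<in>J. lborel :: real measure)"
      using fin A by (intro sets_PiM_I_finite) auto
    ultimately have "emeasure (distr (\<Pi>\<^sub>M i\<in>I. lborel) (\<Pi>\<^sub>M j\<in>J. lborel) (\<lambda>x. \<lambda>j\<in>J. x (\<phi> j))) (Pi\<^sub>E J A)
        = emeasure (\<Pi>\<^sub>M i\<in>I. lborel :: real measure) (Pi\<^sub>E I (\<lambda>i. A (\<psi> i)))"
      by (simp add: emeasure_distr[OF m])
    also have "\<dots> = (\<Prod>i\<in>I. emeasure lborel (A (\<psi> i)))"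
      using A \<psi>J by (intro I.emeasure_PiM finI) auto
    also have "\<dots> = (\<Prod>j\<in>J. emeasure lborel (A (\<psi> (\<phi> j))))"
      by (rule prod.reindex_bij_betw[OF bij, symmetric])
    also have "\<dots> = (\<Prod>j\<in>J. emeasure lborel (A j))" by (intro prod.cong) (auto simp: \<psi>)
    finally show "emeasure (distr (\<Pi>\<^sub>M i\<in>I. lborel) (\<Pi>\<^sub>M j\<in>J. lborel) (\<lambda>x. \<lambda>j\<in>J. x (\<phi> j))) (Pi\<^sub>E J A)
        = (\<Prod>j\<in>J. emeasure lborel (A j))" .
  qed simp
qed

definition orthonormal_spanning :: "(real^'n) set \<Rightarrow> (real^'n) set \<Rightarrow> bool" where
  "orthonormal_spanning B S \<longleftrightarrow> pairwise orthogonal B \<and> (\<forall>b\<in>B. norm b = 1) \<and> span B = S"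

lemma orthonormal_spanning_independent:
  assumes "orthonormal_spanning B S"
  shows "independent B" "finite B"
proof -
  have "0 \<notin> B" using assms by (force simp: orthonormal_spanning_def)
  then show "independent B" using assms pairwise_orthogonal_independent by (auto simp: orthonormal_spanning_def)
  then show "finite B" by (rule independent_imp_finite)
qed

text \<open>The map \<open>Q\<close> carrying the standard basis to \<open>B\<close> is orthogonal
  and so preserves \<open>lborel\<close>, which is itself a product over \<open>Basis\<close>; a
  bijection \<open>\<phi>\<close> moves the index set to \<open>B\<close>.\<close>

lemma lborel_orthonormal:
  fixes B :: "(real^'n) set"
  assumes B: "orthonormal_spanning B UNIV"
  shows "lborel = distr (\<Pi>\<^sub>M b\<in>B. lborel) borel (\<lambda>x. \<Sum>b\<in>B. x b *\<^sub>R b)"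
proof -
  note ind = orthonormal_spanning_independent[OF B]
  have orth: "a \<bullet> b = (if a = b then 1 else 0)" if "a \<in> B" "b \<in> B" for a b
    using B that by (auto simp: orthonormal_spanning_def pairwise_def orthogonal_def dot_square_norm)
  have "card B = dim (UNIV :: (real^'n) set)"
    using B ind by (intro basis_card_eq_dim) (auto simp: orthonormal_spanning_def)
  then have "card (Basis :: (real^'n) set) = card B" by (simp add: dim_UNIV)
  then obtain \<phi> where \<phi>: "bij_betw \<phi> (Basis :: (real^'n) set) B"
    using finite_same_card_bij[OF finite_Basis ind(2)] by blast
  have \<phi>B: "\<phi> j \<in> B" if "j \<in> Basis" for j using \<phi> that by (auto simp: bij_betw_def)
  have orth\<phi>: "\<phi> i \<bullet> \<phi> j = (if i = j then 1 else 0)" if "i \<in> Basis" "j \<in> Basis" for i j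
    using orth[OF \<phi>B \<phi>B, OF that] \<phi> that by (auto simp: bij_betw_def inj_on_def)
  define Q where "Q z = (\<Sum>j\<in>Basis. (z \<bullet> j) *\<^sub>R \<phi> j)" for z :: "real^'n"
  have "orthogonal_transformation Q"
    unfolding orthogonal_transformation_def
  proof (intro conjI allI)
    show "linear Q" unfolding Q_def
      by (intro linear_compose_sum ballI linearI) (auto simp: inner_add_left scaleR_add_left)
    show "Q v \<bullet> Q w = v \<bullet> w" for v w
    proof -
      have "Q v \<bullet> Q w = (\<Sum>i\<in>Basis. \<Sum>j\<in>Basis. (v \<bullet> i) * (w \<bullet> j) * (\<phi> i \<bullet> \<phi> j))"
        unfolding Q_def
        by (simp add: inner_sum_left inner_sum_right sum_distrib_left)
           (subst sum.swap, simp add: mult_ac)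
      also have "\<dots> = (\<Sum>i\<in>Basis. \<Sum>j\<in>Basis. (if i = j then (v \<bullet> i) * (w \<bullet> j) else 0))"
        by (intro sum.cong) (auto simp: orth\<phi>)
      also have "\<dots> = (\<Sum>i\<in>Basis. (v \<bullet> i) * (w \<bullet> i))" by (simp add: sum.delta)
      finally show ?thesis by (simp add: euclidean_inner[of v w])
    qed
  qed
  then have Qm[measurable]: "Q \<in> borel_measurable borel" and QQ: "distr lborel borel Q = lborel"
    by (rule orthogonal_transformation_measurable, rule distr_lborel_orthogonal)
  have r[measurable]: "(\<lambda>x. \<lambda>j\<in>Basis. x (\<phi> j)) \<in> (\<Pi>\<^sub>M b\<in>B. lborel :: real measure) \<rightarrow>\<^sub>M (\<Pi>\<^sub>M j\<in>Basis. lborel :: real measure)"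
    by (intro measurable_restrict measurable_component_singleton \<phi>B)
  have s[measurable]: "(\<lambda>x. \<Sum>j\<in>Basis. x j *\<^sub>R (j :: real^'n)) \<in> (\<Pi>\<^sub>M j\<in>Basis. lborel :: real measure) \<rightarrow>\<^sub>M borel"
    by measurable
  have "lborel = distr (distr (distr (\<Pi>\<^sub>M b\<in>B. lborel) (\<Pi>\<^sub>M j\<in>Basis. lborel) (\<lambda>x. \<lambda>j\<in>Basis. x (\<phi> j)))
      borel (\<lambda>x. \<Sum>j\<in>Basis. x j *\<^sub>R (j :: real^'n))) borel Q"
    unfolding distr_PiM_lborel_reindex[OF finite_Basis \<phi>] lborel_eq[symmetric] QQ ..
  also have "\<dots> = distr (\<Pi>\<^sub>M b\<in>B. lborel) borel (\<lambda>x. Q (\<Sum>j\<in>Basis. (\<lambda>j\<in>Basis. x (\<phi> j)) j *\<^sub>R j))"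
    unfolding distr_distr[OF s r] distr_distr[OF Qm measurable_comp[OF r s]]
    unfolding comp_def ..
  also have "(\<lambda>x. Q (\<Sum>j\<in>Basis. (\<lambda>j\<in>Basis. x (\<phi> j)) j *\<^sub>R j)) = (\<lambda>x. \<Sum>b\<in>B. x b *\<^sub>R b)"
  proof
    fix x :: "real^'n \<Rightarrow> real"
    have "Q (\<Sum>j\<in>Basis. (\<lambda>j\<in>Basis. x (\<phi> j)) j *\<^sub>R j) = (\<Sum>j\<in>Basis. x (\<phi> j) *\<^sub>R \<phi> j)"
      unfolding Q_def by (intro sum.cong) (auto simp: inner_sum_left inner_Basis if_distrib sum.delta cong: if_cong)
    also have "\<dots> = (\<Sum>b\<in>B. x b *\<^sub>R b)" by (rule sum.reindex_bij_betw[OF \<phi>])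
    finally show "Q (\<Sum>j\<in>Basis. (\<lambda>j\<in>Basis. x (\<phi> j)) j *\<^sub>R j) = (\<Sum>b\<in>B. x b *\<^sub>R b)" .
  qed
  finally show ?thesis .
qed

section \<open>Integrals over a hyperplane as integrals over a slab\<close>

abbreviation perp_lborel :: "real^'n \<Rightarrow> (real^'n) measure" where
  "perp_lborel u \<equiv> subspace_lborel {p. p \<bullet> u = 0}"

lemma subspace_lborel_orthonormal:
  fixes S :: "(real^'n) set"
  assumes "subspace S"
  obtains B where "orthonormal_spanning B S"
    "subspace_lborel S = distr (\<Pi>\<^sub>M b\<in>B. lborel) borel (\<lambda>f. \<Sum>b\<in>B. f b *\<^sub>R b)"
proof -
  define B where "B = (SOME B. pairwise orthogonal B \<and> (\<forall>b\<in>B. norm b = 1) \<and> span B = S)"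
  obtain B' where "pairwise orthogonal B' \<and> (\<forall>b\<in>B'. norm b = 1) \<and> span B' = S"
    using orthonormal_basis_subspace[OF assms] by metis
  then have "orthonormal_spanning B S"
    unfolding B_def orthonormal_spanning_def by (rule someI)
  moreover have "subspace_lborel S = distr (\<Pi>\<^sub>M b\<in>B. lborel) borel (\<lambda>f. \<Sum>b\<in>B. f b *\<^sub>R b)"
    by (simp only: subspace_lborel_def B_def Let_def)
  ultimately show ?thesis using that by blast
qed

lemma sets_subspace_lborel [simp, measurable_cong]: "sets (subspace_lborel S) = sets borel"
  by (simp add: subspace_lborel_def Let_def)

lemma space_subspace_lborel [simp]: "space (subspace_lborel S) = UNIV"
  by (simp add: subspace_lborel_def Let_def)

text \<open>Adding \<open>u\<close> to an orthonormal basis of its complement gives one of the whole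
  space, and Fubini separates the coordinate along \<open>u\<close>.\<close>

lemma
  fixes u :: "real^'n"
  assumes u: "norm u = 1"
  shows AE_perp_lborel: "AE p in perp_lborel u. p \<bullet> u = 0"
    and nn_integral_lborel_perp: "F \<in> borel_measurable borel \<Longrightarrow>
      (\<integral>\<^sup>+z. F z \<partial>lborel) = (\<integral>\<^sup>+p. \<integral>\<^sup>+t. F (p + t *\<^sub>R u) \<partial>lborel \<partial>perp_lborel u)"
proof -
  have "subspace {p. p \<bullet> u = 0}" by (auto simp: subspace_def inner_add_left)
  then obtain B where B: "orthonormal_spanning B {p. p \<bullet> u = 0}"
    and eq: "perp_lborel u = distr (\<Pi>\<^sub>M b\<in>B. lborel) borel (\<lambda>f. \<Sum>b\<in>B. f b *\<^sub>R b)"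
    by (rule subspace_lborel_orthonormal)
  note ind = orthonormal_spanning_independent[OF B]
  have Bu: "b \<bullet> u = 0" if "b \<in> B" for b
    using B that span_base[OF that] by (auto simp: orthonormal_spanning_def)
  then have uB: "u \<notin> B" using u by fastforce
  have B': "orthonormal_spanning (insert u B) UNIV"
    unfolding orthonormal_spanning_def
  proof (intro conjI)
    show "pairwise orthogonal (insert u B)"
      using B Bu by (auto simp: orthonormal_spanning_def pairwise_insert orthogonal_def inner_commute)
    show "\<forall>b\<in>insert u B. norm b = 1" using B u by (auto simp: orthonormal_spanning_def)
    show "span (insert u B) = UNIV"
    proof (intro set_eqI iffI UNIV_I)
      fix z :: "real^'n"
      have "z - (z \<bullet> u) *\<^sub>R u \<in> span B"
        using B u by (auto simp: orthonormal_spanning_def inner_diff_left dot_square_norm)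
      then have "z - (z \<bullet> u) *\<^sub>R u \<in> span (insert u B)" using span_mono[of B "insert u B"] by blast
      moreover have "(z \<bullet> u) *\<^sub>R u \<in> span (insert u B)" by (intro span_scale span_base) simp
      ultimately show "z \<in> span (insert u B)" using span_add by fastforce
    qed
  qed
  interpret product_sigma_finite "\<lambda>_::real^'n. lborel :: real measure" by (rule product_sigma_finite_lborel)
  have s[measurable]: "(\<lambda>x. \<Sum>b\<in>B. x b *\<^sub>R b) \<in> (\<Pi>\<^sub>M b\<in>B. lborel :: real measure) \<rightarrow>\<^sub>M borel"
    by measurable
  have s'[measurable]: "(\<lambda>x. \<Sum>b\<in>insert u B. x b *\<^sub>R b) \<in> (\<Pi>\<^sub>M b\<in>insert u B. lborel :: real measure) \<rightarrow>\<^sub>M borel"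
    by measurable
  show "AE p in perp_lborel u. p \<bullet> u = 0"
    unfolding eq by (subst AE_distr_iff) (auto simp: inner_sum_left Bu)
  assume F[measurable]: "F \<in> borel_measurable borel"
  have "(\<integral>\<^sup>+z. F z \<partial>lborel) = (\<integral>\<^sup>+x. F (\<Sum>b\<in>insert u B. x b *\<^sub>R b) \<partial>(\<Pi>\<^sub>M b\<in>insert u B. lborel))"
    by (subst lborel_orthonormal[OF B'], subst nn_integral_distr) auto
  also have "\<dots> = (\<integral>\<^sup>+x. \<integral>\<^sup>+t. F (\<Sum>b\<in>insert u B. (x(u := t)) b *\<^sub>R b) \<partial>lborel \<partial>(\<Pi>\<^sub>M b\<in>B. lborel))"
    by (rule product_nn_integral_insert[OF ind(2) uB]) measurable
  also have "\<dots> = (\<integral>\<^sup>+x. \<integral>\<^sup>+t. F ((\<Sum>b\<in>B. x b *\<^sub>R b) + t *\<^sub>R u) \<partial>lborel \<partial>(\<Pi>\<^sub>M b\<in>B. lborel))"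
  proof (intro nn_integral_cong arg_cong[where f=F])
    fix x t
    have "(\<Sum>b\<in>B. (x(u := t)) b *\<^sub>R b) = (\<Sum>b\<in>B. x b *\<^sub>R b)"
      using uB by (intro sum.cong) auto
    then show "(\<Sum>b\<in>insert u B. (x(u := t)) b *\<^sub>R b) = (\<Sum>b\<in>B. x b *\<^sub>R b) + t *\<^sub>R u"
      using ind(2) uB by simp
  qed
  also have "\<dots> = (\<integral>\<^sup>+p. \<integral>\<^sup>+t. F (p + t *\<^sub>R u) \<partial>lborel \<partial>perp_lborel u)"
    unfolding eq by (subst nn_integral_distr) auto
  finally show "(\<integral>\<^sup>+z. F z \<partial>lborel) = (\<integral>\<^sup>+p. \<integral>\<^sup>+t. F (p + t *\<^sub>R u) \<partial>lborel \<partial>perp_lborel u)" .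
qed

text \<open>On each line parallel to \<open>u\<close> the factor \<open>h\<close> is constant and
  the slab condition cuts out an interval of length
  \<open>(b - a) / \<bar>u \<bullet> w\<bar>\<close>. A slab normal to a second direction
  \<open>w\<close> is allowed for the sake of \<open>nn_integral_perp_lborel_change\<close>.\<close>

lemma nn_integral_window:
  fixes u w :: "real^'n"
  assumes u: "norm u = 1" and w: "u \<bullet> w \<noteq> 0" and h[measurable]: "h \<in> borel_measurable borel"
    and ab: "a \<le> b"
  shows "(\<integral>\<^sup>+z. indicator {a..b} (z \<bullet> w) * h (z - (z \<bullet> u) *\<^sub>R u) \<partial>lborel)
    = ennreal ((b - a) / \<bar>u \<bullet> w\<bar>) * (\<integral>\<^sup>+p. h p \<partial>perp_lborel u)"
proof -
  have t: "(\<integral>\<^sup>+t. indicator {a..b} (s + (u \<bullet> w) * t) \<partial>lborel) = ennreal ((b - a) / \<bar>u \<bullet> w\<bar>)" for s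
  proof -
    have "ennreal (b - a) = (\<integral>\<^sup>+x. indicator {a..b} x \<partial>lborel)" using ab by simp
    also have "\<dots> = ennreal \<bar>u \<bullet> w\<bar> * (\<integral>\<^sup>+t. indicator {a..b} (s + (u \<bullet> w) * t) \<partial>lborel)"
      by (rule nn_integral_real_affine) (use w in auto)
    finally have "ennreal (b - a) / ennreal \<bar>u \<bullet> w\<bar>
        = (\<integral>\<^sup>+t. indicator {a..b} (s + (u \<bullet> w) * t) \<partial>lborel) * ennreal \<bar>u \<bullet> w\<bar> / ennreal \<bar>u \<bullet> w\<bar>"
      by (simp only: mult.commute)
    also have "\<dots> = (\<integral>\<^sup>+t. indicator {a..b} (s + (u \<bullet> w) * t) \<partial>lborel)"
      using w by (intro mult_divide_eq_ennreal) auto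
    finally have "ennreal (b - a) / ennreal \<bar>u \<bullet> w\<bar> = \<dots>" .
    then show ?thesis using w ab by (simp add: divide_ennreal)
  qed
  have "(\<integral>\<^sup>+z. indicator {a..b} (z \<bullet> w) * h (z - (z \<bullet> u) *\<^sub>R u) \<partial>lborel)
    = (\<integral>\<^sup>+p. \<integral>\<^sup>+t. indicator {a..b} ((p + t *\<^sub>R u) \<bullet> w) *
        h ((p + t *\<^sub>R u) - ((p + t *\<^sub>R u) \<bullet> u) *\<^sub>R u) \<partial>lborel \<partial>perp_lborel u)"
    by (rule nn_integral_lborel_perp[OF u]) measurable
  also have "\<dots> = (\<integral>\<^sup>+p. ennreal ((b - a) / \<bar>u \<bullet> w\<bar>) * h p \<partial>perp_lborel u)"
  proof (rule nn_integral_cong_AE, rule AE_mp[OF AE_perp_lborel[OF u]], rule AE_I2, rule impI)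
    fix p :: "real^'n" assume p: "p \<bullet> u = 0"
    have "(\<integral>\<^sup>+t. indicator {a..b} ((p + t *\<^sub>R u) \<bullet> w) *
        h ((p + t *\<^sub>R u) - ((p + t *\<^sub>R u) \<bullet> u) *\<^sub>R u) \<partial>lborel)
      = (\<integral>\<^sup>+t. indicator {a..b} (p \<bullet> w + (u \<bullet> w) * t) * h p \<partial>lborel)"
      using p u by (intro nn_integral_cong) (simp add: inner_add_left dot_square_norm mult.commute)
    also have "\<dots> = (\<integral>\<^sup>+t. indicator {a..b} (p \<bullet> w + (u \<bullet> w) * t) \<partial>lborel) * h p"
      by (rule nn_integral_multc) measurable
    finally show "(\<integral>\<^sup>+t. indicator {a..b} ((p + t *\<^sub>R u) \<bullet> w) *
        h ((p + t *\<^sub>R u) - ((p + t *\<^sub>R u) \<bullet> u) *\<^sub>R u) \<partial>lborel)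
      = ennreal ((b - a) / \<bar>u \<bullet> w\<bar>) * h p" by (simp add: t)
  qed
  also have "\<dots> = ennreal ((b - a) / \<bar>u \<bullet> w\<bar>) * (\<integral>\<^sup>+p. h p \<partial>perp_lborel u)"
    by (rule nn_integral_cmult) measurable
  finally show ?thesis .
qed

text \<open>The right-hand side is free of the chosen basis, and \<open>u\<close> occurs only in the
  integrand, so measurability in \<open>u\<close> becomes visible.\<close>

lemma nn_integral_perp_lborel:
  fixes u :: "real^'n"
  assumes u: "norm u = 1" and h: "h \<in> borel_measurable borel"
  shows "(\<integral>\<^sup>+p. h p \<partial>perp_lborel u)
    = (\<integral>\<^sup>+z. indicator {0..1} (z \<bullet> u) * h (z - (z \<bullet> u) *\<^sub>R u) \<partial>lborel)"
  using nn_integral_window[OF u _ h, of u 0 1] u by (simp add: dot_square_norm)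

lemma nn_integral_perp_lborel_affine:
  fixes u v :: "real^'n"
  assumes u: "norm u = 1" and v: "v \<bullet> u = 0" and d: "0 < d"
    and h[measurable]: "h \<in> borel_measurable borel"
  shows "(\<integral>\<^sup>+p. h p \<partial>perp_lborel u)
    = ennreal (d ^ (CARD('n) - 1)) * (\<integral>\<^sup>+q. h (v + d *\<^sub>R q) \<partial>perp_lborel u)"
proof -
  \<comment> \<open>A slab of thickness \<open>d\<close> scales to the unit slab and so takes up one
    of the n factors \<open>d\<close> in the scaling of \<open>lborel\<close>.\<close>
  define F where "F z = indicator {0..d} (z \<bullet> u) * h (z - (z \<bullet> u) *\<^sub>R u)" for z
  have Fm[measurable]: "F \<in> borel_measurable borel" unfolding F_def by measurable
  have "ennreal d * (\<integral>\<^sup>+p. h p \<partial>perp_lborel u) = (\<integral>\<^sup>+z. F z \<partial>lborel)"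
    unfolding F_def using nn_integral_window[OF u _ h, of u 0 d] u d by (simp add: dot_square_norm)
  also have "\<dots> = (\<integral>\<^sup>+z. F z \<partial>density (distr lborel borel (\<lambda>x. v + d *\<^sub>R x)) (\<lambda>_. ennreal (\<bar>d\<bar> ^ DIM(real^'n))))"
    using lborel_affine[of d v] d by simp
  also have "\<dots> = ennreal (d ^ CARD('n)) * (\<integral>\<^sup>+z. F (v + d *\<^sub>R z) \<partial>lborel)"
    using d by (simp add: nn_integral_density nn_integral_distr nn_integral_cmult)
  also have "(\<integral>\<^sup>+z. F (v + d *\<^sub>R z) \<partial>lborel)
      = (\<integral>\<^sup>+z. indicator {0..1} (z \<bullet> u) * h (v + d *\<^sub>R (z - (z \<bullet> u) *\<^sub>R u)) \<partial>lborel)"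
  proof (intro nn_integral_cong)
    fix z :: "real^'n"
    have "(d * (z \<bullet> u) \<in> {0..d}) = (z \<bullet> u \<in> {0..1})" using d by (auto simp: zero_le_mult_iff)
    then show "F (v + d *\<^sub>R z) = indicator {0..1} (z \<bullet> u) * h (v + d *\<^sub>R (z - (z \<bullet> u) *\<^sub>R u))"
      using v by (simp add: F_def inner_add_left indicator_def algebra_simps)
  qed
  also have "\<dots> = (\<integral>\<^sup>+q. h (v + d *\<^sub>R q) \<partial>perp_lborel u)"
    by (rule nn_integral_perp_lborel[OF u, symmetric]) measurable
  also have "ennreal (d ^ CARD('n)) = ennreal d * ennreal (d ^ (CARD('n) - 1))"
    using d by (simp add: ennreal_mult[symmetric] power_eq_if[of d "CARD('n)"])
  finally show ?thesis using d by (simp add: mult.assoc ennreal_mult_cancel_left)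
qed

lemma emeasure_perp_lborel_eq:
  fixes u :: "real^'n"
  assumes u: "norm u = 1" and "A \<in> sets borel"
  shows "emeasure (perp_lborel u) A
    = (\<integral>\<^sup>+z. indicator {0..1} (z \<bullet> u) * indicator A (z - (z \<bullet> u) *\<^sub>R u) \<partial>lborel)"
  using nn_integral_perp_lborel[OF u, of "indicator A"] assms by simp

lemma norm_le_proj:
  fixes u :: "'a::real_inner"
  assumes "norm u = 1"
  shows "norm z \<le> norm (z - (z \<bullet> u) *\<^sub>R u) + \<bar>z \<bullet> u\<bar>"
  using norm_triangle_ineq[of "z - (z \<bullet> u) *\<^sub>R u" "(z \<bullet> u) *\<^sub>R u"] assms by simp

lemma norm_proj_le:
  fixes u :: "'a::real_inner"
  assumes "norm u = 1"
  shows "norm (z - (z \<bullet> u) *\<^sub>R u) \<le> norm z"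
proof -
  have "norm (z - (z \<bullet> u) *\<^sub>R u) ^ 2 + (z \<bullet> u)^2 = norm z ^ 2"
    unfolding power2_norm_eq_inner using assms[unfolded norm_eq_1]
    by (simp add: inner_diff_left inner_diff_right inner_commute power2_eq_square)
  then have "norm (z - (z \<bullet> u) *\<^sub>R u) ^ 2 \<le> norm z ^ 2" by (metis add_le_same_cancel1 add.commute le_add_same_cancel1 zero_le_power2)
  then show ?thesis by (rule power2_le_imp_le) simp
qed

lemma emeasure_perp_lborel_cball_le:
  fixes u :: "real^'n"
  assumes u: "norm u = 1"
  shows "emeasure (perp_lborel u) (cball 0 r) \<le> emeasure lborel (cball (0::real^'n) (r + 1))"
proof -
  have "emeasure (perp_lborel u) (cball 0 r) \<le> (\<integral>\<^sup>+z. indicator (cball (0::real^'n) (r + 1)) z \<partial>lborel)"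
    unfolding emeasure_perp_lborel_eq[OF u borel_closed[OF closed_cball]]
  proof (intro nn_integral_mono)
    fix z :: "real^'n"
    show "indicator {0..1} (z \<bullet> u) * indicator (cball 0 r) (z - (z \<bullet> u) *\<^sub>R u)
        \<le> (indicator (cball 0 (r + 1)) z :: ennreal)"
      using norm_le_proj[OF u, of z] by (auto simp: indicator_def)
  qed
  then show ?thesis by simp
qed

lemma sigma_finite_perp_lborel:
  fixes u :: "real^'n"
  assumes u: "norm u = 1"
  shows "sigma_finite_measure (perp_lborel u)"
proof
  have "emeasure (perp_lborel u) (cball 0 r) \<noteq> top" for r
    by (rule less_imp_neq, rule le_less_trans[OF emeasure_perp_lborel_cball_le[OF u] emeasure_lborel_cball_finite[unfolded infinity_ennreal_def]])
  moreover have "\<Union> (range (\<lambda>k::nat. cball (0::real^'n) (real k))) = UNIV"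
    using real_arch_simple by (auto simp: dist_norm)
  ultimately show "\<exists>A. countable A \<and> A \<subseteq> sets (perp_lborel u) \<and> \<Union> A = space (perp_lborel u) \<and>
      (\<forall>a\<in>A. emeasure (perp_lborel u) a \<noteq> \<infinity>)"
    by (intro exI[of _ "range (\<lambda>k::nat. cball 0 (real k))"]) auto
qed

text \<open>The substitution is the projection along \<open>u\<close> onto the hyperplane of
  \<open>n\<close>. The slab \<open>0 \<le> z \<bullet> n \<le> 1\<close> is fibred once along
  \<open>u\<close> and once along \<open>n\<close>, and comparing the two gives the Jacobian, from
  which all later cosines stem.\<close>

lemma nn_integral_perp_lborel_change:
  fixes u n :: "real^'n"
  assumes u: "norm u = 1" and n: "norm n = 1" and un: "u \<bullet> n \<noteq> 0"
    and g[measurable]: "g \<in> borel_measurable borel"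
  shows "(\<integral>\<^sup>+p. g (p - ((p \<bullet> n) / (u \<bullet> n)) *\<^sub>R u) \<partial>perp_lborel u)
    = ennreal \<bar>u \<bullet> n\<bar> * (\<integral>\<^sup>+q. g q \<partial>perp_lborel n)"
proof -
  define \<tau> where "\<tau> p = p - ((p \<bullet> n) / (u \<bullet> n)) *\<^sub>R u" for p
  have [measurable]: "\<tau> \<in> borel_measurable borel" unfolding \<tau>_def by measurable
  interpret sigma_finite_measure "perp_lborel n" by (rule sigma_finite_perp_lborel[OF n])
  interpret P: pair_sigma_finite "lborel :: real measure" "perp_lborel n" ..
  \<comment> \<open>\<open>c\<close> is the image of \<open>n\<close> under \<open>\<tau>\<close>.
    It lies in the hyperplane of \<open>n\<close>, so a move along \<open>n\<close> only translates
    the integrand there.\<close>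
  define c where "c = n - (1 / (u \<bullet> n)) *\<^sub>R u"
  have cn: "c \<bullet> n = 0" using un n by (simp add: c_def inner_diff_left dot_square_norm)
  have "ennreal (1 / \<bar>u \<bullet> n\<bar>) * (\<integral>\<^sup>+p. g (\<tau> p) \<partial>perp_lborel u)
    = (\<integral>\<^sup>+z. indicator {0..1} (z \<bullet> n) * g (\<tau> (z - (z \<bullet> u) *\<^sub>R u)) \<partial>lborel)"
    using nn_integral_window[OF u un, of "\<lambda>p. g (\<tau> p)" 0 1] by simp
  also have "\<dots> = (\<integral>\<^sup>+z. indicator {0..1} (z \<bullet> n) * g (\<tau> z) \<partial>lborel)"
  proof (intro nn_integral_cong arg_cong2[where f="(*)"] arg_cong[where f=g] refl)
    fix z :: "real^'n"
    show "\<tau> (z - (z \<bullet> u) *\<^sub>R u) = \<tau> z"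
      using un by (simp add: \<tau>_def inner_diff_left diff_divide_distrib scaleR_diff_left)
  qed
  also have "\<dots> = (\<integral>\<^sup>+p. \<integral>\<^sup>+t. indicator {0..1} ((p + t *\<^sub>R n) \<bullet> n) * g (\<tau> (p + t *\<^sub>R n)) \<partial>lborel \<partial>perp_lborel n)"
    by (rule nn_integral_lborel_perp[OF n]) measurable
  also have "\<dots> = (\<integral>\<^sup>+p. \<integral>\<^sup>+t. indicator {0..1} t * g (t *\<^sub>R c + 1 *\<^sub>R p) \<partial>lborel \<partial>perp_lborel n)"
  proof (rule nn_integral_cong_AE, rule AE_mp[OF AE_perp_lborel[OF n]], rule AE_I2, rule impI)
    fix p :: "real^'n" assume p: "p \<bullet> n = 0"
    have "\<tau> (p + t *\<^sub>R n) = t *\<^sub>R c + p" for t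
      using p n by (simp add: \<tau>_def c_def inner_add_left dot_square_norm algebra_simps)
    then show "(\<integral>\<^sup>+t. indicator {0..1} ((p + t *\<^sub>R n) \<bullet> n) * g (\<tau> (p + t *\<^sub>R n)) \<partial>lborel)
        = (\<integral>\<^sup>+t. indicator {0..1} t * g (t *\<^sub>R c + 1 *\<^sub>R p) \<partial>lborel)"
      using p n by (simp add: inner_add_left dot_square_norm)
  qed
  also have "\<dots> = (\<integral>\<^sup>+t. \<integral>\<^sup>+p. indicator {0..1} t * g (t *\<^sub>R c + 1 *\<^sub>R p) \<partial>perp_lborel n \<partial>lborel)"
    by (rule P.Fubini') measurable
  also have "\<dots> = (\<integral>\<^sup>+(t::real). indicator {0..1} t * (\<integral>\<^sup>+p. g p \<partial>perp_lborel n) \<partial>lborel)"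
  proof (intro nn_integral_cong)
    fix t :: real
    have "(\<integral>\<^sup>+p. g (t *\<^sub>R c + 1 *\<^sub>R p) \<partial>perp_lborel n) = (\<integral>\<^sup>+p. g p \<partial>perp_lborel n)"
      using nn_integral_perp_lborel_affine[OF n, of "t *\<^sub>R c" 1 g] cn by simp
    then show "(\<integral>\<^sup>+p. indicator {0..1} t * g (t *\<^sub>R c + 1 *\<^sub>R p) \<partial>perp_lborel n)
        = indicator {0..1} t * (\<integral>\<^sup>+p. g p \<partial>perp_lborel n)"
      by (subst nn_integral_cmult) auto
  qed
  also have "\<dots> = (\<integral>\<^sup>+q. g q \<partial>perp_lborel n)"
    by (subst nn_integral_multc) auto
  finally have *: "ennreal (1 / \<bar>u \<bullet> n\<bar>) * (\<integral>\<^sup>+p. g (\<tau> p) \<partial>perp_lborel u) = (\<integral>\<^sup>+q. g q \<partial>perp_lborel n)" .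
  have "(\<integral>\<^sup>+p. g (\<tau> p) \<partial>perp_lborel u)
      = ennreal \<bar>u \<bullet> n\<bar> * (ennreal (1 / \<bar>u \<bullet> n\<bar>) * (\<integral>\<^sup>+p. g (\<tau> p) \<partial>perp_lborel u))"
    using un by (simp add: mult.assoc[symmetric] ennreal_mult[symmetric])
  then show ?thesis unfolding * unfolding \<tau>_def .
qed

text \<open>The cylinder \<open>C\<close> over the disc is convex, so its frontier is a Lebesgue
  null set, and that frontier contains the cylinder over the sphere.\<close>

lemma emeasure_perp_lborel_sphere:
  fixes u :: "real^'n"
  assumes u: "norm u = 1" and r: "0 < r"
  shows "emeasure (perp_lborel u) {p. norm p = r} = 0"
proof -
  define C where "C = {z::real^'n. norm (z - (z \<bullet> u) *\<^sub>R u) \<le> r}"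
  have lin: "linear (\<lambda>z. z - (z \<bullet> u) *\<^sub>R u)"
    by (intro linearI) (auto simp: inner_add_left algebra_simps)
  have "C = (\<lambda>z. z - (z \<bullet> u) *\<^sub>R u) -` cball 0 r" by (auto simp: C_def)
  then have "convex C" using convex_linear_vimage[OF lin convex_cball] by simp
  then have "frontier C \<in> null_sets lborel"
    using negligible_convex_frontier[of C]
    by (simp add: negligible_iff_null_sets null_sets_completion_iff)
  have sub: "z \<in> frontier C" if z: "norm (z - (z \<bullet> u) *\<^sub>R u) = r" for z
  proof -
    define q where "q = z - (z \<bullet> u) *\<^sub>R u"
    have q: "norm q = r" "q \<bullet> u = 0" using z u by (auto simp: q_def inner_diff_left dot_square_norm)
    have "z + e *\<^sub>R q \<notin> C" if "e > 0" for e
    proof -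
      have "(z + e *\<^sub>R q) - ((z + e *\<^sub>R q) \<bullet> u) *\<^sub>R u = (1 + e) *\<^sub>R q"
        using q by (simp add: q_def[symmetric] inner_add_left algebra_simps) (simp add: q_def)
      then show ?thesis using that q r by (simp add: C_def)
    qed
    moreover have "\<exists>e>0. z + e *\<^sub>R q \<in> ball z d" if "d > 0" for d
      using that q r by (intro exI[of _ "d / (2 * r)"]) (auto simp: dist_norm)
    ultimately have "z \<notin> interior C" by (meson mem_interior subsetD)
    moreover have "z \<in> C" using z by (simp add: C_def)
    ultimately show ?thesis using closure_subset by (auto simp: frontier_def)
  qed
  have "{p::real^'n. norm p = r} \<in> sets borel" by measurable
  then have "emeasure (perp_lborel u) {p. norm p = r} \<le> (\<integral>\<^sup>+z. indicator (frontier C) z \<partial>lborel)"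
    unfolding emeasure_perp_lborel_eq[OF u \<open>{p::real^'n. norm p = r} \<in> sets borel\<close>]
    by (intro nn_integral_mono) (auto simp: indicator_def intro: sub[OF sym])
  also have "\<dots> = 0" using \<open>frontier C \<in> null_sets lborel\<close> by (simp add: null_setsD1)
  finally show ?thesis by simp
qed

text \<open>The volume of the (n-1)-dimensional unit ball. It carries the argument \<open>u\<close>
  because \<open>perp_lborel u\<close> involves a choice of basis; independence of \<open>u\<close>
  is \<open>unit_disc_vol_eq\<close>.\<close>

definition unit_disc_vol :: "real^'n \<Rightarrow> ennreal" where
  "unit_disc_vol u = emeasure (perp_lborel u) {p. norm p < 1}"

lemma emeasure_perp_lborel_ball:
  fixes u :: "real^'n"
  assumes u: "norm u = 1" and v: "v \<bullet> u = 0" and r: "0 < r"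
  shows "emeasure (perp_lborel u) {p. norm (p - v) < r} = ennreal (r ^ (CARD('n) - 1)) * unit_disc_vol u"
proof -
  have "(\<lambda>p. indicator {p. norm (p - v) < r} p :: ennreal) \<in> borel_measurable borel" by measurable
  from nn_integral_perp_lborel_affine[OF u v r this]
  have "emeasure (perp_lborel u) {p. norm (p - v) < r}
      = ennreal (r ^ (CARD('n) - 1)) * (\<integral>\<^sup>+q. indicator {p. norm (p - v) < r} (v + r *\<^sub>R q) \<partial>perp_lborel u)"
    by simp
  also have "(\<integral>\<^sup>+q. indicator {p. norm (p - v) < r} (v + r *\<^sub>R q) \<partial>perp_lborel u)
      = (\<integral>\<^sup>+q. indicator {p. norm p < 1} q \<partial>perp_lborel u)"
    using r by (intro nn_integral_cong) (auto simp: indicator_def)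
  finally show ?thesis by (simp add: unit_disc_vol_def)
qed

lemma unit_disc_vol_less_top:
  fixes u :: "real^'n"
  assumes "norm u = 1"
  shows "unit_disc_vol u < top"
proof -
  have "unit_disc_vol u \<le> emeasure (perp_lborel u) (cball 0 1)"
    unfolding unit_disc_vol_def by (intro emeasure_mono) auto
  also have "\<dots> \<le> emeasure lborel (cball (0::real^'n) (1 + 1))" by (rule emeasure_perp_lborel_cball_le[OF assms])
  also have "\<dots> < top" using emeasure_lborel_cball_finite by (simp add: infinity_ennreal_def)
  finally show ?thesis .
qed

lemma unit_disc_vol_pos:
  fixes u :: "real^'n"
  assumes u: "norm u = 1"
  shows "0 < unit_disc_vol u"
proof -
  \<comment> \<open>This ball of diameter 1 fits into the unit slab over the disc.\<close>
  have "0 < emeasure lborel (ball ((1/2) *\<^sub>R u) (1/2))"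
    using less_imp_neq[OF unit_ball_vol_pos[of "real CARD('n)", OF of_nat_0_le_iff]]
    by (simp add: emeasure_ball ennreal_less_zero_iff)
  also have "\<dots> = (\<integral>\<^sup>+z. indicator (ball ((1/2) *\<^sub>R u) (1/2)) z \<partial>lborel)" by simp
  also have "\<dots> \<le> unit_disc_vol u"
  proof -
    have m: "{p::real^'n. norm p < 1} \<in> sets borel" by measurable
    show ?thesis
      unfolding unit_disc_vol_def emeasure_perp_lborel_eq[OF u m]
    proof (intro nn_integral_mono)
      fix z :: "real^'n"
      show "(indicator (ball ((1/2) *\<^sub>R u) (1/2)) z :: ennreal)
          \<le> indicator {0..1} (z \<bullet> u) * indicator {p. norm p < 1} (z - (z \<bullet> u) *\<^sub>R u)"
      proof (cases "z \<in> ball ((1/2) *\<^sub>R u) (1/2)")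
        case True
        then have d: "norm (z - (1/2) *\<^sub>R u) < 1/2" by (simp add: dist_norm norm_minus_commute)
        have "\<bar>(z - (1/2) *\<^sub>R u) \<bullet> u\<bar> < 1/2"
          using Cauchy_Schwarz_ineq2[of "z - (1/2) *\<^sub>R u" u] u d by simp
        then have "\<bar>z \<bullet> u - 1/2\<bar> < 1/2" using u by (simp add: inner_diff_left dot_square_norm)
        then have 1: "z \<bullet> u \<in> {0..1}" unfolding atLeastAtMost_iff by arith
        have eq: "z - (z \<bullet> u) *\<^sub>R u = (z - (1/2) *\<^sub>R u) - ((z - (1/2) *\<^sub>R u) \<bullet> u) *\<^sub>R u"
          using u by (simp add: inner_diff_left dot_square_norm algebra_simps)
        have "norm (z - (z \<bullet> u) *\<^sub>R u) < 1"
          using norm_proj_le[OF u, of "z - (1/2) *\<^sub>R u"] d unfolding eq by linarith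
        then show ?thesis using 1 by (simp add: indicator_def)
      qed simp
    qed
  qed
  finally show ?thesis .
qed

lemma unit_disc_vol_eq:
  fixes u u' :: "real^'n"
  assumes u: "norm u = 1" and u': "norm u' = 1"
  shows "unit_disc_vol u = unit_disc_vol u'"
proof -
  obtain f where f: "orthogonal_transformation f" "f u = u'"
    using orthogonal_transformation_exists[of u u'] u u' by auto
  have m[measurable]: "{p::real^'n. norm p < 1} \<in> sets borel" by measurable
  define G where "G z = (indicator {0..1} (z \<bullet> u') * indicator {p. norm p < 1} (z - (z \<bullet> u') *\<^sub>R u') :: ennreal)" for z
  have "unit_disc_vol u' = (\<integral>\<^sup>+z. G z \<partial>lborel)"
    unfolding unit_disc_vol_def emeasure_perp_lborel_eq[OF u' m] G_def ..
  also have "\<dots> = (\<integral>\<^sup>+z. G (f z) \<partial>lborel)"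
    by (rule nn_integral_lborel_orthogonal[OF f(1), symmetric]) (unfold G_def, measurable)
  also have "\<dots> = unit_disc_vol u"
    unfolding unit_disc_vol_def emeasure_perp_lborel_eq[OF u m] G_def
  proof (intro nn_integral_cong arg_cong2[where f="(*)"])
    fix z
    have fz: "f z \<bullet> u' = z \<bullet> u" using f unfolding orthogonal_transformation_def by auto
    have lin: "linear f" using f by (simp add: orthogonal_transformation_linear)
    show "indicator {0..1} (f z \<bullet> u') = (indicator {0..1} (z \<bullet> u) :: ennreal)" by (simp add: fz)
    have "f z - (f z \<bullet> u') *\<^sub>R u' = f (z - (z \<bullet> u) *\<^sub>R u)"
      using f lin by (simp add: fz linear_diff linear_cmul)
    then have "norm (f z - (f z \<bullet> u') *\<^sub>R u') = norm (z - (z \<bullet> u) *\<^sub>R u)"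
      using f(1) by (simp add: orthogonal_transformation_norm)
    then show "indicator {p. norm p < 1} (f z - (f z \<bullet> u') *\<^sub>R u')
        = (indicator {p. norm p < 1} (z - (z \<bullet> u) *\<^sub>R u) :: ennreal)" by (simp add: indicator_def)
  qed
  finally show ?thesis by simp
qed

section \<open>The Crofton measure\<close>

lemma sets_crofton_measure [simp, measurable_cong]:
  "sets (crofton_measure :: ((real^'n) \<times> (real^'n)) measure) = sets borel"
  using sets.sets_measure_of_eq[of "borel :: ((real^'n) \<times> (real^'n)) measure"]
  unfolding crofton_measure_def by simp

lemma space_crofton_measure [simp]: "space crofton_measure = UNIV"
  unfolding crofton_measure_def by (simp add: space_measure_of_conv)

text \<open>For a unit vector \<open>u\<close> this is the measure of the slice of \<open>A\<close>
  in its hyperplane, in slab form: \<open>subspace_lborel\<close> depends on \<open>u\<close>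
  through a choice of basis, which would hide measurability in \<open>u\<close>.\<close>

definition line_weight :: "((real^'n) \<times> (real^'n)) set \<Rightarrow> real^'n \<Rightarrow> ennreal" where
  "line_weight A u = (\<integral>\<^sup>+z. indicator {0..1} (z \<bullet> u) * indicator A (u, z - (z \<bullet> u) *\<^sub>R u) \<partial>lborel)"

lemma borel_measurable_line_weight [measurable]:
  fixes A :: "((real^'n) \<times> (real^'n)) set"
  assumes "A \<in> sets borel"
  shows "line_weight A \<in> borel_measurable borel"
proof -
  have [measurable]: "A \<in> sets (borel \<Otimes>\<^sub>M borel)" unfolding borel_prod by (rule assms)
  show ?thesis unfolding line_weight_def by measurable
qed

lemma slice_borel:
  fixes A :: "((real^'n) \<times> (real^'n)) set"
  assumes "A \<in> sets borel"
  shows "{p. (u, p) \<in> A} \<in> sets borel"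
proof -
  have [measurable]: "A \<in> sets (borel \<Otimes>\<^sub>M borel)" unfolding borel_prod by (rule assms)
  show ?thesis by measurable
qed

lemma line_weight_eq:
  fixes A :: "((real^'n) \<times> (real^'n)) set"
  assumes u: "norm u = 1" and "A \<in> sets borel"
  shows "line_weight A u = emeasure (perp_lborel u) {p. (u, p) \<in> A}"
  unfolding emeasure_perp_lborel_eq[OF u slice_borel[OF assms(2)]] line_weight_def
  by (simp add: indicator_def)

text \<open>Countable additivity of the defining set function has to come before
  \<open>measure_of\<close> yields its values. Under the integral \<open>line_weight\<close> may
  replace the slice measure, since almost every \<open>u\<close> is a unit vector.\<close>

lemma emeasure_crofton_measure:
  fixes A :: "((real^'n) \<times> (real^'n)) set"
  assumes A: "A \<in> sets borel"
  shows "emeasure crofton_measure A = (\<integral>\<^sup>+u. line_weight A u \<partial>sphere_prob)"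
proof -
  define \<mu> where "\<mu> = (\<lambda>A::((real^'n) \<times> (real^'n)) set.
    \<integral>\<^sup>+ u. emeasure (subspace_lborel {p. p \<bullet> u = 0}) {p. (u, p) \<in> A} \<partial>sphere_prob)"
  have \<mu>: "\<mu> A = (\<integral>\<^sup>+u. line_weight A u \<partial>sphere_prob)" if "A \<in> sets borel" for A
    unfolding \<mu>_def
  proof (rule nn_integral_cong_AE, rule AE_mp[OF AE_sphere_prob], rule AE_I2, rule impI)
    fix u :: "real^'n" assume "norm u = 1"
    then show "emeasure (perp_lborel u) {p. (u, p) \<in> A} = line_weight A u"
      using line_weight_eq that by metis
  qed
  have "emeasure crofton_measure A = \<mu> A"
    unfolding crofton_measure_def \<mu>_def[symmetric]
  proof (rule emeasure_measure_of_sigma)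
    show "sigma_algebra UNIV (sets (borel :: ((real^'n) \<times> (real^'n)) measure))"
      using sets.sigma_algebra_axioms[of "borel :: ((real^'n) \<times> (real^'n)) measure"] by simp
    show "positive (sets borel) \<mu>" by (simp add: positive_def \<mu>_def)
    show "countably_additive (sets borel) \<mu>"
    proof (rule countably_additiveI)
      fix F :: "nat \<Rightarrow> ((real^'n) \<times> (real^'n)) set"
      assume F: "range F \<subseteq> sets borel" "disjoint_family F" "(\<Union>i. F i) \<in> sets borel"
      have Fi: "F i \<in> sets borel" for i using F(1) by auto
      have "(\<Sum>i. \<mu> (F i)) = (\<integral>\<^sup>+u. (\<Sum>i. line_weight (F i) u) \<partial>sphere_prob)"
        using Fi by (subst nn_integral_suminf) (auto simp: \<mu> intro!: borel_measurable_line_weight)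
      also have "\<dots> = (\<integral>\<^sup>+u. line_weight (\<Union>i. F i) u \<partial>sphere_prob)"
      proof (rule nn_integral_cong_AE, rule AE_mp[OF AE_sphere_prob], rule AE_I2, rule impI)
        fix u :: "real^'n" assume u: "norm u = 1"
        have "(\<Sum>i. emeasure (perp_lborel u) {p. (u, p) \<in> F i}) = emeasure (perp_lborel u) (\<Union>i. {p. (u, p) \<in> F i})"
          using F(2) slice_borel[OF Fi] by (intro suminf_emeasure) (auto simp: disjoint_family_on_def)
        also have "(\<Union>i. {p. (u, p) \<in> F i}) = {p. (u, p) \<in> (\<Union>i. F i)}" by auto
        finally show "(\<Sum>i. line_weight (F i) u) = line_weight (\<Union>i. F i) u"
          using u Fi F(3) by (simp add: line_weight_eq)
      qed
      finally show "(\<Sum>i. \<mu> (F i)) = \<mu> (\<Union>i. F i)" using F(3) by (simp add: \<mu>)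
    qed
  qed (rule A)
  then show ?thesis using \<mu>[OF A] by simp
qed

lemma lines_meeting_borel:
  fixes K :: "(real^'n) set"
  assumes "open K"
  shows "lines_meeting K \<in> sets borel"
proof -
  have "lines_meeting K = {l. norm (fst l) = 1 \<and> snd l \<bullet> fst l = 0} \<inter> (\<Union>t. (\<lambda>l. snd l + t *\<^sub>R fst l) -` K)"
    by (auto simp: lines_meeting_def)
  also have "\<dots> \<in> sets borel"
  proof (rule sets.Int)
    have eq: "({l. norm (fst l) = 1 \<and> snd l \<bullet> fst l = 0} :: ((real^'n) \<times> (real^'n)) set)
        = {l. norm (fst l) = 1} \<inter> {l. snd l \<bullet> fst l = 0}" by auto
    show "{l. norm (fst l) = 1 \<and> snd l \<bullet> fst l = 0} \<in> sets (borel :: ((real^'n) \<times> (real^'n)) measure)"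
      unfolding eq by (intro borel_closed closed_Int closed_Collect_eq continuous_intros)
    have "open (\<Union>t. (\<lambda>l::(real^'n) \<times> (real^'n). snd l + t *\<^sub>R fst l) -` K)"
      by (intro open_UN ballI open_vimage assms continuous_intros)
    then show "(\<Union>t. (\<lambda>l. snd l + t *\<^sub>R fst l) -` K) \<in> sets (borel :: ((real^'n) \<times> (real^'n)) measure)"
      by (rule borel_open)
  qed
  finally show ?thesis .
qed

lemma emeasure_crofton_lines_less_top:
  fixes K :: "(real^'n) set"
  assumes K: "open K" "bounded K"
  shows "emeasure crofton_measure (lines_meeting K) < top"
proof -
  interpret prob_space "sphere_prob :: (real^'n) measure" by (rule prob_space_sphere_prob)
  obtain R where R: "\<And>x. x \<in> K \<Longrightarrow> norm x \<le> R" using K(2) by (auto simp: bounded_iff)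
  have "emeasure crofton_measure (lines_meeting K)
      \<le> (\<integral>\<^sup>+u. emeasure lborel (cball (0::real^'n) (R + 1)) \<partial>(sphere_prob :: (real^'n) measure))"
    unfolding emeasure_crofton_measure[OF lines_meeting_borel[OF K(1)]]
  proof (rule nn_integral_mono_AE, rule AE_mp[OF AE_sphere_prob], rule AE_I2, rule impI)
    fix u :: "real^'n" assume u: "norm u = 1"
    have "norm p \<le> R" if l: "(u, p) \<in> lines_meeting K" for p
    proof -
      obtain t where t: "p + t *\<^sub>R u \<in> K" "p \<bullet> u = 0" using l by (auto simp: lines_meeting_def)
      then have eq: "(p + t *\<^sub>R u) - ((p + t *\<^sub>R u) \<bullet> u) *\<^sub>R u = p"
        using u by (simp add: inner_add_left dot_square_norm)
      show ?thesis using R[OF t(1)] norm_proj_le[OF u, of "p + t *\<^sub>R u", unfolded eq] by linarith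
    qed
    then have "line_weight (lines_meeting K) u \<le> emeasure (perp_lborel u) (cball 0 R)"
      unfolding line_weight_eq[OF u lines_meeting_borel[OF K(1)]] by (intro emeasure_mono) auto
    also have "\<dots> \<le> emeasure lborel (cball (0::real^'n) (R + 1))" by (rule emeasure_perp_lborel_cball_le[OF u])
    finally show "line_weight (lines_meeting K) u \<le> emeasure lborel (cball (0::real^'n) (R + 1))" .
  qed
  also have "\<dots> < top"
    using emeasure_space_1 emeasure_lborel_cball_finite[of "0::real^'n" "R + 1"] by simp
  finally show ?thesis .
qed

lemma emeasure_crofton_lines_pos:
  fixes K :: "(real^'n) set"
  assumes K: "open K" "K \<noteq> {}"
  shows "0 < emeasure crofton_measure (lines_meeting K)"
proof -
  interpret prob_space "sphere_prob :: (real^'n) measure" by (rule prob_space_sphere_prob)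
  obtain c where "c \<in> K" using K by blast
  then obtain e where e: "0 < e" "ball c e \<subseteq> K" using K(1) open_contains_ball by blast
  obtain a :: "real^'n" where a: "norm a = 1" using vector_choose_size[of 1] by auto
  have "0 < ennreal (e ^ (CARD('n) - 1)) * unit_disc_vol a"
    using e unit_disc_vol_pos[OF a] by (simp add: ennreal_zero_less_mult_iff)
  also have "\<dots> = (\<integral>\<^sup>+u. ennreal (e ^ (CARD('n) - 1)) * unit_disc_vol a \<partial>(sphere_prob :: (real^'n) measure))"
    using emeasure_space_1 by simp
  also have "\<dots> \<le> emeasure crofton_measure (lines_meeting K)"
    unfolding emeasure_crofton_measure[OF lines_meeting_borel[OF K(1)]]
  proof (rule nn_integral_mono_AE, rule AE_mp[OF AE_sphere_prob], rule AE_I2, rule impI)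
    fix u :: "real^'n" assume u: "norm u = 1"
    \<comment> \<open>The projection of the centre \<open>c\<close>: every line in direction
      \<open>u\<close> with foot within \<open>e\<close> of \<open>v\<close> meets the ball.\<close>
    define v where "v = c - (c \<bullet> u) *\<^sub>R u"
    have v: "v \<bullet> u = 0" using u by (simp add: v_def inner_diff_left dot_square_norm)
    have "p + (c \<bullet> u) *\<^sub>R u \<in> K" if "norm (p - v) < e" for p
    proof -
      have "dist c (p + (c \<bullet> u) *\<^sub>R u) = norm (p - v)"
        by (simp add: dist_norm v_def norm_minus_commute algebra_simps)
      then show ?thesis using that e by auto
    qed
    then have sub: "(u, p) \<in> lines_meeting K" if "norm (p - v) < e" "p \<bullet> u = 0" for p
      using that u by (auto simp: lines_meeting_def)
    have "ennreal (e ^ (CARD('n) - 1)) * unit_disc_vol a = emeasure (perp_lborel u) {p. norm (p - v) < e}"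
      using emeasure_perp_lborel_ball[OF u v e(1)] unit_disc_vol_eq[OF a u] by simp
    also have "\<dots> \<le> emeasure (perp_lborel u) {p. (u, p) \<in> lines_meeting K}"
    proof (rule emeasure_mono_AE)
      show "AE p in perp_lborel u. p \<in> {p. norm (p - v) < e} \<longrightarrow> p \<in> {p. (u, p) \<in> lines_meeting K}"
        using AE_perp_lborel[OF u] by eventually_elim (use sub in auto)
      show "{p. (u, p) \<in> lines_meeting K} \<in> sets (perp_lborel u)"
        using slice_borel[OF lines_meeting_borel[OF K(1)]] by simp
    qed
    finally show "ennreal (e ^ (CARD('n) - 1)) * unit_disc_vol a \<le> line_weight (lines_meeting K) u"
      unfolding line_weight_eq[OF u lines_meeting_borel[OF K(1)]] .
  qed
  finally show ?thesis .
qed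

section \<open>Chords and normals of a convex body\<close>

locale convex_body =
  fixes K :: "(real^'n) set"
  assumes nonempty: "K \<noteq> {}" and open_K: "open K" and bounded_K: "bounded K" and convex_K: "convex K"
begin

text \<open>Extremes of the open chord, in place of the finite set of boundary parameters in
  \<open>entry_point\<close>: they are accessible through openness and convexity of
  \<open>K\<close>, and \<open>entry_exit_eq\<close> shows that they give the same points.\<close>

definition lo :: "real^'n \<Rightarrow> real^'n \<Rightarrow> real" where "lo u p = Inf {t. p + t *\<^sub>R u \<in> K}"

definition hi :: "real^'n \<Rightarrow> real^'n \<Rightarrow> real" where "hi u p = Sup {t. p + t *\<^sub>R u \<in> K}"

lemma frontier_eq: "frontier K = closure K - K"
  using open_K by (simp add: frontier_def interior_open)

lemma chord_K:
  assumes u: "norm u = 1" and t0: "p + t0 *\<^sub>R u \<in> K"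
  shows "p + t *\<^sub>R u \<in> K \<longleftrightarrow> lo u p < t \<and> t < hi u p"
proof -
  define S where "S = {t. p + t *\<^sub>R u \<in> K}"
  have "S = (\<lambda>t. p + t *\<^sub>R u) -` K" by (auto simp: S_def)
  then have openS: "open S" using open_K by (simp, intro open_vimage continuous_intros)
  have neS: "S \<noteq> {}" using t0 by (auto simp: S_def)
  obtain R where R: "\<And>x. x \<in> K \<Longrightarrow> norm x \<le> R" using bounded_K by (auto simp: bounded_iff)
  have bS: "\<bar>t\<bar> \<le> R + norm p" if "t \<in> S" for t
    using R[of "p + t *\<^sub>R u"] that norm_triangle_ineq4[of "p + t *\<^sub>R u" p] u by (simp add: S_def)
  have ba: "bdd_above S" "bdd_below S"
    using bS by (force intro!: bdd_aboveI[of _ "R + norm p"], force intro!: bdd_belowI[of _ "- (R + norm p)"])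
  have conv: "t \<in> S" if "a \<in> S" "b \<in> S" "a < t" "t < b" for a b t
  proof -
    define s where "s = (t - a) / (b - a)"
    have "s * (b - a) = t - a" using that by (simp add: s_def)
    then have "t = (1 - s) * a + s * b" by (simp add: algebra_simps)
    moreover have "0 \<le> s" "s \<le> 1" using that by (auto simp: s_def)
    ultimately have s: "0 \<le> s" "s \<le> 1" "t = (1 - s) * a + s * b" by auto
    have "(1 - s) *\<^sub>R (p + a *\<^sub>R u) + s *\<^sub>R (p + b *\<^sub>R u) \<in> K"
      using convexD_alt[OF convex_K, of "p + a *\<^sub>R u" "p + b *\<^sub>R u" s] that s by (simp add: S_def)
    also have "(1 - s) *\<^sub>R (p + a *\<^sub>R u) + s *\<^sub>R (p + b *\<^sub>R u) = p + t *\<^sub>R u"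
      unfolding s(3) by (simp add: algebra_simps)
    finally show ?thesis by (simp add: S_def)
  qed
  have "t \<in> S \<longleftrightarrow> Inf S < t \<and> t < Sup S"
  proof
    assume t: "t \<in> S"
    then obtain e where e: "e > 0" "\<And>s. dist s t < e \<Longrightarrow> s \<in> S" using openS by (auto simp: open_dist)
    have "t - e/2 \<in> S" "t + e/2 \<in> S" using e by (auto simp: dist_real_def)
    then have "Inf S \<le> t - e/2" "t + e/2 \<le> Sup S" using ba by (auto intro: cInf_lower cSup_upper)
    then show "Inf S < t \<and> t < Sup S" using e by auto
  next
    assume "Inf S < t \<and> t < Sup S"
    then show "t \<in> S"
      using conv cInf_lessD[OF neS] less_cSupD[OF neS] by blast
  qed
  then show ?thesis by (simp add: S_def lo_def hi_def)
qed

text \<open>If a point of the closure lay beyond an end of the chord, convexity would put the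
  half-open segment from the inner point at \<open>t0\<close> towards it into \<open>K\<close>,
  including that end, which is not in \<open>K\<close>.\<close>

lemma chord_closure:
  assumes u: "norm u = 1" and t0: "p + t0 *\<^sub>R u \<in> K"
  shows "p + t *\<^sub>R u \<in> closure K \<longleftrightarrow> lo u p \<le> t \<and> t \<le> hi u p"
proof
  have lohi: "lo u p < t0" "t0 < hi u p" using chord_K[OF u t0] t0 by auto
  {
    assume t: "lo u p \<le> t \<and> t \<le> hi u p"
    have "closure {lo u p <..< hi u p} = {lo u p .. hi u p}" using lohi by (intro closure_greaterThanLessThan) simp
    moreover have "(\<lambda>t. p + t *\<^sub>R u) ` closure {lo u p <..< hi u p} \<subseteq> closure K"
    proof (rule image_closure_subset)
      show "continuous_on (closure {lo u p <..< hi u p}) (\<lambda>t. p + t *\<^sub>R u)" by (intro continuous_intros)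
      have "(\<lambda>t. p + t *\<^sub>R u) ` {lo u p <..< hi u p} \<subseteq> K"
      proof (rule image_subsetI)
        show "p + t *\<^sub>R u \<in> K" if "t \<in> {lo u p <..< hi u p}" for t
          using chord_K[OF u t0, of t] that by simp
      qed
      then show "(\<lambda>t. p + t *\<^sub>R u) ` {lo u p <..< hi u p} \<subseteq> closure K"
        by (rule order_trans[OF _ closure_subset])
    qed simp
    ultimately show "p + t *\<^sub>R u \<in> closure K" using t by (simp add: image_subset_iff)
  next
    assume t: "p + t *\<^sub>R u \<in> closure K"
    have *: "p + (t0 + e * (t - t0)) *\<^sub>R u \<in> K" if "0 \<le> e" "e < 1" for e
    proof -
      have inI: "(p + t *\<^sub>R u) - (1 - e) *\<^sub>R ((p + t *\<^sub>R u) - (p + t0 *\<^sub>R u)) \<in> interior K"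
        using that t t0 open_K by (intro mem_interior_closure_convex_shrink convex_K) (auto simp: interior_open)
      have eq: "(p + t *\<^sub>R u) - (1 - e) *\<^sub>R ((p + t *\<^sub>R u) - (p + t0 *\<^sub>R u))
          = p + (t0 + e * (t - t0)) *\<^sub>R u" by (simp add: algebra_simps)
      show ?thesis using inI unfolding eq interior_open[OF open_K] .
    qed
    show "lo u p \<le> t \<and> t \<le> hi u p"
    proof (rule ccontr)
      assume "\<not> (lo u p \<le> t \<and> t \<le> hi u p)"
      then consider "t < lo u p" | "hi u p < t" by linarith
      then show False
      proof cases
        case 1
        define e where "e = (lo u p - t0) / (t - t0)"
        have "0 \<le> e" "e < 1" "t0 + e * (t - t0) = lo u p" using 1 lohi by (auto simp: e_def field_simps)
        then show False using *[of e] chord_K[OF u t0, of "lo u p"] by simp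
      next
        case 2
        define e where "e = (hi u p - t0) / (t - t0)"
        have "0 \<le> e" "e < 1" "t0 + e * (t - t0) = hi u p" using 2 lohi by (auto simp: e_def field_simps)
        then show False using *[of e] chord_K[OF u t0, of "hi u p"] by simp
      qed
    qed
  }
qed

lemma chord_frontier:
  assumes u: "norm u = 1" and t0: "p + t0 *\<^sub>R u \<in> K"
  shows "p + t *\<^sub>R u \<in> frontier K \<longleftrightarrow> t = lo u p \<or> t = hi u p" and "lo u p < hi u p"
proof -
  show "lo u p < hi u p" using chord_K[OF u t0] t0 by fastforce
  then show "p + t *\<^sub>R u \<in> frontier K \<longleftrightarrow> t = lo u p \<or> t = hi u p"
    unfolding frontier_eq Diff_iff chord_closure[OF u t0] chord_K[OF u t0] by auto
qed

lemma lines_meetingE: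
  assumes "(u, p) \<in> lines_meeting K"
  obtains t where "norm u = 1" "p \<bullet> u = 0" "p + t *\<^sub>R u \<in> K"
  using assms by (auto simp: lines_meeting_def)

lemma entry_exit_eq:
  assumes "(u, p) \<in> lines_meeting K"
  shows "entry_point K (u, p) = p + lo u p *\<^sub>R u" "exit_point K (u, p) = p + hi u p *\<^sub>R u"
proof -
  obtain t where t: "norm u = 1" "p + t *\<^sub>R u \<in> K" using assms by (rule lines_meetingE)
  have "{t. p + t *\<^sub>R u \<in> frontier K} = {lo u p, hi u p}" using chord_frontier(1)[OF t] by auto
  then show "entry_point K (u, p) = p + lo u p *\<^sub>R u" "exit_point K (u, p) = p + hi u p *\<^sub>R u"
    using chord_frontier(2)[OF t] by (simp_all add: entry_point_def exit_point_def)
qed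

lemma entry_exit_frontier:
  assumes "l \<in> lines_meeting K"
  shows "entry_point K l \<in> frontier K" "exit_point K l \<in> frontier K" "entry_point K l \<noteq> exit_point K l"
proof -
  obtain u p where l: "l = (u, p)" by (cases l)
  note up = assms[unfolded l]
  obtain t where t: "norm u = 1" "p + t *\<^sub>R u \<in> K" using up by (rule lines_meetingE)
  show "entry_point K l \<in> frontier K" "exit_point K l \<in> frontier K" "entry_point K l \<noteq> exit_point K l"
    unfolding l entry_exit_eq[OF up] using chord_frontier[OF t] t by auto
qed

text \<open>A point strictly inside the chord stays in the open set \<open>K\<close> when the line
  moves, which bounds \<open>lo\<close> from above and \<open>hi\<close> from below; a point beyond
  an end stays off the closure, which gives the opposite bounds.\<close>

lemma continuous_lo_hi:
  "continuous_on (lines_meeting K) (\<lambda>l. lo (fst l) (snd l))"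
  "continuous_on (lines_meeting K) (\<lambda>l. hi (fst l) (snd l))"
proof -
  have nearK: "\<forall>\<^sub>F l in at l0 within lines_meeting K. snd l + t *\<^sub>R fst l \<in> K"
    if "snd l0 + t *\<^sub>R fst l0 \<in> K" for l0 t
    by (rule topological_tendstoD[OF _ open_K that]) (intro tendsto_intros)
  have nearC: "\<forall>\<^sub>F l in at l0 within lines_meeting K. snd l + t *\<^sub>R fst l \<in> - closure K"
    if "snd l0 + t *\<^sub>R fst l0 \<in> - closure K" for l0 t
    by (rule topological_tendstoD[OF _ _ that]) (intro tendsto_intros, simp add: open_Compl)
  have inLM: "\<forall>\<^sub>F l in at l0 within lines_meeting K. l \<in> lines_meeting K" for l0
    by (simp add: eventually_at_filter)
  have c: "(snd l + t *\<^sub>R fst l \<in> K \<longleftrightarrow> lo (fst l) (snd l) < t \<and> t < hi (fst l) (snd l))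
      \<and> (snd l + t *\<^sub>R fst l \<in> closure K \<longleftrightarrow> lo (fst l) (snd l) \<le> t \<and> t \<le> hi (fst l) (snd l))
      \<and> lo (fst l) (snd l) < hi (fst l) (snd l)"
    if "l \<in> lines_meeting K" for l t
  proof -
    have "(fst l, snd l) \<in> lines_meeting K" using that by simp
    then obtain t where "norm (fst l) = 1" "snd l + t *\<^sub>R fst l \<in> K" by (rule lines_meetingE)
    then show ?thesis using chord_K chord_closure chord_frontier(2) by metis
  qed
  show "continuous_on (lines_meeting K) (\<lambda>l. hi (fst l) (snd l))"
    unfolding continuous_on_def
  proof (intro ballI order_tendstoI)
    fix l0 a assume l0: "l0 \<in> lines_meeting K" and a: "a < hi (fst l0) (snd l0)"
    define t where "t = (max a (lo (fst l0) (snd l0)) + hi (fst l0) (snd l0)) / 2"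
    have t: "a < t" "lo (fst l0) (snd l0) < t" "t < hi (fst l0) (snd l0)"
      using a c[OF l0] by (auto simp: t_def max_def)
    have "\<forall>\<^sub>F l in at l0 within lines_meeting K. snd l + t *\<^sub>R fst l \<in> K"
      using nearK[of l0 t] c[OF l0, of t] t by simp
    then show "\<forall>\<^sub>F l in at l0 within lines_meeting K. a < hi (fst l) (snd l)"
      using inLM[of l0]
    proof eventually_elim
      case (elim l)
      then have "lo (fst l) (snd l) < t \<and> t < hi (fst l) (snd l)" using c[OF elim(2), of t] by blast
      then show ?case using t by linarith
    qed
  next
    fix l0 a assume l0: "l0 \<in> lines_meeting K" and a: "hi (fst l0) (snd l0) < a"
    define t where "t = (lo (fst l0) (snd l0) + hi (fst l0) (snd l0)) / 2"
    have t: "lo (fst l0) (snd l0) < t" "t < hi (fst l0) (snd l0)"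
      using c[OF l0] by (auto simp: t_def)
    have "\<forall>\<^sub>F l in at l0 within lines_meeting K. snd l + t *\<^sub>R fst l \<in> K"
      using nearK[of l0 t] c[OF l0, of t] t by simp
    moreover have "\<forall>\<^sub>F l in at l0 within lines_meeting K. snd l + a *\<^sub>R fst l \<in> - closure K"
      using nearC[of l0 a] c[OF l0, of a] a by simp
    ultimately show "\<forall>\<^sub>F l in at l0 within lines_meeting K. hi (fst l) (snd l) < a"
      using inLM[of l0]
    proof eventually_elim
      case (elim l)
      have "lo (fst l) (snd l) < t \<and> t < hi (fst l) (snd l)" using c[OF elim(3), of t] elim(1) by blast
      moreover have "\<not> (lo (fst l) (snd l) \<le> a \<and> a \<le> hi (fst l) (snd l))"
        using c[OF elim(3), of a] elim(2) by blast
      ultimately show ?case using t a by linarith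
    qed
  qed
  show "continuous_on (lines_meeting K) (\<lambda>l. lo (fst l) (snd l))"
    unfolding continuous_on_def
  proof (intro ballI order_tendstoI)
    fix l0 a assume l0: "l0 \<in> lines_meeting K" and a: "lo (fst l0) (snd l0) < a"
    define t where "t = (min a (hi (fst l0) (snd l0)) + lo (fst l0) (snd l0)) / 2"
    have t: "t < a" "lo (fst l0) (snd l0) < t" "t < hi (fst l0) (snd l0)"
      using a c[OF l0] by (auto simp: t_def min_def)
    have "\<forall>\<^sub>F l in at l0 within lines_meeting K. snd l + t *\<^sub>R fst l \<in> K"
      using nearK[of l0 t] c[OF l0, of t] t by simp
    then show "\<forall>\<^sub>F l in at l0 within lines_meeting K. lo (fst l) (snd l) < a"
      using inLM[of l0]
    proof eventually_elim
      case (elim l)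
      then have "lo (fst l) (snd l) < t \<and> t < hi (fst l) (snd l)" using c[OF elim(2), of t] by blast
      then show ?case using t by linarith
    qed
  next
    fix l0 a assume l0: "l0 \<in> lines_meeting K" and a: "a < lo (fst l0) (snd l0)"
    define t where "t = (lo (fst l0) (snd l0) + hi (fst l0) (snd l0)) / 2"
    have t: "lo (fst l0) (snd l0) < t" "t < hi (fst l0) (snd l0)"
      using c[OF l0] by (auto simp: t_def)
    have "\<forall>\<^sub>F l in at l0 within lines_meeting K. snd l + t *\<^sub>R fst l \<in> K"
      using nearK[of l0 t] c[OF l0, of t] t by simp
    moreover have "\<forall>\<^sub>F l in at l0 within lines_meeting K. snd l + a *\<^sub>R fst l \<in> - closure K"
      using nearC[of l0 a] c[OF l0, of a] a by simp
    ultimately show "\<forall>\<^sub>F l in at l0 within lines_meeting K. a < lo (fst l) (snd l)"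
      using inLM[of l0]
    proof eventually_elim
      case (elim l)
      have "lo (fst l) (snd l) < t \<and> t < hi (fst l) (snd l)" using c[OF elim(3), of t] elim(1) by blast
      moreover have "\<not> (lo (fst l) (snd l) \<le> a \<and> a \<le> hi (fst l) (snd l))"
        using c[OF elim(3), of a] elim(2) by blast
      ultimately show ?case using t a by linarith
    qed
  qed
qed

lemma continuous_entry_exit:
  "continuous_on (lines_meeting K) (entry_point K)" "continuous_on (lines_meeting K) (exit_point K)"
proof -
  have "continuous_on (lines_meeting K) (\<lambda>l. snd l + lo (fst l) (snd l) *\<^sub>R fst l)"
    "continuous_on (lines_meeting K) (\<lambda>l. snd l + hi (fst l) (snd l) *\<^sub>R fst l)"
    by (intro continuous_intros continuous_lo_hi)+
  then show "continuous_on (lines_meeting K) (entry_point K)" "continuous_on (lines_meeting K) (exit_point K)"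
    using entry_exit_eq by (metis (no_types, lifting) continuous_on_eq prod.collapse)+
qed

end

section \<open>Outer normals of a convex body\<close>

text \<open>The last clause expresses differentiability of the boundary at \<open>y\<close>: every
  direction strictly below the supporting hyperplane enters \<open>K\<close>. It makes
  \<open>n\<close> unique and keeps the first-order geometry free of charts.\<close>

definition normal_at :: "(real^'n) set \<Rightarrow> real^'n \<Rightarrow> real^'n \<Rightarrow> bool" where
  "normal_at K y n \<longleftrightarrow> norm n = 1 \<and> (\<forall>z\<in>K. n \<bullet> (z - y) < 0) \<and>
     (\<forall>v. n \<bullet> v < 0 \<longrightarrow> (\<exists>d>0. y + d *\<^sub>R v \<in> K))"

lemma normal_at_closure:
  assumes "normal_at K y n" "z \<in> closure K"
  shows "n \<bullet> (z - y) \<le> 0"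
proof -
  have "K \<subseteq> {z. n \<bullet> z \<le> n \<bullet> y}"
    using assms(1) by (force simp: normal_at_def inner_diff_right)
  then have "closure K \<subseteq> {z. n \<bullet> z \<le> n \<bullet> y}" by (intro closure_minimal closed_halfspace_le)
  then show ?thesis using assms(2) by (auto simp: inner_diff_right)
qed

text \<open>For distinct unit vectors, \<open>m - n\<close> points strictly below the hyperplane of
  \<open>n\<close>, so it enters \<open>K\<close>, but strictly above that of
  \<open>m\<close>.\<close>

lemma normal_at_unique:
  assumes n: "normal_at K y n" and m: "norm m = 1" "\<And>z. z \<in> K \<Longrightarrow> m \<bullet> (z - y) \<le> 0"
  shows "m = n"
proof (rule ccontr)
  assume "m \<noteq> n"
  have 1: "n \<bullet> n = 1" "m \<bullet> m = 1" using n m by (auto simp: normal_at_def dot_square_norm)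
  have "0 < (m - n) \<bullet> (m - n)" using \<open>m \<noteq> n\<close> by simp
  then have lt: "n \<bullet> m < 1" using 1 by (simp add: inner_diff_left inner_diff_right inner_commute)
  then have "n \<bullet> (m - n) < 0" using 1 by (simp add: inner_diff_right)
  then obtain d where d: "d > 0" "y + d *\<^sub>R (m - n) \<in> K" using n by (auto simp: normal_at_def)
  then have "d * (m \<bullet> (m - n)) \<le> 0" using m(2)[OF d(2)] by simp
  then have "m \<bullet> (m - n) \<le> 0" using d(1) by (simp add: mult_le_0_iff)
  then show False using lt 1 by (simp add: inner_diff_right inner_commute)
qed

context convex_body
begin

text \<open>Makes entering uniform in the direction: a ball about one point of \<open>K\<close> on
  the ray, joined to \<open>y\<close> by convexity, contains a short piece of every ray with
  direction near \<open>v\<close>.\<close>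

lemma normal_at_near:
  assumes n: "normal_at K y n" and y: "y \<in> closure K" and v: "n \<bullet> v < 0"
  obtains e where "0 < e" "\<And>d v'. 0 < d \<Longrightarrow> d < e \<Longrightarrow> norm (v' - v) < e \<Longrightarrow> y + d *\<^sub>R v' \<in> K"
proof -
  obtain d0 where d0: "d0 > 0" "y + d0 *\<^sub>R v \<in> K" using n v by (auto simp: normal_at_def)
  obtain r where r: "r > 0" "ball (y + d0 *\<^sub>R v) r \<subseteq> K" using d0 open_K open_contains_ball by blast
  have "y + d *\<^sub>R v' \<in> K" if "0 < d" "d < min d0 (r / d0)" "norm (v' - v) < min d0 (r / d0)" for d v'
  proof -
    have "dist (y + d0 *\<^sub>R v) (y + d0 *\<^sub>R v') = d0 * norm (v' - v)"
      using d0 by (simp add: dist_norm scaleR_diff_right[symmetric] norm_minus_commute)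
    also have "\<dots> < r" using that d0 by (simp add: field_simps)
    finally have "y + d0 *\<^sub>R v' \<in> interior K" using r open_K by (auto simp: interior_open)
    then have "y - (d / d0) *\<^sub>R (y - (y + d0 *\<^sub>R v')) \<in> interior K"
      using that d0 y by (intro mem_interior_closure_convex_shrink convex_K) auto
    then show ?thesis using d0 open_K by (simp add: interior_open)
  qed
  then show ?thesis using that[of "min d0 (r / d0)"] d0 r by simp
qed

lemma line_through_frontier:
  assumes y: "y \<in> frontier K" and u: "norm u = 1" and d: "0 < d" "y + d *\<^sub>R u \<in> K"
  defines "p \<equiv> y - (y \<bullet> u) *\<^sub>R u"
  shows "(u, p) \<in> lines_meeting K" "entry_point K (u, p) = y"
    "\<exists>s>0. exit_point K (u, p) = y + s *\<^sub>R u"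
    "\<And>z s. z \<in> frontier K \<Longrightarrow> z = y + s *\<^sub>R u \<Longrightarrow> z \<noteq> y \<Longrightarrow> exit_point K (u, p) = z"
proof -
  have eq: "p + (y \<bullet> u + t) *\<^sub>R u = y + t *\<^sub>R u" for t by (simp add: p_def algebra_simps)
  have inK: "p + (y \<bullet> u + d) *\<^sub>R u \<in> K" unfolding eq by (rule d(2))
  show l: "(u, p) \<in> lines_meeting K"
    using inK u by (auto simp: lines_meeting_def p_def inner_diff_left dot_square_norm)
  note ch = chord_frontier[OF u inK] chord_K[OF u inK]
  have lo: "y \<bullet> u = lo u p"
    using ch(1)[of "y \<bullet> u + 0"] ch(3)[of "y \<bullet> u + d"] d y eq[of d] unfolding eq by auto
  then show "entry_point K (u, p) = y" unfolding entry_exit_eq[OF l] using eq[of 0] by simp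
  have "exit_point K (u, p) = y + (hi u p - y \<bullet> u) *\<^sub>R u"
    unfolding entry_exit_eq[OF l] using eq[of "hi u p - y \<bullet> u"] by simp
  then show "\<exists>s>0. exit_point K (u, p) = y + s *\<^sub>R u" using lo ch(2) by (intro exI[of _ "hi u p - y \<bullet> u"]) auto
  show "exit_point K (u, p) = z" if z: "z \<in> frontier K" "z = y + s *\<^sub>R u" "z \<noteq> y" for z s
  proof -
    have "y \<bullet> u + s = lo u p \<or> y \<bullet> u + s = hi u p" using ch(1)[of "y \<bullet> u + s"] z unfolding eq by simp
    then have "y \<bullet> u + s = hi u p" using z lo by auto
    then show ?thesis unfolding entry_exit_eq[OF l] using eq[of s] z by simp
  qed
qed

end

section \<open>Independent entry and exit points\<close>

context convex_body
begin

definition hit :: "(real^'n) set \<Rightarrow> (real^'n) set \<Rightarrow> ((real^'n) \<times> (real^'n)) set" where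
  "hit A B = {l \<in> lines_meeting K. entry_point K l \<in> A \<and> exit_point K l \<in> B}"

abbreviation total_mass :: ennreal where
  "total_mass \<equiv> emeasure crofton_measure (lines_meeting K)"

abbreviation \<sigma> :: "(real^'n) measure" where
  "\<sigma> \<equiv> surface_prob (frontier K)"

lemma measurable_entry_exit:
  "entry_point K \<in> borel_measurable (restrict_space borel (lines_meeting K))"
  "exit_point K \<in> borel_measurable (restrict_space borel (lines_meeting K))"
  by (intro borel_measurable_continuous_on_restrict continuous_entry_exit)+

lemma hit_borel:
  assumes "A \<in> sets borel" "B \<in> sets borel"
  shows "hit A B \<in> sets borel"
proof -
  let ?M = "restrict_space borel (lines_meeting K)"
  have "entry_point K -` A \<inter> space ?M \<in> sets ?M" "exit_point K -` B \<inter> space ?M \<in> sets ?M"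
    using measurable_sets[OF measurable_entry_exit(1) assms(1)] measurable_sets[OF measurable_entry_exit(2) assms(2)]
    by auto
  then have "(entry_point K -` A \<inter> space ?M) \<inter> (exit_point K -` B \<inter> space ?M) \<in> sets ?M" by (rule sets.Int)
  also have "(entry_point K -` A \<inter> space ?M) \<inter> (exit_point K -` B \<inter> space ?M) = hit A B"
    by (auto simp: hit_def space_restrict_space)
  finally show ?thesis
    using lines_meeting_borel[OF open_K] by (simp add: sets_restrict_space_iff)
qed

lemma emeasure_crofton_prob:
  assumes E: "E \<in> sets borel" "E \<subseteq> lines_meeting K"
  shows "emeasure (crofton_prob K) E = emeasure crofton_measure E / total_mass"
proof -
  have LM: "lines_meeting K \<in> sets crofton_measure" using lines_meeting_borel[OF open_K] by simp
  have "E \<in> sets (restrict_space crofton_measure (lines_meeting K))"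
    "lines_meeting K \<in> sets (restrict_space crofton_measure (lines_meeting K))"
    using E LM by (auto simp: sets_restrict_space_iff)
  then show ?thesis
    using E LM unfolding crofton_prob_def
    by (subst emeasure_uniform_measure) (auto simp: emeasure_restrict_space Int_absorb1)
qed

lemma emeasure_law:
  assumes A: "A \<in> sets borel" "B \<in> sets borel"
  shows "emeasure (distr (crofton_prob K) (borel \<Otimes>\<^sub>M borel) (\<lambda>l. (entry_point K l, exit_point K l))) (A \<times> B)
    = emeasure crofton_measure (hit A B) / total_mass"
proof -
  have sp: "space (crofton_prob K) = lines_meeting K"
    by (simp add: crofton_prob_def space_restrict_space)
  have "sets (crofton_prob K) = sets (restrict_space borel (lines_meeting K))"
    by (simp add: crofton_prob_def sets_restrict_space)
  then have "(\<lambda>l. (entry_point K l, exit_point K l)) \<in> crofton_prob K \<rightarrow>\<^sub>M (borel \<Otimes>\<^sub>M borel)"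
    using measurable_entry_exit by (intro measurable_Pair) (simp_all cong: measurable_cong_sets)
  then have "emeasure (distr (crofton_prob K) (borel \<Otimes>\<^sub>M borel) (\<lambda>l. (entry_point K l, exit_point K l))) (A \<times> B)
      = emeasure (crofton_prob K) ((\<lambda>l. (entry_point K l, exit_point K l)) -` (A \<times> B) \<inter> space (crofton_prob K))"
    using A by (intro emeasure_distr) auto
  also have "(\<lambda>l. (entry_point K l, exit_point K l)) -` (A \<times> B) \<inter> space (crofton_prob K) = hit A B"
    by (auto simp: hit_def sp)
  also have "emeasure (crofton_prob K) (hit A B) = emeasure crofton_measure (hit A B) / total_mass"
    using hit_borel[OF A] by (rule emeasure_crofton_prob) (auto simp: hit_def)
  finally show ?thesis .
qed

lemma total_mass: "total_mass \<noteq> 0" "total_mass \<noteq> top"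
  using emeasure_crofton_lines_pos[OF open_K nonempty] emeasure_crofton_lines_less_top[OF open_K bounded_K]
  by auto

lemma hit_UNIV: "hit UNIV UNIV = lines_meeting K"
  by (auto simp: hit_def)

end

locale independent_body = convex_body K for K :: "(real^'n) set" +
  assumes independent: "distr (crofton_prob K) (borel \<Otimes>\<^sub>M borel) (\<lambda>l. (entry_point K l, exit_point K l)) =
         surface_prob (frontier K) \<Otimes>\<^sub>M surface_prob (frontier K)"
begin

text \<open>By the conventions for division in \<open>ennreal\<close>, a uniform measure has total
  mass 0 or 1, and 0 would make the product measure vanish while \<open>crofton_prob\<close> has
  mass 1. So the hypothesis itself forces the area of the boundary to be positive and
  finite.\<close>

lemma
  shows prob_space_\<sigma>: "prob_space \<sigma>"
    and emeasure_hit: "\<lbrakk>A \<in> sets borel; B \<in> sets borel\<rbrakk> \<Longrightarrow>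
      emeasure crofton_measure (hit A B) = total_mass * (emeasure \<sigma> A * emeasure \<sigma> B)"
proof -
  have fr: "frontier K \<in> sets borel" by (simp add: borel_closed)
  have "a / a = 0 \<or> a / a = 1" for a :: ennreal
  proof (cases "a = 0 \<or> a = top")
    case False
    then show ?thesis using ennreal_divide_self[of a] by (simp add: less_top)
  qed (auto simp: divide_ennreal_def)
  then have 01: "emeasure \<sigma> UNIV = 0 \<or> emeasure \<sigma> UNIV = 1"
    using fr by (simp add: emeasure_surface_prob)
  then have "finite_measure \<sigma>" by (intro finite_measureI) auto
  then interpret finite_measure \<sigma> .
  have prod: "emeasure crofton_measure (hit A B) / total_mass = emeasure \<sigma> A * emeasure \<sigma> B"
    if "A \<in> sets borel" "B \<in> sets borel" for A B
    unfolding emeasure_law[OF that, symmetric] independent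
    using that by (intro emeasure_pair_measure_Times) auto
  have "emeasure \<sigma> UNIV * emeasure \<sigma> UNIV = total_mass / total_mass"
    using prod[of UNIV UNIV] by (simp add: hit_UNIV)
  then have "emeasure \<sigma> UNIV = 1"
    using 01 total_mass by (auto simp: ennreal_divide_self less_top)
  then show "prob_space \<sigma>" by (intro prob_spaceI) simp
  assume AB: "A \<in> sets borel" "B \<in> sets borel"
  have "total_mass * (emeasure crofton_measure (hit A B) / total_mass) = emeasure crofton_measure (hit A B)"
    using total_mass by (metis ennreal_times_divide mult.commute mult_divide_eq_ennreal)
  then show "emeasure crofton_measure (hit A B) = total_mass * (emeasure \<sigma> A * emeasure \<sigma> B)"
    unfolding prod[OF AB] by simp
qed

lemma emeasure_hit_UNIV:
  "A \<in> sets borel \<Longrightarrow> emeasure crofton_measure (hit A UNIV) = total_mass * emeasure \<sigma> A"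
  using emeasure_hit[of A UNIV] prob_space.emeasure_space_1[OF prob_space_\<sigma>] by simp

end

section \<open>Blowing up a boundary patch\<close>

text \<open>Patches that, blown up about \<open>y\<close> by \<open>1 / d i\<close>, converge to the
  set \<open>N q < 1\<close> in the tangent plane. Convergence is tested along sequences
  \<open>\<tau>\<close> because the blown-up entry points approach the tangent plane without lying
  in it. \<open>B_bound\<close> supplies the domination, and \<open>N\<close> is general so as to
  cover both balls and oblique sections of cones.\<close>

locale shrinking_patch = convex_body K for K :: "(real^'n) set" +
  fixes y n :: "real^'n" and d :: "nat \<Rightarrow> real" and B :: "nat \<Rightarrow> (real^'n) set"
    and C :: real and N :: "real^'n \<Rightarrow> real"
  assumes y: "y \<in> frontier K" and normal: "normal_at K y n"
    and d: "\<And>i. 0 < d i" "d \<longlonglongrightarrow> 0"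
    and B_borel: "\<And>i. B i \<in> sets borel"
    and B_bound: "\<And>i z. z \<in> B i \<Longrightarrow> z \<in> frontier K \<Longrightarrow> norm (z - y) \<le> C * d i"
    and B_inside: "\<And>q \<tau>. n \<bullet> q = 0 \<Longrightarrow> N q < 1 \<Longrightarrow> \<tau> \<longlonglongrightarrow> q \<Longrightarrow> \<forall>\<^sub>F i in sequentially. y + d i *\<^sub>R \<tau> i \<in> B i"
    and B_outside: "\<And>q \<tau>. n \<bullet> q = 0 \<Longrightarrow> 1 < N q \<Longrightarrow> \<tau> \<longlonglongrightarrow> q \<Longrightarrow> \<forall>\<^sub>F i in sequentially. y + d i *\<^sub>R \<tau> i \<notin> B i"
    and N_borel: "N \<in> borel_measurable borel"
    and N_null: "emeasure (perp_lborel n) {q. N q = 1} = 0"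
    and C: "0 \<le> C"
begin

definition area :: ennreal where "area = emeasure (perp_lborel n) {q. N q < 1}"

lemma norm_n: "norm n = 1" using normal by (simp add: normal_at_def)

lemma y_closure: "y \<in> closure K" using y by (simp add: frontier_eq)

definition foot :: "real^'n \<Rightarrow> real^'n" where "foot u = y - (y \<bullet> u) *\<^sub>R u"

lemma line_eq: "(foot u + d i *\<^sub>R q) + (y \<bullet> u + d i * s) *\<^sub>R u = y + d i *\<^sub>R (q + s *\<^sub>R u)"
  by (simp add: foot_def algebra_simps)

lemma eventually_in_K:
  assumes "n \<bullet> (q + s *\<^sub>R u) < 0"
  shows "\<forall>\<^sub>F i in sequentially. (foot u + d i *\<^sub>R q) + (y \<bullet> u + d i * s) *\<^sub>R u \<in> K"
proof -
  obtain e where e: "0 < e" "\<And>d v'. 0 < d \<Longrightarrow> d < e \<Longrightarrow> norm (v' - (q + s *\<^sub>R u)) < e \<Longrightarrow> y + d *\<^sub>R v' \<in> K"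
    using normal_at_near[OF normal y_closure assms] by metis
  have "\<forall>\<^sub>F i in sequentially. d i < e" using order_tendstoD(2)[OF d(2) e(1)] .
  then show ?thesis unfolding line_eq by eventually_elim (use d e in auto)
qed

text \<open>In blown-up coordinates an inward line enters ever closer to the point where it crosses
  the tangent plane, and \<open>N\<close> there decides membership. An outward line has long been
  inside \<open>K\<close> when it comes near \<open>y\<close>, so its entry point is too far away to
  lie in the patch.\<close>

lemma pointwise_limit:
  assumes u: "norm u = 1" and un: "u \<bullet> n \<noteq> 0" and q: "q \<bullet> u = 0"
    and Nq: "N (q - ((q \<bullet> n) / (u \<bullet> n)) *\<^sub>R u) \<noteq> 1"
    and W: "open W" and exit: "u \<bullet> n < 0 \<Longrightarrow> exit_point K (u, foot u) \<in> W"
  shows "\<forall>\<^sub>F i in sequentially. (u, foot u + d i *\<^sub>R q) \<in> hit (B i) W \<longleftrightarrow>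
    u \<bullet> n < 0 \<and> N (q - ((q \<bullet> n) / (u \<bullet> n)) *\<^sub>R u) < 1"
proof -
  define p where "p i = foot u + d i *\<^sub>R q" for i
  \<comment> \<open>The blown-up line crosses the tangent plane here,
    \<open>n \<bullet> (q + s0 *\<^sub>R u) = 0\<close>; \<open>\<sigma>'\<close> is the blown-up
    parameter of the actual entry.\<close>
  define s0 where "s0 = - (q \<bullet> n) / (u \<bullet> n)"
  define \<sigma>' where "\<sigma>' i = (lo u (p i) - y \<bullet> u) / d i" for i
  have pu: "p i \<bullet> u = 0" for i
    using q u by (simp add: p_def foot_def inner_diff_left inner_add_left dot_square_norm)
  have pK: "p i + (y \<bullet> u + d i * s) *\<^sub>R u = y + d i *\<^sub>R (q + s *\<^sub>R u)" for i s
    unfolding p_def by (rule line_eq)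
  have LM: "(u, p i) \<in> lines_meeting K" if "p i + t *\<^sub>R u \<in> K" for i t
    using that u pu by (auto simp: lines_meeting_def)
  have entry: "entry_point K (u, p i) = y + d i *\<^sub>R (q + \<sigma>' i *\<^sub>R u)" if "(u, p i) \<in> lines_meeting K" for i
    unfolding entry_exit_eq[OF that] pK[symmetric] using d(1)[of i] by (simp add: \<sigma>'_def)
  have near: "\<forall>\<^sub>F i in sequentially. (u, p i) \<in> lines_meeting K \<and> \<sigma>' i < s" if "n \<bullet> (q + s *\<^sub>R u) < 0" for s
    using eventually_in_K[OF that]
  proof eventually_elim
    case (elim i)
    then have *: "p i + (y \<bullet> u + d i * s) *\<^sub>R u \<in> K" by (simp add: p_def)
    then have "lo u (p i) < y \<bullet> u + d i * s" using chord_K[OF u *] by blast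
    then show ?case using LM[OF *] d(1)[of i] by (simp add: \<sigma>'_def field_simps)
  qed
  have ns: "n \<bullet> (q + s *\<^sub>R u) = (u \<bullet> n) * (s - s0)" for s
    using un by (simp add: s0_def inner_add_right inner_commute field_simps)
  consider "u \<bullet> n < 0" | "0 < u \<bullet> n" using un by linarith
  then show ?thesis
  proof cases
    case 1
    \<comment> \<open>Entering before \<open>s0\<close> would produce a point of \<open>K\<close>
      above the supporting hyperplane.\<close>
    have lower: "s0 \<le> \<sigma>' i" if l: "(u, p i) \<in> lines_meeting K" for i
    proof (rule ccontr)
      assume "\<not> s0 \<le> \<sigma>' i"
      then have lt: "lo u (p i) < y \<bullet> u + d i * s0" using d(1)[of i] by (simp add: \<sigma>'_def field_simps)
      obtain t0 where t0: "p i + t0 *\<^sub>R u \<in> K" using l by (auto simp: lines_meeting_def)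
      define t where "t = (lo u (p i) + min (hi u (p i)) (y \<bullet> u + d i * s0)) / 2"
      have t: "lo u (p i) < t" "t < hi u (p i)" "t < y \<bullet> u + d i * s0"
        using lt chord_frontier(2)[OF u t0] by (auto simp: t_def min_def algebra_simps)
      define s where "s = (t - y \<bullet> u) / d i"
      have ts: "t = y \<bullet> u + d i * s" using d(1)[of i] by (simp add: s_def)
      have "s < s0" using t(3) d(1)[of i] unfolding ts by simp
      have "y + d i *\<^sub>R (q + s *\<^sub>R u) \<in> K"
        using chord_K[OF u t0, of t] t unfolding ts pK by blast
      then have "n \<bullet> (d i *\<^sub>R (q + s *\<^sub>R u)) < 0" using normal unfolding normal_at_def by force
      then have "n \<bullet> (q + s *\<^sub>R u) < 0" using d(1)[of i] by (simp add: mult_less_0_iff)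
      then show False using 1 \<open>s < s0\<close> by (simp add: ns mult_less_0_iff)
    qed
    have nears: "\<forall>\<^sub>F i in sequentially. (u, p i) \<in> lines_meeting K \<and> \<sigma>' i < s" if "s0 < s" for s
      using that 1 by (intro near) (simp add: ns mult_less_0_iff)
    have ev: "\<forall>\<^sub>F i in sequentially. (u, p i) \<in> lines_meeting K"
      using nears[of "s0 + 1"] by (auto elim: eventually_mono)
    have "\<sigma>' \<longlonglongrightarrow> s0"
    proof (rule order_tendstoI)
      show "\<forall>\<^sub>F i in sequentially. a < \<sigma>' i" if "a < s0" for a
        using ev by eventually_elim (use lower that in force)
      show "\<forall>\<^sub>F i in sequentially. \<sigma>' i < a" if "s0 < a" for a
        using nears[OF that] by eventually_elim auto
    qed
    then have lim: "(\<lambda>i. q + \<sigma>' i *\<^sub>R u) \<longlonglongrightarrow> q + s0 *\<^sub>R u" by (intro tendsto_intros)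
    have qs: "q + s0 *\<^sub>R u = q - ((q \<bullet> n) / (u \<bullet> n)) *\<^sub>R u" by (simp add: s0_def)
    have n0: "n \<bullet> (q + s0 *\<^sub>R u) = 0" by (simp add: ns)
    have "n \<bullet> u < 0" using 1 by (simp add: inner_commute)
    then obtain e where e: "e > 0" "y + e *\<^sub>R u \<in> K" using normal by (auto simp: normal_at_def)
    have L0: "(u, foot u) \<in> lines_meeting K" unfolding foot_def by (rule line_through_frontier[OF y u e])
    have plim: "(\<lambda>i. (u, p i)) \<longlonglongrightarrow> (u, foot u)"
      unfolding p_def using d(2) by (auto intro!: tendsto_eq_intros)
    have "(\<lambda>i. exit_point K (u, p i)) \<longlonglongrightarrow> exit_point K (u, foot u)"
      by (rule continuous_on_tendsto_compose[OF continuous_entry_exit(2) plim L0 ev])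
    then have evW: "\<forall>\<^sub>F i in sequentially. exit_point K (u, p i) \<in> W"
      using topological_tendstoD[OF _ W] exit[OF 1] by blast
    show ?thesis
    proof (cases "N (q + s0 *\<^sub>R u) < 1")
      case True
      have "\<forall>\<^sub>F i in sequentially. y + d i *\<^sub>R (q + \<sigma>' i *\<^sub>R u) \<in> B i" by (rule B_inside[OF n0 True lim])
      with ev evW show ?thesis
      proof eventually_elim
        case (elim i)
        then show ?case using 1 True entry[OF elim(1)] by (simp add: hit_def p_def[symmetric] qs)
      qed
    next
      case False
      then have "1 < N (q + s0 *\<^sub>R u)" using Nq unfolding qs by linarith
      then have "\<forall>\<^sub>F i in sequentially. y + d i *\<^sub>R (q + \<sigma>' i *\<^sub>R u) \<notin> B i" by (rule B_outside[OF n0 _ lim])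
      with ev show ?thesis
      proof eventually_elim
        case (elim i)
        then show ?case using 1 False entry[OF elim(1)] by (simp add: hit_def p_def[symmetric] qs)
      qed
    qed
  next
    case 2
    \<comment> \<open>Negative enough for the line to be inside \<open>K\<close> already, and for
      every earlier point on it to violate \<open>B_bound\<close>.\<close>
    define s1 where "s1 = min (s0 - 1) (- (C + norm q + 1))"
    have "n \<bullet> (q + s1 *\<^sub>R u) < 0" using 2 by (simp add: ns mult_less_0_iff s1_def)
    from near[OF this] show ?thesis
    proof eventually_elim
      case (elim i)
      then have \<sigma>': "\<sigma>' i < - (C + norm q + 1)" by (simp add: s1_def)
      have "entry_point K (u, p i) \<notin> B i"
      proof
        assume "entry_point K (u, p i) \<in> B i"
        then have "norm (entry_point K (u, p i) - y) \<le> C * d i"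
          using B_bound entry_exit_frontier(1)[of "(u, p i)"] elim by blast
        then have "norm (q + \<sigma>' i *\<^sub>R u) \<le> C"
          using elim d(1)[of i] by (simp add: entry)
        then have "\<bar>\<sigma>' i\<bar> \<le> C + norm q" using norm_triangle_ineq4[of "q + \<sigma>' i *\<^sub>R u" q] u by simp
        then show False using \<sigma>' C norm_ge_zero[of q] by linarith
      qed
      then show ?case using 2 by (simp add: hit_def p_def[symmetric])
    qed
  qed
qed

section \<open>Passing to the limit under the integrals\<close>

definition weight :: "(real^'n) set \<Rightarrow> nat \<Rightarrow> real^'n \<Rightarrow> ennreal" where
  "weight W i u = ennreal (1 / d i ^ (CARD('n) - 1)) * line_weight (hit (B i) W) u"

lemma borel_measurable_weight [measurable]: "W \<in> sets borel \<Longrightarrow> weight W i \<in> borel_measurable borel"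
  unfolding weight_def
  by (intro borel_measurable_times_ennreal borel_measurable_const borel_measurable_line_weight hit_borel B_borel)

lemma weight_eq:
  assumes u: "norm u = 1" and W: "W \<in> sets borel"
  shows "weight W i u = (\<integral>\<^sup>+q. indicator (hit (B i) W) (u, foot u + d i *\<^sub>R q) \<partial>perp_lborel u)"
proof -
  note h = hit_borel[OF B_borel W, of i]
  have v: "foot u \<bullet> u = 0" using u by (simp add: foot_def inner_diff_left dot_square_norm)
  have "(\<lambda>p. indicator {p. (u, p) \<in> hit (B i) W} p :: ennreal) \<in> borel_measurable borel"
    using slice_borel[OF h] by (intro borel_measurable_indicator)
  note aff = nn_integral_perp_lborel_affine[OF u v d(1)[of i] this]
  have "line_weight (hit (B i) W) u = (\<integral>\<^sup>+p. indicator {p. (u, p) \<in> hit (B i) W} p \<partial>perp_lborel u)"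
    using slice_borel[OF h] by (simp add: line_weight_eq[OF u h])
  also note aff
  also have "(\<integral>\<^sup>+q. indicator {p. (u, p) \<in> hit (B i) W} (foot u + d i *\<^sub>R q) \<partial>perp_lborel u)
      = (\<integral>\<^sup>+q. indicator (hit (B i) W) (u, foot u + d i *\<^sub>R q) \<partial>perp_lborel u)"
    by (simp add: indicator_def)
  finally have "line_weight (hit (B i) W) u
      = ennreal (d i ^ (CARD('n) - 1)) * (\<integral>\<^sup>+q. indicator (hit (B i) W) (u, foot u + d i *\<^sub>R q) \<partial>perp_lborel u)" .
  then show ?thesis
    using d(1)[of i] by (simp add: weight_def mult.assoc[symmetric] ennreal_mult[symmetric])
qed

text \<open>Projecting the entry point minus \<open>y\<close> along \<open>u\<close> leaves
  \<open>d i *\<^sub>R q\<close>, so \<open>B_bound\<close> confines \<open>q\<close> to a fixed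
  ball; this is the dominating function.\<close>

lemma indicator_hit_le:
  assumes u: "norm u = 1" and q: "q \<bullet> u = 0"
  shows "indicator (hit (B i) W) (u, foot u + d i *\<^sub>R q) \<le> (indicator (cball 0 C) q :: ennreal)"
proof (cases "(u, foot u + d i *\<^sub>R q) \<in> hit (B i) W")
  case True
  define z where "z = entry_point K (u, foot u + d i *\<^sub>R q)"
  have l: "(u, foot u + d i *\<^sub>R q) \<in> lines_meeting K" and zB: "z \<in> B i"
    using True by (auto simp: hit_def z_def)
  have "z \<in> frontier K" unfolding z_def by (rule entry_exit_frontier[OF l])
  then have zy: "norm (z - y) \<le> C * d i" by (rule B_bound[OF zB])
  define s where "s = lo u (foot u + d i *\<^sub>R q) - y \<bullet> u"
  have zy_eq: "z - y = d i *\<^sub>R q + s *\<^sub>R u"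
    unfolding z_def entry_exit_eq[OF l] by (simp add: foot_def s_def algebra_simps)
  have "(z - y) - ((z - y) \<bullet> u) *\<^sub>R u = d i *\<^sub>R q"
    unfolding zy_eq using q u by (simp add: inner_add_left dot_square_norm)
  then have "norm (d i *\<^sub>R q) \<le> C * d i" using norm_proj_le[OF u, of "z - y"] zy by simp
  then have "norm q \<le> C" using d(1)[of i] by (simp add: mult.commute)
  then show ?thesis by (simp add: indicator_def)
qed simp

lemma weight_le:
  assumes u: "norm u = 1" and W: "W \<in> sets borel"
  shows "weight W i u \<le> emeasure lborel (cball (0::real^'n) (C + 1))"
proof -
  have "weight W i u \<le> (\<integral>\<^sup>+q. indicator (cball 0 C) q \<partial>perp_lborel u)"
    unfolding weight_eq[OF u W]
    by (rule nn_integral_mono_AE, rule AE_mp[OF AE_perp_lborel[OF u]], rule AE_I2, rule impI)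
       (rule indicator_hit_le[OF u])
  also have "\<dots> = emeasure (perp_lborel u) (cball 0 C)" by simp
  also have "\<dots> \<le> emeasure lborel (cball (0::real^'n) (C + 1))" by (rule emeasure_perp_lborel_cball_le[OF u])
  finally show ?thesis .
qed

text \<open>Dominated convergence over the feet \<open>q\<close>; pulling the limit set back from
  the tangent plane along \<open>u\<close> produces the cosine. For outward \<open>u\<close> both
  sides vanish, since \<open>ennreal\<close> truncates.\<close>

lemma weight_limit:
  assumes u: "norm u = 1" and un: "u \<bullet> n \<noteq> 0"
    and W: "open W" and exit: "u \<bullet> n < 0 \<Longrightarrow> exit_point K (u, foot u) \<in> W"
  shows "(\<lambda>i. weight W i u) \<longlonglongrightarrow> ennreal (- (u \<bullet> n)) * area"
proof -
  define \<tau> where "\<tau> q = q - ((q \<bullet> n) / (u \<bullet> n)) *\<^sub>R u" for q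
  have [measurable]: "\<tau> \<in> borel_measurable borel" unfolding \<tau>_def by measurable
  note [measurable] = N_borel
  have Wb: "W \<in> sets borel" using W by (rule borel_open)
  define g :: "real^'n \<Rightarrow> ennreal" where "g q = (if u \<bullet> n < 0 then indicator {q. N q < 1} (\<tau> q) else 0)" for q
  have gm[measurable]: "g \<in> borel_measurable borel" unfolding g_def by measurable
  have "(\<integral>\<^sup>+q. indicator {q. N q = 1} (\<tau> q) \<partial>perp_lborel u)
      = ennreal \<bar>u \<bullet> n\<bar> * (\<integral>\<^sup>+q. indicator {q. N q = 1} q \<partial>perp_lborel n)"
    unfolding \<tau>_def by (rule nn_integral_perp_lborel_change[OF u norm_n un]) measurable
  then have "(\<integral>\<^sup>+q. indicator {q. N q = 1} (\<tau> q) \<partial>perp_lborel u) = (0::ennreal)"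
    using N_null by simp
  then have "AE q in perp_lborel u. indicator {q. N q = 1} (\<tau> q) = (0::ennreal)"
    by (subst (asm) nn_integral_0_iff_AE) measurable
  then have AEN: "AE q in perp_lborel u. N (\<tau> q) \<noteq> 1"
    by eventually_elim (auto split: split_indicator_asm)
  have "(\<lambda>i. \<integral>\<^sup>+q. indicator (hit (B i) W) (u, foot u + d i *\<^sub>R q) \<partial>perp_lborel u)
      \<longlonglongrightarrow> (\<integral>\<^sup>+q. g q \<partial>perp_lborel u)"
  proof (rule nn_integral_dominated_convergence[where w="indicator (cball 0 C)"])
    show "(\<lambda>q. indicator (hit (B i) W) (u, foot u + d i *\<^sub>R q) :: ennreal) \<in> borel_measurable (perp_lborel u)" for i
    proof -
      have [measurable]: "hit (B i) W \<in> sets (borel \<Otimes>\<^sub>M borel)"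
        unfolding borel_prod by (rule hit_borel[OF B_borel Wb])
      show ?thesis by measurable
    qed
    show "AE q in perp_lborel u. indicator (hit (B i) W) (u, foot u + d i *\<^sub>R q) \<le> (indicator (cball 0 C) q :: ennreal)" for i
      using AE_perp_lborel[OF u] by eventually_elim (rule indicator_hit_le[OF u])
    show "(\<integral>\<^sup>+q. indicator (cball 0 C) q \<partial>perp_lborel u) < \<infinity>"
      using le_less_trans[OF emeasure_perp_lborel_cball_le[OF u] emeasure_lborel_cball_finite] by simp
    show "AE q in perp_lborel u. (\<lambda>i. indicator (hit (B i) W) (u, foot u + d i *\<^sub>R q) :: ennreal) \<longlonglongrightarrow> g q"
      using AE_perp_lborel[OF u] AEN
    proof eventually_elim
      case (elim q)
      have "\<forall>\<^sub>F i in sequentially. (u, foot u + d i *\<^sub>R q) \<in> hit (B i) W \<longleftrightarrow>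
          u \<bullet> n < 0 \<and> N (q - ((q \<bullet> n) / (u \<bullet> n)) *\<^sub>R u) < 1"
        using elim exit by (intro pointwise_limit[OF u un _ _ W]) (auto simp: \<tau>_def)
      then have "\<forall>\<^sub>F i in sequentially. indicator (hit (B i) W) (u, foot u + d i *\<^sub>R q) = g q"
        by eventually_elim (auto simp: g_def indicator_def \<tau>_def)
      then show ?case by (rule tendsto_eventually)
    qed
    show "indicator (cball 0 C) \<in> borel_measurable (perp_lborel u)"
      by (rule borel_measurable_indicator) simp
  qed (use gm in simp)
  also have "(\<integral>\<^sup>+q. g q \<partial>perp_lborel u) = ennreal (- (u \<bullet> n)) * area"
  proof (cases "u \<bullet> n < 0")
    case True
    have "(\<integral>\<^sup>+q. indicator {q. N q < 1} (\<tau> q) \<partial>perp_lborel u)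
      = ennreal \<bar>u \<bullet> n\<bar> * (\<integral>\<^sup>+q. indicator {q. N q < 1} q \<partial>perp_lborel n)"
      unfolding \<tau>_def by (rule nn_integral_perp_lborel_change[OF u norm_n un]) measurable
    then show ?thesis using True by (simp add: g_def area_def)
  next
    case False
    then show ?thesis by (simp add: g_def ennreal_neg)
  qed
  finally show ?thesis unfolding weight_eq[OF u Wb] .
qed

lemma emeasure_hit_weight:
  "W \<in> sets borel \<Longrightarrow> ennreal (1 / d i ^ (CARD('n) - 1)) * emeasure crofton_measure (hit (B i) W)
    = (\<integral>\<^sup>+u. weight W i u \<partial>sphere_prob)"
  unfolding emeasure_crofton_measure[OF hit_borel[OF B_borel]] weight_def
  by (rule nn_integral_cmult[symmetric])
     (simp add: measurable_cong_sets[OF sets_surface_prob refl] borel_measurable_line_weight hit_borel B_borel)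

lemma AE_sphere_good: "AE u in sphere_prob. norm u = 1 \<and> u \<bullet> n \<noteq> 0"
proof -
  have "n \<noteq> 0" using norm_n by auto
  from AE_sphere_prob_inner_nonzero[OF this] AE_sphere_prob show ?thesis by eventually_elim simp
qed

lemma patch_limit:
  "(\<lambda>i. ennreal (1 / d i ^ (CARD('n) - 1)) * emeasure crofton_measure (hit (B i) UNIV))
    \<longlonglongrightarrow> cosine_mean n * area"
proof -
  interpret S: prob_space "sphere_prob :: (real^'n) measure" by (rule prob_space_sphere_prob)
  have "(\<lambda>i. \<integral>\<^sup>+u. weight UNIV i u \<partial>sphere_prob) \<longlonglongrightarrow> (\<integral>\<^sup>+u. ennreal (- (u \<bullet> n)) * area \<partial>sphere_prob)"
  proof (rule nn_integral_dominated_convergence[where w="\<lambda>_. emeasure lborel (cball (0::real^'n) (C + 1))"])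
    show "AE u in sphere_prob. weight UNIV i u \<le> emeasure lborel (cball (0::real^'n) (C + 1))" for i
      using AE_sphere_good by eventually_elim (auto intro: weight_le)
    show "AE u in sphere_prob. (\<lambda>i. weight UNIV i u) \<longlonglongrightarrow> ennreal (- (u \<bullet> n)) * area"
      using AE_sphere_good by eventually_elim (auto intro: weight_limit)
    show "(\<integral>\<^sup>+u. emeasure lborel (cball (0::real^'n) (C + 1)) \<partial>(sphere_prob :: (real^'n) measure)) < \<infinity>"
      using S.emeasure_space_1 emeasure_lborel_cball_finite[of "0::real^'n" "C + 1"] by simp
  qed measurable
  moreover have "(\<integral>\<^sup>+u. ennreal (- (u \<bullet> n)) * area \<partial>sphere_prob) = cosine_mean n * area"
    unfolding cosine_mean_def by (rule nn_integral_multc) measurable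
  moreover have "UNIV \<in> sets (borel :: (real^'n) measure)" by simp
  ultimately show ?thesis by (simp only: emeasure_hit_weight)
qed

text \<open>Outside \<open>S\<close> the limiting line need not exit in \<open>W\<close>, and the
  exits of nearby lines are then not controlled. Dropping these directions costs only an inequality,
  by Fatou.\<close>

lemma patch_liminf:
  assumes W: "open W"
    and lim: "(\<lambda>i. ennreal (1 / d i ^ (CARD('n) - 1)) * emeasure crofton_measure (hit (B i) W)) \<longlonglongrightarrow> L"
    and S: "S \<in> sets borel" "\<And>u. norm u = 1 \<Longrightarrow> u \<bullet> n < 0 \<Longrightarrow> u \<in> S \<Longrightarrow> exit_point K (u, foot u) \<in> W"
  shows "(\<integral>\<^sup>+u. ennreal (- (u \<bullet> n)) * indicator S u \<partial>sphere_prob) * area \<le> L"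
proof -
  have Wb: "W \<in> sets borel" using W by (rule borel_open)
  note [measurable] = S(1)
  have "(\<integral>\<^sup>+u. ennreal (- (u \<bullet> n)) * indicator S u \<partial>sphere_prob) * area
      = (\<integral>\<^sup>+u. ennreal (- (u \<bullet> n)) * indicator S u * area \<partial>sphere_prob)"
    using S(1) by (intro nn_integral_multc[symmetric]) measurable
  also have "\<dots> \<le> (\<integral>\<^sup>+u. liminf (\<lambda>i. weight W i u) \<partial>sphere_prob)"
  proof (rule nn_integral_mono_AE, rule AE_mp[OF AE_sphere_good], rule AE_I2, rule impI)
    fix u :: "real^'n" assume u: "norm u = 1 \<and> u \<bullet> n \<noteq> 0"
    show "ennreal (- (u \<bullet> n)) * indicator S u * area \<le> liminf (\<lambda>i. weight W i u)"
    proof (cases "u \<in> S \<and> u \<bullet> n < 0")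
      case True
      then have "(\<lambda>i. weight W i u) \<longlonglongrightarrow> ennreal (- (u \<bullet> n)) * area"
        using u S(2) by (intro weight_limit W) auto
      then have "liminf (\<lambda>i. weight W i u) = ennreal (- (u \<bullet> n)) * area"
        by (intro lim_imp_Liminf) auto
      then show ?thesis using True by simp
    next
      case False
      then show ?thesis by (auto simp: ennreal_neg indicator_def)
    qed
  qed
  also have "\<dots> \<le> liminf (\<lambda>i. \<integral>\<^sup>+u. weight W i u \<partial>sphere_prob)"
    using Wb by (intro nn_integral_liminf) (simp add: measurable_cong_sets[OF sets_surface_prob refl])
  also have "\<dots> = L"
    using lim unfolding emeasure_hit_weight[OF Wb] by (intro lim_imp_Liminf) auto
  finally show ?thesis .
qed

end

section \<open>The pointwise identity\<close>

text \<open>A closed set is the intersection of its open neighbourhoods \<open>W k\<close>, which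
  gives one inequality for it; its open complement, both total masses being 1, gives the
  other.\<close>

lemma prob_measures_eq_open:
  fixes \<mu> \<nu> :: "'a::metric_space measure"
  assumes \<mu>: "prob_space \<mu>" "sets \<mu> = sets borel" and \<nu>: "prob_space \<nu>" "sets \<nu> = sets borel"
    and le: "\<And>W. open W \<Longrightarrow> emeasure \<mu> W \<le> emeasure \<nu> W"
  shows "\<mu> = \<nu>"
proof -
  interpret M: prob_space \<mu> by (rule \<mu>)
  interpret N: prob_space \<nu> by (rule \<nu>)
  have sp: "space \<mu> = UNIV" "space \<nu> = UNIV" using sets_eq_imp_space_eq[OF \<mu>(2)] sets_eq_imp_space_eq[OF \<nu>(2)] by simp_all
  have closed_eq: "emeasure \<mu> X = emeasure \<nu> X" if X: "closed X" for X
  proof (cases "X = {}")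
    case False
    define W where "W k = {x. infdist x X < 1 / (real k + 1)}" for k :: nat
    have W: "open (W k)" for k
      unfolding W_def by (intro open_Collect_less continuous_intros)
    have dec: "decseq W"
    proof (rule decseq_SucI)
      fix k
      have "1 / (real (Suc k) + 1) \<le> 1 / (real k + 1)" by (intro frac_le) auto
      then show "W (Suc k) \<subseteq> W k" by (auto simp: W_def)
    qed
    have int: "(\<Inter>k. W k) = X"
    proof (intro set_eqI iffI)
      fix x assume x: "x \<in> (\<Inter>k. W k)"
      have "\<not> 0 < infdist x X"
      proof
        assume "0 < infdist x X"
        then obtain k where "1 / real (Suc k) < infdist x X" by (rule nat_approx_posE)
        moreover have "x \<in> W k" using x by blast
        ultimately show False by (simp add: W_def add.commute)
      qed
      then have "infdist x X = 0" using infdist_nonneg[of x X] by linarith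
      then show "x \<in> X" using in_closed_iff_infdist_zero[OF X False] by simp
    next
      fix x assume "x \<in> X"
      then show "x \<in> (\<Inter>k. W k)" by (simp add: W_def)
    qed
    have Ms: "range W \<subseteq> sets \<mu>" "range W \<subseteq> sets \<nu>" using W \<mu> \<nu> by (auto intro: borel_open)
    have "(\<lambda>k. emeasure \<mu> (W k)) \<longlonglongrightarrow> emeasure \<mu> X" "(\<lambda>k. emeasure \<nu> (W k)) \<longlonglongrightarrow> emeasure \<nu> X"
      using Lim_emeasure_decseq[OF Ms(1) dec] Lim_emeasure_decseq[OF Ms(2) dec] int by auto
    then have 1: "emeasure \<mu> X \<le> emeasure \<nu> X" by (rule LIMSEQ_le) (use le W in auto)
    have "emeasure \<mu> (- X) \<le> emeasure \<nu> (- X)" using X by (intro le) (simp add: open_Compl)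
    moreover have Xs: "X \<in> sets \<mu>" "X \<in> sets \<nu>" using X \<mu> \<nu> by (auto intro: borel_closed)
    ultimately have "1 - measure \<mu> X \<le> 1 - measure \<nu> X"
      using M.prob_compl[OF Xs(1)] N.prob_compl[OF Xs(2)] sp
      by (simp add: Compl_eq_Diff_UNIV M.emeasure_eq_measure N.emeasure_eq_measure)
    with 1 show ?thesis by (simp add: M.emeasure_eq_measure N.emeasure_eq_measure)
  qed simp
  show ?thesis
  proof (rule measure_eqI_generator_eq[where E="Collect closed" and \<Omega>=UNIV and A="\<lambda>_. UNIV"])
    show "Int_stable (Collect (closed :: 'a set \<Rightarrow> bool))" by (auto simp: Int_stable_def)
    show "sets \<mu> = sigma_sets UNIV (Collect closed)" "sets \<nu> = sigma_sets UNIV (Collect closed)"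
      using \<mu> \<nu> by (simp_all add: borel_eq_closed)
    show "emeasure \<mu> X = emeasure \<nu> X" if "X \<in> Collect closed" for X using that closed_eq by blast
    show "emeasure \<mu> UNIV \<noteq> \<infinity>" by simp
  qed auto
qed

context convex_body
begin

definition exit_from :: "real^'n \<Rightarrow> real^'n \<Rightarrow> real^'n" where
  "exit_from x u = exit_point K (u, x - (x \<bullet> u) *\<^sub>R u)"

lemma
  assumes x: "x \<in> frontier K" and n: "normal_at K x n"
  shows exit_from: "\<And>u. norm u = 1 \<Longrightarrow> u \<bullet> n < 0 \<Longrightarrow> \<exists>s>0. exit_from x u = x + s *\<^sub>R u"
    and exit_from_eq: "\<And>u z s. norm u = 1 \<Longrightarrow> u \<bullet> n < 0 \<Longrightarrow> z \<in> frontier K \<Longrightarrow> z = x + s *\<^sub>R u \<Longrightarrow> z \<noteq> x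
      \<Longrightarrow> exit_from x u = z"
    and continuous_exit_from: "continuous_on {u. norm u = 1 \<and> u \<bullet> n < 0} (exit_from x)"
proof -
  have e: "\<exists>d>0. x + d *\<^sub>R u \<in> K" if "u \<bullet> n < 0" for u
    using n that by (auto simp: normal_at_def inner_commute)
  have *: "(u, x - (x \<bullet> u) *\<^sub>R u) \<in> lines_meeting K" if "norm u = 1" "u \<bullet> n < 0" for u
    using e[OF that(2)] line_through_frontier(1)[OF x that(1)] by blast
  show "\<exists>s>0. exit_from x u = x + s *\<^sub>R u" if "norm u = 1" "u \<bullet> n < 0" for u
    using e[OF that(2)] line_through_frontier(3)[OF x that(1)] unfolding exit_from_def by blast
  show "exit_from x u = z" if "norm u = 1" "u \<bullet> n < 0" "z \<in> frontier K" "z = x + s *\<^sub>R u" "z \<noteq> x" for u z s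
    using e[OF that(2)] line_through_frontier(4)[OF x that(1) _ _ that(3-5)] unfolding exit_from_def by blast
  show "continuous_on {u. norm u = 1 \<and> u \<bullet> n < 0} (exit_from x)"
    unfolding exit_from_def
    by (rule continuous_on_compose2[OF continuous_entry_exit(2)]) (use * in \<open>auto intro!: continuous_intros\<close>)
qed

lemma ball_patch:
  assumes x: "x \<in> frontier K" and n: "normal_at K x n" and d: "\<And>i::nat. 0 < d i" "d \<longlonglongrightarrow> 0"
  shows "shrinking_patch K x n d (\<lambda>i. ball x (d i)) 1 norm"
proof
  have dist: "dist x (x + d i *\<^sub>R t) = d i * norm t" for i t
    using d(1)[of i] by (simp add: dist_norm)
  show "\<forall>\<^sub>F i in sequentially. x + d i *\<^sub>R \<tau> i \<in> ball x (d i)" if "norm q < 1" "\<tau> \<longlonglongrightarrow> q" for q \<tau>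
    using order_tendstoD(2)[OF tendsto_norm[OF that(2)] that(1)]
    by eventually_elim (use d in \<open>simp add: dist\<close>)
  show "\<forall>\<^sub>F i in sequentially. x + d i *\<^sub>R \<tau> i \<notin> ball x (d i)" if "1 < norm q" "\<tau> \<longlonglongrightarrow> q" for q \<tau>
    using order_tendstoD(1)[OF tendsto_norm[OF that(2)] that(1)]
    by eventually_elim (use d in \<open>simp add: dist\<close>)
  show "emeasure (perp_lborel n) {q. norm q = 1} = 0"
    using n by (intro emeasure_perp_lborel_sphere) (auto simp: normal_at_def)
qed (use assms in \<open>auto simp: dist_norm norm_minus_commute\<close>)

end

text \<open>Evaluated at one arbitrary unit vector in order to have a constant of the dimension
  alone.\<close>

definition disc_vol :: "'n::finite itself \<Rightarrow> ennreal" where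
  "disc_vol _ = unit_disc_vol (axis undefined 1 :: real^'n)"

definition cos_mean :: "'n::finite itself \<Rightarrow> ennreal" where
  "cos_mean _ = cosine_mean (axis undefined 1 :: real^'n)"

lemma unit_disc_vol_disc_vol: "norm u = 1 \<Longrightarrow> unit_disc_vol (u :: real^'n) = disc_vol TYPE('n)"
  unfolding disc_vol_def by (rule unit_disc_vol_eq) (auto simp: norm_axis_1)

lemma cosine_mean_cos_mean: "norm u = 1 \<Longrightarrow> cosine_mean (u :: real^'n) = cos_mean TYPE('n)"
  unfolding cos_mean_def by (rule cosine_mean_eq) (auto simp: norm_axis_1)

lemma disc_vol: "disc_vol TYPE('n::finite) \<noteq> 0" "disc_vol TYPE('n) \<noteq> top"
  using unit_disc_vol_pos[of "axis undefined 1 :: real^'n"] unit_disc_vol_less_top[of "axis undefined 1 :: real^'n"]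
  by (auto simp: disc_vol_def norm_axis_1)

lemma cos_mean: "cos_mean TYPE('n::finite) \<noteq> 0" "cos_mean TYPE('n) \<noteq> top"
proof -
  have n: "norm (axis undefined 1 :: real^'n) = 1" by (simp add: norm_axis_1)
  show "cos_mean TYPE('n::finite) \<noteq> 0"
    using cosine_mean_pos[of "axis undefined 1 :: real^'n"] by (auto simp: cos_mean_def axis_eq_0_iff)
  show "cos_mean TYPE('n) \<noteq> top"
    using cosine_mean_le_1[OF n] by (auto simp: cos_mean_def top_unique)
qed

context independent_body
begin

text \<open>Conditioning on the entry point in a small ball about \<open>x\<close> gives, in the limit, only an
  inequality for open sets; equality follows because both sides are probability measures.\<close>

lemma exit_distribution:
  assumes x: "x \<in> frontier K" and n: "normal_at K x n" and W: "W \<in> sets borel"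
  shows "cos_mean TYPE('n) * emeasure \<sigma> W
    = (\<integral>\<^sup>+u. ennreal (- (u \<bullet> n)) * indicator {u. norm u = 1 \<and> u \<bullet> n < 0 \<and> exit_from x u \<in> W} u \<partial>sphere_prob)"
proof -
  interpret S: prob_space \<sigma> by (rule prob_space_\<sigma>)
  have S1: "emeasure \<sigma> UNIV = 1" using S.emeasure_space_1 by simp
  define cm where "cm = cos_mean TYPE('n)"
  have nn: "norm n = 1" using n by (simp add: normal_at_def)
  have cm: "cosine_mean n = cm" "cm \<noteq> 0" "cm \<noteq> top"
    using cosine_mean_cos_mean[OF nn] cos_mean by (auto simp: cm_def)
  define E where "E = {u. norm u = 1 \<and> u \<bullet> n < 0}"
  have E[measurable]: "E \<in> sets borel" unfolding E_def by measurable
  define e where "e u = (if u \<in> E then exit_from x u else 0)" for u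
  have "exit_from x \<in> borel_measurable (restrict_space borel E)"
    unfolding E_def by (intro borel_measurable_continuous_on_restrict continuous_exit_from[OF x n])
  then have e[measurable]: "e \<in> borel_measurable borel"
    unfolding e_def by (subst (asm) measurable_restrict_space_iff[where c=0]) (auto simp: E)
  have ind: "indicator {u. norm u = 1 \<and> u \<bullet> n < 0 \<and> exit_from x u \<in> W} u = (indicator E u * indicator W (e u) :: ennreal)" for W u
    by (auto simp: indicator_def E_def e_def)
  \<comment> \<open>The exit law from \<open>x\<close> under cosine distributed directions; division
    by \<open>cm\<close> makes it a probability measure.\<close>
  define P where "P = distr (density sphere_prob (\<lambda>u. ennreal (- (u \<bullet> n)) * indicator E u / cm)) borel e"
  have sP: "sets P = sets borel" by (simp add: P_def)
  have P: "cm * emeasure P W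
      = (\<integral>\<^sup>+u. ennreal (- (u \<bullet> n)) * indicator {u. norm u = 1 \<and> u \<bullet> n < 0 \<and> exit_from x u \<in> W} u \<partial>sphere_prob)"
    if [measurable]: "W \<in> sets borel" for W
  proof -
    have "emeasure P W = (\<integral>\<^sup>+z. indicator W z \<partial>P)" using that sP by simp
    also have "\<dots> = (\<integral>\<^sup>+u. (ennreal (- (u \<bullet> n)) * indicator E u / cm) * indicator W (e u) \<partial>sphere_prob)"
      unfolding P_def by (subst nn_integral_distr) (auto simp: nn_integral_density)
    also have "\<dots> = (\<integral>\<^sup>+u. (ennreal (- (u \<bullet> n)) * indicator E u * indicator W (e u)) / cm \<partial>sphere_prob)"
      by (simp add: divide_ennreal_def mult_ac)
    also have "\<dots> = (\<integral>\<^sup>+u. ennreal (- (u \<bullet> n)) * indicator E u * indicator W (e u) \<partial>sphere_prob) / cm"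
      by (rule nn_integral_divide) measurable
    finally have "cm * emeasure P W = (\<integral>\<^sup>+u. ennreal (- (u \<bullet> n)) * indicator E u * indicator W (e u) \<partial>sphere_prob) / cm * cm"
      by (simp add: mult.commute)
    also have "\<dots> = (\<integral>\<^sup>+u. ennreal (- (u \<bullet> n)) * indicator E u * indicator W (e u) \<partial>sphere_prob)"
      unfolding ennreal_divide_times using cm ennreal_divide_self[of cm] by (simp add: less_top)
    finally show ?thesis by (simp add: ind mult.assoc)
  qed
  have "cm * emeasure P UNIV = cm"
  proof -
    have "(\<integral>\<^sup>+u. ennreal (- (u \<bullet> n)) * indicator {u. norm u = 1 \<and> u \<bullet> n < 0 \<and> exit_from x u \<in> UNIV} u \<partial>sphere_prob)
        = cosine_mean n"
      unfolding cosine_mean_def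
      by (rule nn_integral_cong_AE, rule AE_mp[OF AE_sphere_prob], rule AE_I2)
         (auto simp: indicator_def ennreal_neg)
    then show ?thesis using P[of UNIV] cm(1) by simp
  qed
  then have "cm * emeasure P UNIV = cm * 1" by simp
  then have "emeasure P UNIV = 1" using cm unfolding ennreal_mult_cancel_left by auto
  then have "prob_space P" by (intro prob_spaceI) (simp add: P_def)
  define d where "d i = 1 / (real i + 1)" for i
  have d: "0 < d i" "d \<longlonglongrightarrow> 0" for i
    unfolding d_def using LIMSEQ_inverse_real_of_nat by (auto simp: inverse_eq_divide add.commute)
  interpret B: shrinking_patch K x n d "\<lambda>i. ball x (d i)" 1 norm by (rule ball_patch[OF x n d])
  have area: "B.area = disc_vol TYPE('n)"
    using unit_disc_vol_disc_vol[OF nn] by (simp add: B.area_def unit_disc_vol_def)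
  have "emeasure P W \<le> emeasure \<sigma> W" if W: "open W" for W
  proof -
    have Wb: "W \<in> sets borel" using W by (rule borel_open)
    have "(\<lambda>i. ennreal (1 / d i ^ (CARD('n) - 1)) * emeasure crofton_measure (hit (ball x (d i)) UNIV) * emeasure \<sigma> W)
      \<longlonglongrightarrow> cm * disc_vol TYPE('n) * emeasure \<sigma> W"
      using tendsto_mult_ennreal[OF B.patch_limit tendsto_const[of "emeasure \<sigma> W"]] cm disc_vol[where 'n='n]
      by (simp add: area ennreal_mult_eq_top_iff)
    \<comment> \<open>Independence enters here: the lines that enter near \<open>x\<close> and leave
      through \<open>W\<close> have the mass of all lines entering near \<open>x\<close> times
      \<open>emeasure \<sigma> W\<close>.\<close>
    then have lim: "(\<lambda>i. ennreal (1 / d i ^ (CARD('n) - 1)) * emeasure crofton_measure (hit (ball x (d i)) W))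
      \<longlonglongrightarrow> cm * disc_vol TYPE('n) * emeasure \<sigma> W"
      using Wb by (simp add: emeasure_hit S1 mult.assoc)
    have "(\<integral>\<^sup>+u. ennreal (- (u \<bullet> n)) * indicator (E \<inter> e -` W) u \<partial>sphere_prob) * B.area
        \<le> cm * disc_vol TYPE('n) * emeasure \<sigma> W"
    proof (rule B.patch_liminf[OF W lim])
      show "E \<inter> e -` W \<in> sets borel" using measurable_sets[OF e Wb] by auto
      show "exit_point K (u, B.foot u) \<in> W" if "u \<in> E \<inter> e -` W" for u
        using that by (auto simp: e_def exit_from_def B.foot_def)
    qed
    also have "(\<integral>\<^sup>+u. ennreal (- (u \<bullet> n)) * indicator (E \<inter> e -` W) u \<partial>sphere_prob) = cm * emeasure P W"
      unfolding P[OF Wb] ind by (intro nn_integral_cong) (auto simp: indicator_def)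
    finally have "(cm * disc_vol TYPE('n)) * emeasure P W \<le> (cm * disc_vol TYPE('n)) * emeasure \<sigma> W"
      by (simp add: area mult_ac)
    moreover have "cm * disc_vol TYPE('n) \<noteq> 0" "cm * disc_vol TYPE('n) \<noteq> top"
      using cm disc_vol[where 'n='n] by (auto simp: ennreal_mult_eq_top_iff)
    ultimately show ?thesis by (simp add: ennreal_mult_le_mult_iff)
  qed
  then have "P = \<sigma>"
    using \<open>prob_space P\<close> prob_space_\<sigma> sP by (intro prob_measures_eq_open) auto
  then show ?thesis using P[OF W] by (simp add: cm_def)
qed

end

section \<open>Patches cut out by a thin cone with apex on the boundary\<close>

text \<open>The derivative of \<open>sgn\<close> at \<open>r *\<^sub>R u\<close> is the projection
  orthogonal to \<open>u\<close>, divided by \<open>r\<close>. The sequential form is the one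
  \<open>shrinking_patch\<close> asks for.\<close>

lemma tendsto_sgn_blowup:
  fixes u q :: "'a::real_inner"
  assumes u: "norm u = 1" and r: "0 < r" and d: "\<And>i::nat. 0 < d i" "d \<longlonglongrightarrow> 0" and \<tau>: "\<tau> \<longlonglongrightarrow> q"
  shows "(\<lambda>i. norm (sgn (r *\<^sub>R u + d i *\<^sub>R \<tau> i) - u) / d i) \<longlonglongrightarrow> norm (q - (q \<bullet> u) *\<^sub>R u) / r"
proof -
  define a where "a i = norm (r *\<^sub>R u + d i *\<^sub>R \<tau> i)" for i
  have uu: "u \<bullet> u = 1" using u by (simp add: dot_square_norm)
  have a: "a \<longlonglongrightarrow> r"
    unfolding a_def using u r by (auto intro!: tendsto_eq_intros d \<tau>)
  \<comment> \<open>The difference quotient \<open>(a i - r) / d i\<close> of the norm, written as a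
    difference of squares over a sum so that its limit is visible.\<close>
  define b where "b i = (2 * r * (u \<bullet> \<tau> i) + d i * (\<tau> i \<bullet> \<tau> i)) / (a i + r)" for i
  have b: "b \<longlonglongrightarrow> u \<bullet> q"
    unfolding b_def using r by (auto intro!: tendsto_eq_intros d \<tau> a)
  have lim: "(\<lambda>i. norm (\<tau> i - b i *\<^sub>R u) / a i) \<longlonglongrightarrow> norm (q - (u \<bullet> q) *\<^sub>R u) / r"
    using r by (intro tendsto_intros \<tau> a b) auto
  have "\<forall>\<^sub>F i in sequentially. 0 < a i" using order_tendstoD(1)[OF a r] .
  then have "\<forall>\<^sub>F i in sequentially. norm (\<tau> i - b i *\<^sub>R u) / a i = norm (sgn (r *\<^sub>R u + d i *\<^sub>R \<tau> i) - u) / d i"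
  proof eventually_elim
    case (elim i)
    have "a i ^ 2 = r ^ 2 + 2 * r * d i * (u \<bullet> \<tau> i) + d i ^ 2 * (\<tau> i \<bullet> \<tau> i)"
      unfolding a_def power2_norm_eq_inner
      by (simp add: inner_add_left inner_add_right uu inner_commute power2_eq_square algebra_simps)
    then have "(a i - r) * (a i + r) = d i * (2 * r * (u \<bullet> \<tau> i) + d i * (\<tau> i \<bullet> \<tau> i))"
      by (simp add: power2_eq_square algebra_simps)
    moreover have "a i + r \<noteq> 0" using elim r by simp
    ultimately have db: "d i * b i = a i - r"
      by (simp add: b_def nonzero_divide_eq_eq eq_divide_eq)
    have "sgn (r *\<^sub>R u + d i *\<^sub>R \<tau> i) - u = (1 / a i) *\<^sub>R (r *\<^sub>R u + d i *\<^sub>R \<tau> i - a i *\<^sub>R u)"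
      using elim by (simp add: sgn_div_norm a_def[symmetric] scaleR_diff_right inverse_eq_divide)
    also have "r *\<^sub>R u + d i *\<^sub>R \<tau> i - a i *\<^sub>R u = d i *\<^sub>R \<tau> i - (a i - r) *\<^sub>R u"
      by (simp add: algebra_simps)
    also have "\<dots> = d i *\<^sub>R (\<tau> i - b i *\<^sub>R u)"
      unfolding db[symmetric] by (simp add: scaleR_diff_right)
    finally have "norm (sgn (r *\<^sub>R u + d i *\<^sub>R \<tau> i) - u) = (1 / a i) * (d i * norm (\<tau> i - b i *\<^sub>R u))"
      using elim d(1)[of i] by simp
    then show ?case using d(1)[of i] by simp
  qed
  from Lim_transform_eventually[OF lim this] show ?thesis by (simp add: inner_commute)
qed

context convex_body
begin

text \<open>Near \<open>y\<close> the boundary is transversal to the line of sight from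
  \<open>x\<close>: the direction from \<open>y\<close> to a boundary point keeps away from
  \<open>- u\<close>, which enters \<open>K\<close>, and from \<open>u\<close>, which points above
  the tangent plane. So it has a component of at least \<open>k / 2\<close> across the line of
  sight, and displacement shows up as angle.\<close>

lemma cone_distance:
  fixes x y :: "real^'n"
  assumes x: "x \<in> frontier K" and y: "y \<in> frontier K" and n: "normal_at K y n" and xy: "n \<bullet> (x - y) < 0"
  obtains \<rho> C where "0 < \<rho>" "0 \<le> C"
    "\<And>z. z \<in> frontier K \<Longrightarrow> norm (z - y) < \<rho> \<Longrightarrow> norm (z - y) \<le> C * norm (sgn (z - x) - sgn (y - x))"
proof -
  define r where "r = norm (y - x)"
  define u where "u = sgn (y - x)"
  have "x \<noteq> y" using xy by auto
  then have r: "0 < r" by (simp add: r_def)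
  have u: "norm u = 1" "y - x = r *\<^sub>R u"
    using \<open>x \<noteq> y\<close> by (auto simp: u_def r_def norm_sgn sgn_div_norm)
  have uu: "u \<bullet> u = 1" using u by (simp add: dot_square_norm)
  have "x - y = - (r *\<^sub>R u)" using u(2) by (metis minus_diff_eq)
  then have nu: "0 < n \<bullet> u" using xy r by (simp add: zero_less_mult_iff)
  have nn: "norm n = 1" using n by (simp add: normal_at_def)
  have yc: "y \<in> closure K" using y by (simp add: frontier_eq)
  have "n \<bullet> (- u) < 0" using nu by simp
  then obtain e where e: "0 < e" "\<And>d v'. 0 < d \<Longrightarrow> d < e \<Longrightarrow> norm (v' - (- u)) < e \<Longrightarrow> y + d *\<^sub>R v' \<in> K"
    using normal_at_near[OF n yc] by metis
  define k where "k = min 1 (min e (n \<bullet> u))"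
  have k: "0 < k" "k \<le> 1" "k \<le> e" "k \<le> n \<bullet> u" using e nu by (auto simp: k_def)
  define \<rho> where "\<rho> = min e r"
  \<comment> \<open>Origin of the constant: at least \<open>k / 2\<close> of the displacement is
    transversal, and \<open>norm (z - x)\<close> is at most \<open>2 * r\<close>.\<close>
  have "norm (z - y) \<le> (4 * r / k) * norm (sgn (z - x) - u)" if z: "z \<in> frontier K" and zy: "norm (z - y) < \<rho>" for z
  proof (cases "z = y")
    case False
    define l where "l = norm (z - y)"
    have l: "0 < l" "l < e" "l < r" using False zy by (auto simp: l_def \<rho>_def)
    define v where "v = sgn (z - y)"
    have v: "norm v = 1" "z - y = l *\<^sub>R v" using False by (auto simp: v_def l_def norm_sgn sgn_div_norm)
    have vv: "v \<bullet> v = 1" using v by (simp add: dot_square_norm)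
    have zeq: "z = y + l *\<^sub>R v" using v(2) by (simp add: diff_eq_eq add.commute)
    have "z \<notin> K" using z by (simp add: frontier_eq)
    then have 1: "e \<le> norm (v + u)" using e(2)[OF l(1,2), of v] zeq by force
    have "n \<bullet> (z - y) \<le> 0" using normal_at_closure[OF n] z by (simp add: frontier_eq)
    then have "n \<bullet> v \<le> 0" unfolding v(2) using l by (simp add: mult_le_0_iff)
    then have "n \<bullet> u \<le> n \<bullet> (u - v)" by (simp add: inner_diff_right)
    also have "\<dots> \<le> norm (u - v)" using Cauchy_Schwarz_ineq2[of n "u - v"] nn by simp
    finally have 2: "n \<bullet> u \<le> norm (u - v)" .
    define c where "c = v \<bullet> u"
    have "k ^ 2 \<le> norm (v + u) ^ 2" "k ^ 2 \<le> norm (u - v) ^ 2"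
      using 1 2 k by (auto intro!: power_mono)
    then have c: "k ^ 2 \<le> 2 + 2 * c" "k ^ 2 \<le> 2 - 2 * c"
      unfolding power2_norm_eq_inner
      by (simp_all add: inner_add_left inner_add_right inner_diff_left inner_diff_right uu vv c_def inner_commute)
    have "k ^ 2 / 2 \<le> 1 - c ^ 2"
    proof (cases "0 \<le> c")
      case True
      have "k ^ 2 / 2 * 1 \<le> (1 - c) * (1 + c)" using c True zero_le_power2[of k] by (intro mult_mono) linarith+
      then show ?thesis by (simp add: power2_eq_square algebra_simps)
    next
      case False
      have "1 * (k ^ 2 / 2) \<le> (1 - c) * (1 + c)" using c False zero_le_power2[of k] by (intro mult_mono) linarith+
      then show ?thesis by (simp add: power2_eq_square algebra_simps)
    qed
    moreover have "norm (v - c *\<^sub>R u) ^ 2 = 1 - c ^ 2"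
      unfolding power2_norm_eq_inner
      by (simp add: inner_diff_left inner_diff_right uu vv c_def inner_commute power2_eq_square)
    moreover have "(k / 2) ^ 2 = k ^ 2 / 4" by (simp add: power_divide)
    ultimately have "(k / 2) ^ 2 \<le> norm (v - c *\<^sub>R u) ^ 2" using zero_le_power2[of k] by linarith
    then have 3: "k / 2 \<le> norm (v - c *\<^sub>R u)" by (rule power2_le_imp_le) simp
    define a where "a = norm (z - x)"
    have "z - x = (y - x) + (z - y)" by simp
    then have zx: "z - x = r *\<^sub>R u + l *\<^sub>R v" unfolding u(2) v(2) .
    have "r - l \<le> a" unfolding a_def zx using norm_diff_ineq[of "r *\<^sub>R u" "l *\<^sub>R v"] u v r l by simp
    then have a0: "0 < a" using l by simp
    have a2: "a \<le> 2 * r" unfolding a_def zx using norm_triangle_ineq[of "r *\<^sub>R u" "l *\<^sub>R v"] u v r l by simp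
    define w where "w = sgn (z - x) - u"
    have "sgn (z - x) = (1 / a) *\<^sub>R (z - x)" by (simp add: sgn_div_norm a_def inverse_eq_divide)
    then have w: "w = (1 / a) *\<^sub>R (r *\<^sub>R u + l *\<^sub>R v) - u" unfolding w_def by (simp only: zx)
    have "w - (w \<bullet> u) *\<^sub>R u = (l / a) *\<^sub>R (v - c *\<^sub>R u)"
      unfolding w by (simp add: inner_diff_left inner_add_left uu c_def algebra_simps)
    then have "norm ((l / a) *\<^sub>R (v - c *\<^sub>R u)) \<le> norm w" using norm_proj_le[OF u(1), of w] by simp
    then have "(l / a) * norm (v - c *\<^sub>R u) \<le> norm w" using l a0 by simp
    moreover have "(l / (2 * r)) * (k / 2) \<le> (l / a) * norm (v - c *\<^sub>R u)"
      using 3 a2 a0 l r k by (intro mult_mono) (auto intro!: divide_left_mono)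
    ultimately have "l * k / (4 * r) \<le> norm w" by simp
    then show ?thesis using r k by (simp add: l_def w_def field_simps)
  qed (use r k in simp)
  moreover have "0 < \<rho>" "0 \<le> 4 * r / k" using e r k by (auto simp: \<rho>_def)
  ultimately show ?thesis using that[of \<rho> "4 * r / k"] unfolding u_def by blast
qed

text \<open>Blown up, the cone cuts the tangent plane in an oblique section whose projection along
  \<open>u\<close> is a disc of radius \<open>r\<close> in the hyperplane of \<open>u\<close>; this
  gives the area. The cut-off \<open>\<rho>\<close> keeps to the neighbourhood of \<open>y\<close>
  where \<open>cone_distance\<close> applies.\<close>

lemma cone_patch:
  fixes x y :: "real^'n"
  assumes x: "x \<in> frontier K" and y: "y \<in> frontier K" and n: "normal_at K y n" and xy: "n \<bullet> (x - y) < 0"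
    and d: "\<And>i::nat. 0 < d i" "d \<longlonglongrightarrow> 0"
  defines "u \<equiv> sgn (y - x)" and "r \<equiv> norm (y - x)"
  obtains \<rho> C where "0 < \<rho>"
    "shrinking_patch K y n d (\<lambda>i. {z. norm (z - y) < \<rho> \<and> norm (sgn (z - x) - u) < d i}) C (\<lambda>q. norm (q - (q \<bullet> u) *\<^sub>R u) / r)"
    "\<bar>u \<bullet> n\<bar> > 0" "ennreal \<bar>u \<bullet> n\<bar> * emeasure (perp_lborel n) {q. norm (q - (q \<bullet> u) *\<^sub>R u) / r < 1}
       = ennreal (r ^ (CARD('n) - 1)) * unit_disc_vol u"
proof -
  obtain \<rho> C where \<rho>: "0 < \<rho>" and C: "0 \<le> C"
    and dist: "\<And>z. z \<in> frontier K \<Longrightarrow> norm (z - y) < \<rho> \<Longrightarrow> norm (z - y) \<le> C * norm (sgn (z - x) - u)"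
    unfolding u_def using cone_distance[OF x y n xy] by metis
  have "x \<noteq> y" using xy by auto
  then have r: "0 < r" by (simp add: r_def)
  have u: "norm u = 1" "y - x = r *\<^sub>R u"
    using \<open>x \<noteq> y\<close> by (auto simp: u_def r_def norm_sgn sgn_div_norm)
  have nn: "norm n = 1" using n by (simp add: normal_at_def)
  have "x - y = - (r *\<^sub>R u)" using u(2) by (metis minus_diff_eq)
  then have nu: "0 < u \<bullet> n" using xy r by (simp add: zero_less_mult_iff inner_commute)
  define N where "N q = norm (q - (q \<bullet> u) *\<^sub>R u) / r" for q
  have Nb[measurable]: "N \<in> borel_measurable borel" unfolding N_def by measurable
  define \<pi> where "\<pi> p = p - ((p \<bullet> n) / (u \<bullet> n)) *\<^sub>R u" for p
  have N\<pi>: "N (\<pi> p) = norm p / r" if "p \<bullet> u = 0" for p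
    using that u(1) by (simp add: N_def \<pi>_def inner_diff_left dot_square_norm)
  have trans: "ennreal \<bar>u \<bullet> n\<bar> * emeasure (perp_lborel n) {q. N q \<in> A} = emeasure (perp_lborel u) {p. norm p / r \<in> A}"
    if [measurable]: "A \<in> sets borel" for A
  proof -
    have "ennreal \<bar>u \<bullet> n\<bar> * emeasure (perp_lborel n) {q. N q \<in> A}
        = ennreal \<bar>u \<bullet> n\<bar> * (\<integral>\<^sup>+q. indicator {q. N q \<in> A} q \<partial>perp_lborel n)" by simp
    also have "\<dots> = (\<integral>\<^sup>+p. indicator {q. N q \<in> A} (\<pi> p) \<partial>perp_lborel u)"
      unfolding \<pi>_def using nu by (intro nn_integral_perp_lborel_change[OF u(1) nn, symmetric]) auto
    also have "\<dots> = (\<integral>\<^sup>+p. indicator {p. norm p / r \<in> A} p \<partial>perp_lborel u)"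
      by (rule nn_integral_cong_AE, rule AE_mp[OF AE_perp_lborel[OF u(1)]], rule AE_I2)
         (simp add: indicator_def N\<pi>)
    finally show ?thesis by simp
  qed
  have "ennreal \<bar>u \<bullet> n\<bar> * emeasure (perp_lborel n) {q. N q = 1} = 0"
    using trans[of "{1}"] emeasure_perp_lborel_sphere[OF u(1) r] r by (simp add: divide_eq_eq)
  then have null: "emeasure (perp_lborel n) {q. N q = 1} = 0" using nu by simp
  have area: "ennreal \<bar>u \<bullet> n\<bar> * emeasure (perp_lborel n) {q. N q < 1} = ennreal (r ^ (CARD('n) - 1)) * unit_disc_vol u"
    using trans[of "{..<1}"] emeasure_perp_lborel_ball[OF u(1) _ r, of 0] r by (simp add: divide_less_eq)
  have sgn_eq: "sgn (y + d i *\<^sub>R t - x) = sgn (r *\<^sub>R u + d i *\<^sub>R t)" for i t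
  proof -
    have "y + d i *\<^sub>R t - x = (y - x) + d i *\<^sub>R t" by simp
    then show ?thesis unfolding u(2) by (rule arg_cong)
  qed
  have near: "\<forall>\<^sub>F i in sequentially. norm ((y + d i *\<^sub>R \<tau> i) - y) < \<rho>" if "\<tau> \<longlonglongrightarrow> q" for \<tau> q
  proof -
    have "(\<lambda>i. norm (d i *\<^sub>R \<tau> i)) \<longlonglongrightarrow> 0" by (auto intro!: tendsto_eq_intros that d)
    from order_tendstoD(2)[OF this \<rho>] show ?thesis by simp
  qed
  have patch: "shrinking_patch K y n d (\<lambda>i. {z. norm (z - y) < \<rho> \<and> norm (sgn (z - x) - u) < d i}) C N"
  proof
    show "{z. norm (z - y) < \<rho> \<and> norm (sgn (z - x) - u) < d i} \<in> sets borel" for i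
      unfolding sgn_div_norm by measurable
    show "norm (z - y) \<le> C * d i" if "z \<in> {z. norm (z - y) < \<rho> \<and> norm (sgn (z - x) - u) < d i}" "z \<in> frontier K" for i z
    proof -
      have "norm (z - y) \<le> C * norm (sgn (z - x) - u)" using that dist by auto
      also have "\<dots> \<le> C * d i" using that C by (intro mult_left_mono) auto
      finally show ?thesis .
    qed
    fix q :: "real^'n" and \<tau> assume \<tau>: "\<tau> \<longlonglongrightarrow> q"
    note lim = tendsto_sgn_blowup[OF u(1) r d \<tau>]
    show "\<forall>\<^sub>F i in sequentially. y + d i *\<^sub>R \<tau> i \<in> {z. norm (z - y) < \<rho> \<and> norm (sgn (z - x) - u) < d i}" if "N q < 1"
      using order_tendstoD(2)[OF lim that[unfolded N_def]] near[OF \<tau>]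
      by eventually_elim (use d in \<open>simp add: sgn_eq divide_less_eq\<close>)
    show "\<forall>\<^sub>F i in sequentially. y + d i *\<^sub>R \<tau> i \<notin> {z. norm (z - y) < \<rho> \<and> norm (sgn (z - x) - u) < d i}" if "1 < N q"
      using order_tendstoD(1)[OF lim that[unfolded N_def]]
      by eventually_elim (use d in \<open>simp add: sgn_eq less_divide_eq\<close>)
  qed (use assms(1-5) d C null Nb in auto)
  show ?thesis
    using that[of \<rho> C] \<rho> patch area nu unfolding N_def by simp
qed

end

section \<open>Eliminating the surface measure\<close>

context independent_body
begin

text \<open>One factor \<open>cos_mean\<close> normalises the exit law from \<open>x\<close>; the
  other, with \<open>disc_vol\<close>, comes from the blow-up at \<open>y\<close>;
  \<open>total_mass\<close> converts Crofton mass into probability.\<close>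

definition density_const :: real where
  "density_const = (enn2real (cos_mean TYPE('n)))^2 * enn2real (disc_vol TYPE('n)) / enn2real total_mass"

text \<open>The cone patch is measured twice. As exit law from \<open>x\<close> its probability is
  asymptotically proportional to the cosine at \<open>x\<close> times a cap of directions; as entry
  law it is given by the blow-up at \<open>y\<close>. Eliminating it leaves the cap, which may be
  moved to any centre \<open>e\<close>, so that the left side no longer sees \<open>x\<close> and
  \<open>y\<close>.\<close>

lemma cap_asymptotics:
  fixes x y nx ny e :: "real^'n"
  assumes x: "x \<in> frontier K" and nx: "normal_at K x nx" and y: "y \<in> frontier K" and ny: "normal_at K y ny"
    and yx: "nx \<bullet> (y - x) < 0" and xy: "ny \<bullet> (x - y) < 0" and e: "norm e = 1"
    and d: "\<And>i::nat. 0 < d i" "d \<longlonglongrightarrow> 0"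
  shows "(\<lambda>i. measure sphere_prob {u. norm (u - e) < d i} / d i ^ (CARD('n) - 1)) \<longlonglongrightarrow>
    density_const * norm (y - x) ^ (CARD('n) + 1) / ((nx \<bullet> (x - y)) * (ny \<bullet> (y - x)))"
proof -
  interpret S: prob_space \<sigma> by (rule prob_space_\<sigma>)
  interpret Q: prob_space "sphere_prob :: (real^'n) measure" by (rule prob_space_sphere_prob)
  define m where "m = CARD('n) - 1"
  define r where "r = norm (y - x)"
  define u where "u = sgn (y - x)"
  have "x \<noteq> y" using xy by auto
  then have r: "0 < r" by (simp add: r_def)
  have u: "norm u = 1" "y - x = r *\<^sub>R u"
    using \<open>x \<noteq> y\<close> by (auto simp: u_def r_def norm_sgn sgn_div_norm)
  have nn: "norm nx = 1" "norm ny = 1" using nx ny by (auto simp: normal_at_def)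
  define a where "a = - (u \<bullet> nx)"
  define b where "b = u \<bullet> ny"
  have xy': "x - y = - (r *\<^sub>R u)" using u(2) by (metis minus_diff_eq)
  have a0: "0 < a" using yx r unfolding u(2) a_def by (simp add: mult_less_0_iff inner_commute)
  have b0: "0 < b" using xy r unfolding xy' b_def by (simp add: zero_less_mult_iff inner_commute)
  obtain cm where cm: "cos_mean TYPE('n) = ennreal cm" "0 < cm"
    using cos_mean[where 'n='n] by (cases "cos_mean TYPE('n)") (auto simp: less_le)
  obtain dv where dv: "disc_vol TYPE('n) = ennreal dv" "0 < dv"
    using disc_vol[where 'n='n] by (cases "disc_vol TYPE('n)") (auto simp: less_le)
  obtain tm where tm: "total_mass = ennreal tm" "0 < tm"
    using total_mass by (cases total_mass) (auto simp: less_le)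
  obtain \<rho> C where \<rho>: "0 < \<rho>"
    and patch: "shrinking_patch K y ny d (\<lambda>i. {z. norm (z - y) < \<rho> \<and> norm (sgn (z - x) - u) < d i}) C (\<lambda>q. norm (q - (q \<bullet> u) *\<^sub>R u) / r)"
    and "\<bar>u \<bullet> ny\<bar> > 0"
    and area: "ennreal \<bar>u \<bullet> ny\<bar> * emeasure (perp_lborel ny) {q. norm (q - (q \<bullet> u) *\<^sub>R u) / r < 1}
       = ennreal (r ^ m) * unit_disc_vol u"
    by (rule cone_patch[OF x y ny xy d, folded u_def r_def m_def])
  define B where "B i = {z. norm (z - y) < \<rho> \<and> norm (sgn (z - x) - u) < d i}" for i
  interpret P: shrinking_patch K y ny d B C "\<lambda>q. norm (q - (q \<bullet> u) *\<^sub>R u) / r"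
    using patch unfolding B_def .
  have "ennreal b * P.area = ennreal (r ^ m * dv)"
    using area b0 r dv unit_disc_vol_disc_vol[OF u(1)] by (simp add: P.area_def b_def ennreal_mult)
  then have "P.area \<noteq> top" using b0 by (auto simp: ennreal_mult_top)
  then obtain ar where ar: "P.area = ennreal ar" "0 \<le> ar" by (cases P.area) auto
  have "b * ar = r ^ m * dv"
    using \<open>ennreal b * P.area = ennreal (r ^ m * dv)\<close> b0 r dv ar
    by (simp add: ennreal_mult[symmetric])
  then have ar_eq: "ar = r ^ m * dv / b" using b0 by (simp add: field_simps)
  define R where "R i = tm * measure \<sigma> (B i) / d i ^ m" for i
  have R: "R \<longlonglongrightarrow> cm * ar"
  proof -
    have "ennreal (1 / d i ^ (CARD('n) - 1)) * emeasure crofton_measure (hit (B i) UNIV) = ennreal (R i)" for i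
      unfolding emeasure_hit_UNIV[OF P.B_borel] R_def m_def tm(1) S.emeasure_eq_measure
      using d(1)[of i] tm(2) by (simp add: ennreal_mult[symmetric])
    then have "(\<lambda>i. ennreal (R i)) \<longlonglongrightarrow> ennreal (cm * ar)"
      using P.patch_limit cm ar cosine_mean_cos_mean[OF nn(2)] by (simp add: ennreal_mult)
    then show ?thesis
      using d(1) tm(2) cm ar by (subst (asm) tendsto_ennreal_iff) (auto simp: R_def less_imp_le)
  qed
  define s where "s i = measure sphere_prob {v. norm (v - u) < d i}" for i
  have s_e: "s i = measure sphere_prob {v. norm (v - e) < d i}" for i
    unfolding s_def measure_def using emeasure_sphere_prob_ball[of u e "d i"] u e by simp
  have uE: "u \<bullet> nx < 0" using a0 by (simp add: a_def)
  have exit_u: "exit_from x u = y"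
    by (rule exit_from_eq[OF x nx u(1) uE y, of r]) (use u(2) \<open>x \<noteq> y\<close> in \<open>auto simp: algebra_simps\<close>)
  \<comment> \<open>Continuity of the exit point makes the cut-off \<open>\<rho>\<close> hold
    automatically for all directions near \<open>u\<close>.\<close>
  have "\<exists>\<eta>>0. \<forall>v\<in>{u. norm u = 1 \<and> u \<bullet> nx < 0}. dist v u < \<eta> \<longrightarrow> dist (exit_from x v) (exit_from x u) < \<rho>"
    using continuous_exit_from[OF x nx] u(1) uE \<rho> unfolding continuous_on_iff by blast
  then obtain \<eta> where \<eta>: "\<eta> > 0" "\<And>v. norm v = 1 \<Longrightarrow> v \<bullet> nx < 0 \<Longrightarrow> dist v u < \<eta> \<Longrightarrow> dist (exit_from x v) y < \<rho>"
    unfolding exit_u by blast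
  have bounds: "\<forall>\<^sub>F i in sequentially. (a - d i) * s i \<le> cm * measure \<sigma> (B i) \<and> cm * measure \<sigma> (B i) \<le> (a + d i) * s i \<and> d i < a"
    using order_tendstoD(2)[OF d(2) \<eta>(1)] order_tendstoD(2)[OF d(2) a0]
  proof eventually_elim
    case (elim i)
    \<comment> \<open>The cosine is 1-Lipschitz in the direction, so on the cap it equals
      \<open>a\<close> up to \<open>d i\<close>.\<close>
    have in_a: "\<bar>- (v \<bullet> nx) - a\<bar> \<le> d i" if "norm (v - u) < d i" for v
      using Cauchy_Schwarz_ineq2[of "v - u" nx] nn that by (simp add: a_def inner_diff_left)
    have cap: "norm (v - u) < d i \<longleftrightarrow> v \<bullet> nx < 0 \<and> exit_from x v \<in> B i" if v: "norm v = 1" for v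
    proof -
      have "exit_from x v \<in> B i \<longleftrightarrow> dist (exit_from x v) y < \<rho> \<and> norm (v - u) < d i" if vn: "v \<bullet> nx < 0"
      proof -
        obtain t where "t > 0" "exit_from x v = x + t *\<^sub>R v" using exit_from[OF x nx v vn] by blast
        then have "sgn (exit_from x v - x) = v" using v by (simp add: sgn_scaleR sgn_div_norm)
        then show ?thesis by (simp add: B_def dist_norm)
      qed
      moreover have "v \<bullet> nx < 0" if "norm (v - u) < d i" using in_a[OF that] elim by linarith
      moreover have "dist (exit_from x v) y < \<rho>" if "norm (v - u) < d i" "v \<bullet> nx < 0"
        using \<eta>(2)[OF v that(2)] that(1) elim by (simp add: dist_norm)
      ultimately show ?thesis by blast
    qed
    have capb: "{v. norm (v - u) < d i} \<in> sets (sphere_prob :: (real^'n) measure)" by simp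
    have s: "emeasure sphere_prob {v. norm (v - u) < d i} = ennreal (s i)"
      by (simp add: s_def Q.emeasure_eq_measure)
    have eq: "ennreal (cm * measure \<sigma> (B i)) = (\<integral>\<^sup>+v. ennreal (- (v \<bullet> nx)) * indicator {v. norm (v - u) < d i} v \<partial>sphere_prob)"
    proof -
      have "ennreal (cm * measure \<sigma> (B i)) = cos_mean TYPE('n) * emeasure \<sigma> (B i)"
        using cm by (simp add: S.emeasure_eq_measure ennreal_mult)
      also have "\<dots> = (\<integral>\<^sup>+v. ennreal (- (v \<bullet> nx)) * indicator {u. norm u = 1 \<and> u \<bullet> nx < 0 \<and> exit_from x u \<in> B i} v \<partial>sphere_prob)"
        by (rule exit_distribution[OF x nx P.B_borel])
      also have "\<dots> = (\<integral>\<^sup>+v. ennreal (- (v \<bullet> nx)) * indicator {v. norm (v - u) < d i} v \<partial>sphere_prob)"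
        by (rule nn_integral_cong_AE, rule AE_mp[OF AE_sphere_prob], rule AE_I2) (auto simp: indicator_def cap)
      finally show ?thesis .
    qed
    have "ennreal ((a - d i) * s i) = (\<integral>\<^sup>+v. ennreal (a - d i) * indicator {v. norm (v - u) < d i} v \<partial>sphere_prob)"
      using capb elim s by (subst nn_integral_cmult_indicator) (auto simp: ennreal_mult s_def)
    also have "\<dots> \<le> ennreal (cm * measure \<sigma> (B i))"
      unfolding eq using in_a by (intro nn_integral_mono) (force simp: indicator_def intro!: ennreal_leI)
    finally have 1: "(a - d i) * s i \<le> cm * measure \<sigma> (B i)"
      using cm by (subst (asm) ennreal_le_iff) auto
    have "ennreal (cm * measure \<sigma> (B i)) \<le> (\<integral>\<^sup>+v. ennreal (a + d i) * indicator {v. norm (v - u) < d i} v \<partial>sphere_prob)"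
      unfolding eq using in_a by (intro nn_integral_mono) (force simp: indicator_def intro!: ennreal_leI)
    also have "\<dots> = ennreal ((a + d i) * s i)"
      using capb d(1)[of i] a0 s by (subst nn_integral_cmult_indicator) (auto simp: ennreal_mult s_def)
    finally have 2: "cm * measure \<sigma> (B i) \<le> (a + d i) * s i"
      using a0 d(1)[of i] by (subst (asm) ennreal_le_iff) (auto simp: s_def)
    show ?case using 1 2 elim by simp
  qed
  have "(\<lambda>i. s i / d i ^ m) \<longlonglongrightarrow> (cm / tm) * (cm * ar) / (a - 0)"
  proof (rule tendsto_sandwich)
    show "(\<lambda>i. (cm / tm) * R i / (a + d i)) \<longlonglongrightarrow> (cm / tm) * (cm * ar) / (a - 0)"
      using a0 tm(2) by (auto intro!: tendsto_eq_intros R d)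
    show "(\<lambda>i. (cm / tm) * R i / (a - d i)) \<longlonglongrightarrow> (cm / tm) * (cm * ar) / (a - 0)"
      using a0 tm(2) by (auto intro!: tendsto_eq_intros R d)
    have R': "(cm / tm) * R i = cm * measure \<sigma> (B i) / d i ^ m" for i using tm by (simp add: R_def)
    show "\<forall>\<^sub>F i in sequentially. (cm / tm) * R i / (a + d i) \<le> s i / d i ^ m"
      using bounds
    proof eventually_elim
      case (elim i)
      have "cm * measure \<sigma> (B i) / d i ^ m \<le> (a + d i) * s i / d i ^ m"
        using elim d(1)[of i] by (intro divide_right_mono) auto
      then show ?case unfolding R' using a0 d(1)[of i] by (simp add: pos_divide_le_eq mult.commute)
    qed
    show "\<forall>\<^sub>F i in sequentially. s i / d i ^ m \<le> (cm / tm) * R i / (a - d i)"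
      using bounds
    proof eventually_elim
      case (elim i)
      have "(a - d i) * s i / d i ^ m \<le> cm * measure \<sigma> (B i) / d i ^ m"
        using elim d(1)[of i] by (intro divide_right_mono) auto
      then have "s i / d i ^ m * (a - d i) \<le> cm * measure \<sigma> (B i) / d i ^ m" by (simp add: mult.commute)
      then show ?case unfolding R' by (rule mult_imp_le_div_pos[rotated]) (use elim in simp)
    qed
  qed
  also have "(cm / tm) * (cm * ar) / (a - 0) = density_const * norm (y - x) ^ (CARD('n) + 1) / ((nx \<bullet> (x - y)) * (ny \<bullet> (y - x)))"
  proof -
    have 1: "nx \<bullet> (x - y) = r * a" unfolding xy' a_def by (simp add: inner_commute)
    have 2: "ny \<bullet> (y - x) = r * b" unfolding u(2) b_def by (simp add: inner_commute)
    \<comment> \<open>The radius of the disc contributes \<open>m\<close> powers of the distance;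
      the other two come from inner products with the unnormalised chord.\<close>
    have "CARD('n) + 1 = m + 2" by (simp add: m_def)
    then have 3: "norm (y - x) ^ (CARD('n) + 1) = r ^ m * (r * r)"
      by (simp add: r_def[symmetric] power_add power2_eq_square)
    show ?thesis
      unfolding 1 2 3 ar_eq density_const_def
      using cm dv tm r a0 b0 by (simp add: power2_eq_square field_simps)
  qed
  finally show ?thesis unfolding s_e m_def .
qed

text \<open>The limit in \<open>cap_asymptotics\<close> is a single number \<open>l\<close> for all
  pairs of points, so solving for the product of the two factors gives one constant.\<close>

theorem density_identity:
  obtains c where "0 < c"
    "\<And>x y nx ny. \<lbrakk>x \<in> frontier K; normal_at K x nx; y \<in> frontier K; normal_at K y ny;
       nx \<bullet> (y - x) < 0; ny \<bullet> (x - y) < 0\<rbrakk>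
     \<Longrightarrow> (nx \<bullet> (x - y)) * (ny \<bullet> (y - x)) = c * norm (y - x) ^ (CARD('n) + 1)"
proof -
  define d where "d i = 1 / (real i + 1)" for i
  have d: "0 < d i" "d \<longlonglongrightarrow> 0" for i
    unfolding d_def using LIMSEQ_inverse_real_of_nat by (auto simp: inverse_eq_divide add.commute)
  define e :: "real^'n" where "e = axis undefined 1"
  have e: "norm e = 1" by (simp add: e_def norm_axis_1)
  \<comment> \<open>Convergence of this sequence is not known beforehand;
    \<open>cap_asymptotics\<close> provides it as soon as one admissible pair of points
    exists.\<close>
  define l where "l = lim (\<lambda>i. measure sphere_prob {u. norm (u - e) < d i} / d i ^ (CARD('n) - 1))"
  have dc: "0 < density_const"
    using cos_mean[where 'n='n] disc_vol[where 'n='n] total_mass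
    by (auto simp: density_const_def enn2real_eq_0_iff zero_less_mult_iff zero_less_divide_iff enn2real_positive_iff less_top zero_less_iff_neq_zero)
  have key: "0 < l \<and> (nx \<bullet> (x - y)) * (ny \<bullet> (y - x)) = density_const / l * norm (y - x) ^ (CARD('n) + 1)"
    if as: "x \<in> frontier K" "normal_at K x nx" "y \<in> frontier K" "normal_at K y ny"
       "nx \<bullet> (y - x) < 0" "ny \<bullet> (x - y) < 0" for x y nx ny
  proof -
    define A where "A = (nx \<bullet> (x - y)) * (ny \<bullet> (y - x))"
    define r where "r = norm (y - x) ^ (CARD('n) + 1)"
    have "0 < nx \<bullet> (x - y)" "0 < ny \<bullet> (y - x)" using as(5,6) by (auto simp: inner_diff_right)
    then have A: "0 < A" by (simp add: A_def)
    have "x \<noteq> y" using as(5) by auto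
    then have r: "0 < r" by (simp add: r_def)
    have l: "l = density_const * r / A"
      unfolding l_def A_def r_def by (rule limI, rule cap_asymptotics[OF as e d])
    then have "0 < l" using dc r A by simp
    moreover have "A = density_const / l * r" using l dc r A \<open>0 < l\<close> by (simp add: field_simps)
    ultimately show ?thesis unfolding A_def r_def by blast
  qed
  show ?thesis
  proof (cases "0 < l")
    case True
    show ?thesis by (rule that[of "density_const / l"]) (use True dc key in auto)
  next
    \<comment> \<open>Then no admissible pair exists, and any positive constant will do.\<close>
    case False
    show ?thesis by (rule that[of 1]) (use False key in auto)
  qed
qed

end

section \<open>Second order behaviour of the boundary\<close>

text \<open>The mean value theorem is applied on a segment to the function minus its quadratic
  Taylor polynomial. The derivative of \<open>g'\<close> at the single point \<open>X\<close> then
  controls both expansions, with \<open>g'' h h / 2\<close> for the function and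
  \<open>g'' h h\<close> for its derivative along \<open>h\<close>.\<close>

lemma second_order_expansion:
  fixes g :: "'a::real_normed_vector \<Rightarrow> real"
  assumes V: "open V" "X \<in> V" and g': "\<And>z. z \<in> V \<Longrightarrow> (g has_derivative blinfun_apply (g' z)) (at z)"
    and g'': "(g' has_derivative blinfun_apply g'') (at X)" and e: "0 < e"
  obtains \<delta> where "0 < \<delta>"
    "\<And>h. norm h < \<delta> \<Longrightarrow> \<bar>g (X + h) - g X - g' X h - g'' h h / 2\<bar> \<le> e * norm h ^ 2"
    "\<And>h. norm h < \<delta> \<Longrightarrow> \<bar>g' (X + h) h - g' X h - g'' h h\<bar> \<le> e * norm h ^ 2"
proof -
  obtain d1 where d1: "0 < d1" "ball X d1 \<subseteq> V" using V open_contains_ball by blast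
  obtain d2 where d2: "0 < d2" "\<And>z. norm (z - X) < d2 \<Longrightarrow> norm (g' z - g' X - g'' (z - X)) \<le> e * norm (z - X)"
    using g'' e unfolding has_derivative_at_alt by blast
  define \<delta> where "\<delta> = min d1 d2"
  have gen: "\<bar>g' (X + s *\<^sub>R h) h - g' X h - s * g'' h h\<bar> \<le> e * norm h ^ 2"
    if h: "norm h < \<delta>" and s: "0 \<le> s" "s \<le> 1" for h s
  proof -
    have sh: "norm (s *\<^sub>R h) \<le> norm h" using s by (simp add: mult_left_le_one_le)
    have "g' (X + s *\<^sub>R h) h - g' X h - s * g'' h h = (g' (X + s *\<^sub>R h) - g' X - g'' (s *\<^sub>R h)) h"
      by (simp add: blinfun.diff_left blinfun.scaleR_left blinfun.scaleR_right)
    then have "\<bar>g' (X + s *\<^sub>R h) h - g' X h - s * g'' h h\<bar>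
        \<le> norm (g' (X + s *\<^sub>R h) - g' X - g'' (s *\<^sub>R h)) * norm h"
      using norm_blinfun[of "g' (X + s *\<^sub>R h) - g' X - g'' (s *\<^sub>R h)" h] by simp
    also have "\<dots> \<le> (e * norm (s *\<^sub>R h)) * norm h"
      using d2(2)[of "X + s *\<^sub>R h"] sh h by (intro mult_right_mono) (auto simp: \<delta>_def)
    also have "\<dots> \<le> (e * norm h) * norm h" using sh e by (intro mult_right_mono mult_left_mono) auto
    finally show ?thesis by (simp add: power2_eq_square mult.assoc)
  qed
  have first: "\<bar>g (X + h) - g X - g' X h - g'' h h / 2\<bar> \<le> e * norm h ^ 2" if h: "norm h < \<delta>" for h
  proof -
    define \<psi> where "\<psi> s = g (X + s *\<^sub>R h) - s * g' X h - s ^ 2 / 2 * g'' h h" for s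
    have D: "(\<psi> has_real_derivative (g' (X + s *\<^sub>R h) h - g' X h - s * g'' h h)) (at s)" if s: "0 \<le> s" "s \<le> 1" for s
    proof -
      have "norm (s *\<^sub>R h) \<le> norm h" using s by (simp add: mult_left_le_one_le)
      then have "X + s *\<^sub>R h \<in> V" using h d1 by (auto simp: \<delta>_def dist_norm subset_eq)
      from g'[OF this] have "((\<lambda>s. g (X + s *\<^sub>R h)) has_derivative (\<lambda>t. g' (X + s *\<^sub>R h) (t *\<^sub>R h))) (at s)"
        by (rule has_derivative_compose[rotated]) (auto intro!: derivative_eq_intros)
      moreover have "(\<lambda>t. g' (X + s *\<^sub>R h) (t *\<^sub>R h)) = (*) (g' (X + s *\<^sub>R h) h)"
        by (auto simp: fun_eq_iff blinfun.scaleR_right)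
      ultimately have "((\<lambda>s. g (X + s *\<^sub>R h)) has_real_derivative (g' (X + s *\<^sub>R h) h)) (at s)"
        by (simp add: has_field_derivative_def)
      then show ?thesis unfolding \<psi>_def by (auto intro!: derivative_eq_intros)
    qed
    obtain s where s: "0 < s" "s < 1" "\<psi> 1 - \<psi> 0 = (1 - 0) * (g' (X + s *\<^sub>R h) h - g' X h - s * g'' h h)"
      using MVT2[of 0 1 \<psi> "\<lambda>s. g' (X + s *\<^sub>R h) h - g' X h - s * g'' h h"] D by auto
    have "\<psi> 1 - \<psi> 0 = g (X + h) - g X - g' X h - g'' h h / 2" by (simp add: \<psi>_def)
    then show ?thesis using s gen[OF h, of s] by simp
  qed
  show ?thesis
    by (rule that[of \<delta>]) (use d1 d2 first gen[of _ 1] in \<open>auto simp: \<delta>_def\<close>)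
qed

lemma normal_at_eq:
  assumes "normal_at K y n" "normal_at K y m"
  shows "m = n"
proof (rule normal_at_unique[OF assms(1)])
  show "norm m = 1" using assms(2) by (simp add: normal_at_def)
  show "m \<bullet> (z - y) \<le> 0" if "z \<in> K" for z
    using assms(2) that by (simp add: normal_at_def less_imp_le)
qed

section \<open>Normals and second order behaviour in a chart\<close>

locale boundary_chart = convex_body K for K :: "(real^'n) set" +
  fixes f :: "real^'n \<Rightarrow> real^'n" and a :: "real^'n" and k :: 'n and g :: "real^'n \<Rightarrow> real"
    and U :: "(real^'n) set" and g' :: "real^'n \<Rightarrow> (real^'n) \<Rightarrow>\<^sub>L real"
    and g'' :: "real^'n \<Rightarrow> (real^'n) \<Rightarrow>\<^sub>L ((real^'n) \<Rightarrow>\<^sub>L real)"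
  assumes f: "orthogonal_transformation f"
    and indep: "\<And>y z. (\<And>i. i \<noteq> k \<Longrightarrow> y $ i = z $ i) \<Longrightarrow> g y = g z"
    and U: "open U"
    and g': "\<And>y. y \<in> U \<Longrightarrow> (g has_derivative blinfun_apply (g' (f y + a))) (at (f y + a))"
    and g'': "\<And>y. y \<in> U \<Longrightarrow> (g' has_derivative blinfun_apply (g'' (f y + a))) (at (f y + a))"
    and graph: "\<And>y. y \<in> U \<Longrightarrow> y \<in> frontier K \<longleftrightarrow> (f y + a) $ k = g (f y + a)"
    and below: "\<And>y. y \<in> U \<Longrightarrow> y \<in> K \<longleftrightarrow> (f y + a) $ k < g (f y + a)"
begin

definition T :: "real^'n \<Rightarrow> real^'n" where "T y = f y + a"

lemma linear_f: "linear f" using f by (rule orthogonal_transformation_linear)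

lemma norm_f: "norm (f v) = norm v" using f by (rule orthogonal_transformation_norm)

lemma T_add: "T (y + v) = T y + f v" using linear_f by (simp add: T_def linear_add)

lemma f_scaleR: "f (t *\<^sub>R v) = t *\<^sub>R f v" using linear_f by (simp add: linear_cmul)

lemma T_diff: "T y = T x + f (y - x)" using T_add[of x "y - x"] by simp

text \<open>The derivative along \<open>v\<close> of the height of \<open>T y\<close> above the
  graph of \<open>g\<close>; \<open>w\<close> below is its gradient, an outer normal not yet of unit
  length.\<close>

definition slope :: "real^'n \<Rightarrow> real^'n \<Rightarrow> real" where
  "slope y v = f v $ k - g' (T y) (f v)"

definition w :: "real^'n \<Rightarrow> real^'n" where "w y = (\<Sum>b\<in>Basis. slope y b *\<^sub>R b)"

lemma inner_w: "w y \<bullet> v = slope y v"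
proof -
  have lin: "linear (slope y)"
    unfolding slope_def using linear_f
    by (intro linearI) (auto simp: linear_add linear_cmul blinfun.add_right blinfun.scaleR_right algebra_simps)
  have "slope y v = slope y (\<Sum>b\<in>Basis. (v \<bullet> b) *\<^sub>R b)" by (simp add: euclidean_representation)
  also have "\<dots> = (\<Sum>b\<in>Basis. (v \<bullet> b) * slope y b)"
    using lin by (simp add: linear_sum linear_cmul)
  also have "\<dots> = w y \<bullet> v"
    unfolding w_def inner_sum_left by (intro sum.cong) (auto simp: inner_commute)
  finally show ?thesis ..
qed

lemma g'_axis: assumes y: "y \<in> U" shows "g' (T y) (axis k 1) = 0"
proof -
  have "(g has_derivative blinfun_apply (g' (T y))) (at (T y + 0 *\<^sub>R axis k 1))"
    using g'[OF y] by (simp add: T_def)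
  then have "((\<lambda>t::real. g (T y + t *\<^sub>R axis k 1)) has_derivative (\<lambda>t. g' (T y) (t *\<^sub>R axis k 1))) (at 0)"
    by (rule has_derivative_compose[rotated]) (auto intro!: derivative_eq_intros)
  moreover have "(\<lambda>t::real. g (T y + t *\<^sub>R axis k 1)) = (\<lambda>_. g (T y))"
    by (intro ext indep) (auto simp: axis_def)
  ultimately have "((\<lambda>_::real. g (T y)) has_derivative (\<lambda>t. g' (T y) (t *\<^sub>R axis k 1))) (at 0)" by simp
  then have "(\<lambda>t::real. g' (T y) (t *\<^sub>R axis k 1)) = (\<lambda>_. 0)"
    by (rule has_derivative_unique) (rule has_derivative_const)
  then show ?thesis by (metis scaleR_one)
qed

text \<open>Since \<open>g\<close> ignores coordinate \<open>k\<close>, the height has slope 1 in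
  that direction.\<close>

lemma w_nonzero: assumes y: "y \<in> U" shows "w y \<noteq> 0"
proof
  assume "w y = 0"
  define v where "v = inv f (axis k 1)"
  have "f v = axis k 1" unfolding v_def
    using orthogonal_transformation_bij[OF f] by (simp add: surj_f_inv_f bij_is_surj)
  then have "slope y v = 1" using g'_axis[OF y] by (simp add: slope_def)
  then show False using \<open>w y = 0\<close> inner_w[of y v] by simp
qed

lemma height_derivative:
  assumes y: "y \<in> U"
  shows "((\<lambda>t. T (y + t *\<^sub>R v) $ k - g (T (y + t *\<^sub>R v))) has_real_derivative slope y v) (at 0)"
proof -
  have "(g has_derivative blinfun_apply (g' (T y))) (at (T y + 0 *\<^sub>R f v))"
    using g'[OF y] by (simp add: T_def)
  then have "((\<lambda>t::real. g (T y + t *\<^sub>R f v)) has_derivative (\<lambda>t. g' (T y) (t *\<^sub>R f v))) (at 0)"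
    by (rule has_derivative_compose[rotated]) (auto intro!: derivative_eq_intros)
  moreover have "(\<lambda>t. g' (T y) (t *\<^sub>R f v)) = (*) (g' (T y) (f v))"
    by (auto simp: fun_eq_iff blinfun.scaleR_right)
  ultimately have "((\<lambda>t. g (T y + t *\<^sub>R f v)) has_real_derivative g' (T y) (f v)) (at 0)"
    by (simp add: has_field_derivative_def)
  moreover have "((\<lambda>t. (T y) $ k + t * f v $ k) has_real_derivative f v $ k) (at 0)"
    by (auto intro!: derivative_eq_intros)
  ultimately show ?thesis
    unfolding slope_def T_add f_scaleR by (auto intro!: derivative_eq_intros)
qed

lemma near_U: assumes "y \<in> U" obtains d where "0 < d" "\<And>t. 0 < t \<Longrightarrow> t < d \<Longrightarrow> y + t *\<^sub>R v \<in> U"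
proof -
  obtain e where e: "0 < e" "ball y e \<subseteq> U" using assms U open_contains_ball by blast
  have "y + t *\<^sub>R v \<in> U" if "0 < t" "t < e / (norm v + 1)" for t
  proof -
    have "t * norm v \<le> t * (norm v + 1)" using that by simp
    also have "\<dots> < e" using that by (simp add: pos_less_divide_eq add_nonneg_pos)
    finally have "y + t *\<^sub>R v \<in> ball y e" using that by (simp add: dist_norm)
    then show ?thesis using e by blast
  qed
  moreover have "0 < e / (norm v + 1)" using e by (simp add: add_nonneg_pos)
  ultimately show ?thesis using that by blast
qed

text \<open>Along a direction of negative slope the ray from \<open>y\<close> dips below the graph
  and enters \<open>K\<close>. Positive slope towards a point of \<open>K\<close> would lift the
  segment above the graph, although convexity keeps it in \<open>K\<close>.\<close>

lemma normal_at_w: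
  assumes yU: "y \<in> U" and y: "y \<in> frontier K"
  shows "normal_at K y ((1 / norm (w y)) *\<^sub>R w y)"
proof -
  have w: "0 < norm (w y)" using w_nonzero[OF yU] by simp
  have h0: "T y $ k - g (T y) = 0" using graph[OF yU] y by (simp add: T_def)
  have dir: "\<exists>d>0. y + d *\<^sub>R v \<in> K" if neg: "slope y v < 0" for v
  proof -
    obtain d1 where d1: "0 < d1" "\<And>t. 0 < t \<Longrightarrow> t < d1 \<Longrightarrow> y + t *\<^sub>R v \<in> U" using near_U[OF yU] by metis
    obtain d2 where d2: "0 < d2" "\<And>t. 0 < t \<Longrightarrow> t < d2 \<Longrightarrow> T (y + t *\<^sub>R v) $ k - g (T (y + t *\<^sub>R v)) < 0"
      using DERIV_neg_dec_right[OF height_derivative[OF yU, of v] neg] h0 by auto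
    define t where "t = min d1 d2 / 2"
    have t: "0 < t" "t < d1" "t < d2" using d1 d2 by (auto simp: t_def)
    have "y + t *\<^sub>R v \<in> K" using below[OF d1(2)[OF t(1,2)]] d2(2)[OF t(1,3)] by (simp add: T_def)
    then show ?thesis using t by blast
  qed
  have le: "slope y (z - y) \<le> 0" if z: "z \<in> K" for z
  proof (rule ccontr)
    assume "\<not> slope y (z - y) \<le> 0"
    then have pos: "0 < slope y (z - y)" by simp
    obtain d1 where d1: "0 < d1" "\<And>t. 0 < t \<Longrightarrow> t < d1 \<Longrightarrow> y + t *\<^sub>R (z - y) \<in> U" using near_U[OF yU] by metis
    obtain d2 where d2: "0 < d2" "\<And>t. 0 < t \<Longrightarrow> t < d2 \<Longrightarrow> 0 < T (y + t *\<^sub>R (z - y)) $ k - g (T (y + t *\<^sub>R (z - y)))"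
      using DERIV_pos_inc_right[OF height_derivative[OF yU, of "z - y"] pos] h0 by auto
    define t where "t = min 1 (min d1 d2) / 2"
    have t: "0 < t" "t < d1" "t < d2" "t \<le> 1" using d1 d2 by (auto simp: t_def)
    have "y - t *\<^sub>R (y - z) \<in> interior K"
      using t z y open_K by (intro mem_interior_closure_convex_shrink convex_K) (auto simp: interior_open frontier_eq)
    moreover have "y - t *\<^sub>R (y - z) = y + t *\<^sub>R (z - y)" by (simp add: algebra_simps)
    ultimately have "y + t *\<^sub>R (z - y) \<in> K" using open_K by (simp add: interior_open)
    then show False using below[OF d1(2)[OF t(1,2)]] d2(2)[OF t(1,3)] by (simp add: T_def)
  qed
  have "w y \<bullet> (z - y) < 0" if z: "z \<in> K" for z
  proof -
    obtain e where e: "0 < e" "ball z e \<subseteq> K" using z open_K open_contains_ball by blast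
    \<comment> \<open>A step along \<open>w y\<close> that stays in \<open>K\<close> upgrades the
      weak inequality to a strict one.\<close>
    define t where "t = e / (2 * norm (w y))"
    have t: "0 < t" using e w by (simp add: t_def)
    have "norm (t *\<^sub>R w y) = e / 2" using e w by (simp add: t_def)
    then have "z + t *\<^sub>R w y \<in> K" using e by (auto simp: subset_eq dist_norm)
    from le[OF this] have "w y \<bullet> (z - y) + t * (w y \<bullet> w y) \<le> 0"
      unfolding inner_w[symmetric] by (simp add: inner_add_right inner_diff_right algebra_simps)
    moreover have "0 < t * (w y \<bullet> w y)" using t w by simp
    ultimately show ?thesis by linarith
  qed
  then show ?thesis
    using w dir unfolding normal_at_def by (auto simp: inner_w divide_less_0_iff)
qed

text \<open>For the gradients \<open>w\<close>, both quotients \<open>A y\<close> and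
  \<open>B y\<close> equal, up to o(1), minus half the Hessian of \<open>g\<close> at
  \<open>T x\<close> along \<open>f (y - x)\<close> divided by the squared distance. Normalising
  divides them by \<open>norm (w x)\<close> and \<open>norm (w y)\<close>; the reciprocals differ by
  a term tending to 0, as \<open>g'\<close> is continuous at \<open>T x\<close>, and
  \<open>A\<close> is bounded.\<close>

lemma second_order_at:
  assumes xU: "x \<in> U" and x: "x \<in> frontier K"
    and nx: "normal_at K x nx" and nu: "\<And>y. y \<in> frontier K \<Longrightarrow> normal_at K y (nu y)"
  shows "((\<lambda>y. (nx \<bullet> (x - y) - nu y \<bullet> (y - x)) / norm (y - x) ^ 2) \<longlongrightarrow> 0) (at x within frontier K)"
    and "\<exists>M. \<forall>\<^sub>F y in at x within frontier K. nx \<bullet> (x - y) / norm (y - x) ^ 2 \<le> M"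
proof -
  define F where "F = at x within frontier K"
  define A where "A y = w x \<bullet> (x - y) / norm (y - x) ^ 2" for y
  define B where "B y = w y \<bullet> (y - x) / norm (y - x) ^ 2" for y
  have evU: "\<forall>\<^sub>F y in F. y \<in> U \<and> y \<in> frontier K \<and> y \<noteq> x"
    unfolding F_def using eventually_at_in_open'[OF U xU] by (auto simp: eventually_at_filter elim: eventually_mono)
  have img: "open (T ` U)"
  proof -
    have bij: "bij f" using f by (rule orthogonal_transformation_bij)
    have inv: "orthogonal_transformation (inv f)" using f by (rule orthogonal_transformation_inv)
    have "T ` U = (\<lambda>z. inv f (z - a)) -` U"
      using bij by (force simp: T_def image_iff bij_inv_eq_iff inv_f_f bij_is_inj surj_f_inv_f bij_is_surj)
    moreover have "continuous_on UNIV (inv f)"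
      by (rule linear_continuous_on)
         (use orthogonal_transformation_linear[OF inv] in \<open>simp add: linear_conv_bounded_linear\<close>)
    then have "continuous_on UNIV (\<lambda>z. inv f (z - a))"
      by (rule continuous_on_compose2[of UNIV]) (auto intro!: continuous_intros)
    ultimately show ?thesis using U by (simp add: open_vimage)
  qed
  have key: "\<forall>\<^sub>F y in F. \<bar>A y - B y\<bar> \<le> 3 * e \<and> \<bar>A y\<bar> \<le> norm (g'' (T x)) / 2 + e" if e: "0 < e" for e
  proof -
    obtain \<delta> where \<delta>: "0 < \<delta>"
      "\<And>h. norm h < \<delta> \<Longrightarrow> \<bar>g (T x + h) - g (T x) - g' (T x) h - g'' (T x) h h / 2\<bar> \<le> e * norm h ^ 2"
      "\<And>h. norm h < \<delta> \<Longrightarrow> \<bar>g' (T x + h) h - g' (T x) h - g'' (T x) h h\<bar> \<le> e * norm h ^ 2"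
    proof (rule second_order_expansion[of "T ` U" "T x" g g' "g'' (T x)" e])
      show "(g has_derivative blinfun_apply (g' z)) (at z)" if "z \<in> T ` U" for z
        using that g' by (auto simp: T_def)
    qed (use img xU g'' e in \<open>auto simp: T_def\<close>)
    have "\<forall>\<^sub>F y in F. dist y x < \<delta>" unfolding F_def eventually_at using \<delta>(1) by blast
    then show ?thesis using evU
    proof eventually_elim
      case (elim y)
      define h where "h = f (y - x)"
      define r2 where "r2 = norm (y - x) ^ 2"
      have r2: "0 < r2" using elim by (simp add: r2_def)
      have h: "norm h < \<delta>" "norm h ^ 2 = r2" using elim by (simp_all add: h_def norm_f dist_norm r2_def)
      have Ty: "T y = T x + h" unfolding h_def by (rule T_diff)
      have hk: "h $ k = g (T x + h) - g (T x)"
        using graph[OF xU] graph[of y] elim x unfolding T_def[symmetric] Ty by (simp add: algebra_simps)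
      have A: "A y = - (g (T x + h) - g (T x) - g' (T x) h) / r2"
      proof -
        have "w x \<bullet> (x - y) = - (w x \<bullet> (y - x))" by (simp add: inner_diff_right)
        then show ?thesis unfolding A_def inner_w slope_def h_def[symmetric] r2_def[symmetric] hk by simp
      qed
      have B: "B y = (g (T x + h) - g (T x) - g' (T x + h) h) / r2"
        unfolding B_def inner_w slope_def h_def[symmetric] r2_def[symmetric] Ty hk ..
      define G where "G = g (T x + h) - g (T x)"
      define G1 where "G1 = g' (T x) h"
      define G2 where "G2 = g' (T x + h) h"
      define Q where "Q = g'' (T x) h h"
      have 1: "\<bar>G - G1 - Q / 2\<bar> \<le> e * r2" "\<bar>G2 - G1 - Q\<bar> \<le> e * r2"
        using \<delta>(2)[OF h(1)] \<delta>(3)[OF h(1)] by (simp_all add: G_def G1_def G2_def Q_def h(2))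
      have "\<bar>Q\<bar> \<le> norm (g'' (T x) h) * norm h"
        unfolding Q_def using norm_blinfun[of "g'' (T x) h" h] by simp
      also have "\<dots> \<le> norm (g'' (T x)) * norm h * norm h"
        by (intro mult_right_mono norm_blinfun) simp
      finally have "\<bar>Q\<bar> \<le> norm (g'' (T x)) * norm h * norm h" .
      then have Q: "\<bar>Q\<bar> \<le> norm (g'' (T x)) * r2" using h(2) by (simp add: power2_eq_square mult.assoc)
      \<comment> \<open>In \<open>- 2 * G + G1 + G2\<close> the Hessian term cancels, leaving minus
        twice the first error plus the second, whence \<open>3 * e\<close>.\<close>
      have "A y - B y = (- 2 * G + G1 + G2) / r2"
        unfolding A B G_def G1_def G2_def by (simp add: diff_divide_distrib add_divide_distrib)
      moreover have "\<bar>- 2 * G + G1 + G2\<bar> \<le> 3 * e * r2" using 1 by linarith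
      ultimately have "\<bar>A y - B y\<bar> \<le> 3 * e" using r2 by (simp add: pos_divide_le_eq)
      moreover have "\<bar>G - G1\<bar> \<le> (norm (g'' (T x)) / 2 + e) * r2" using 1 Q by (simp add: algebra_simps)
      then have "\<bar>A y\<bar> \<le> norm (g'' (T x)) / 2 + e"
        unfolding A G_def[symmetric] G1_def[symmetric] using r2 by (simp add: pos_divide_le_eq)
      ultimately show ?case by simp
    qed
  qed
  define D where "D = norm (g'' (T x)) / 2 + 1"
  have Abd: "\<forall>\<^sub>F y in F. \<bar>A y\<bar> \<le> D" using key[of 1] unfolding D_def by (auto elim: eventually_mono)
  have AB: "((\<lambda>y. A y - B y) \<longlongrightarrow> 0) F"
  proof (rule tendstoI)
    fix e :: real assume "0 < e"
    then show "\<forall>\<^sub>F y in F. dist (A y - B y) 0 < e"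
      using key[of "e / 6"] by (auto elim!: eventually_mono)
  qed
  have nx_eq: "nx = (1 / norm (w x)) *\<^sub>R w x"
    by (rule normal_at_eq[OF normal_at_w[OF xU x] nx])
  have nu_eq: "nu y = (1 / norm (w y)) *\<^sub>R w y" if "y \<in> U" "y \<in> frontier K" for y
    by (rule normal_at_eq[OF normal_at_w[OF that] nu[OF that(2)]])
  have wx: "norm (w x) > 0" using w_nonzero[OF xU] by simp
  have "isCont f x"
    using linear_f by (intro linear_continuous_at) (simp add: linear_conv_bounded_linear)
  then have "(f \<longlongrightarrow> f x) F"
    unfolding F_def isCont_def by (rule tendsto_within_subset) simp
  then have contT: "(T \<longlongrightarrow> T x) F"
    unfolding T_def by (intro tendsto_intros)
  have "isCont g' (T x)" using g''[OF xU] has_derivative_continuous by (auto simp: T_def)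
  then have "((\<lambda>y. g' (T y)) \<longlongrightarrow> g' (T x)) F" using contT by (rule isCont_tendsto_compose)
  then have wlim: "((\<lambda>y. norm (w y)) \<longlongrightarrow> norm (w x)) F"
    unfolding w_def slope_def by (intro tendsto_intros blinfun.tendsto)
  have inv_lim: "((\<lambda>y. 1 / norm (w x) - 1 / norm (w y)) \<longlongrightarrow> 1 / norm (w x) - 1 / norm (w x)) F"
    by (intro tendsto_intros wlim) (use wx in auto)
  have p1: "((\<lambda>y. (A y - B y) / norm (w y)) \<longlongrightarrow> 0 / norm (w x)) F"
    by (intro tendsto_intros AB wlim) (use wx in auto)
  have p2: "((\<lambda>y. A y * (1 / norm (w x) - 1 / norm (w y))) \<longlongrightarrow> 0) F"
  proof (rule Lim_null_comparison)
    show "\<forall>\<^sub>F y in F. norm (A y * (1 / norm (w x) - 1 / norm (w y))) \<le> D * \<bar>1 / norm (w x) - 1 / norm (w y)\<bar>"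
      using Abd by eventually_elim (auto simp: abs_mult intro!: mult_right_mono)
    have "((\<lambda>y. D * \<bar>1 / norm (w x) - 1 / norm (w y)\<bar>) \<longlongrightarrow> D * \<bar>1 / norm (w x) - 1 / norm (w x)\<bar>) F"
      by (intro tendsto_intros inv_lim[simplified] wlim) (use wx in auto)
    then show "((\<lambda>y. D * \<bar>1 / norm (w x) - 1 / norm (w y)\<bar>) \<longlongrightarrow> 0) F" by simp
  qed
  have sum: "((\<lambda>y. (A y - B y) / norm (w y) + A y * (1 / norm (w x) - 1 / norm (w y))) \<longlongrightarrow> 0) F"
    using tendsto_add[OF p1 p2] by simp
  have "\<forall>\<^sub>F y in F. (A y - B y) / norm (w y) + A y * (1 / norm (w x) - 1 / norm (w y))
      = (nx \<bullet> (x - y) - nu y \<bullet> (y - x)) / norm (y - x) ^ 2"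
    using evU
  proof eventually_elim
    case (elim y)
    have "(A y - B y) / norm (w y) + A y * (1 / norm (w x) - 1 / norm (w y)) = A y / norm (w x) - B y / norm (w y)"
      by (simp add: diff_divide_distrib algebra_simps)
    moreover have "nx \<bullet> (x - y) / norm (y - x) ^ 2 = A y / norm (w x)"
      unfolding nx_eq A_def by simp
    moreover have "nu y \<bullet> (y - x) / norm (y - x) ^ 2 = B y / norm (w y)"
      using elim by (simp add: nu_eq B_def)
    ultimately show ?case by (simp add: diff_divide_distrib)
  qed
  from Lim_transform_eventually[OF sum this]
  show "((\<lambda>y. (nx \<bullet> (x - y) - nu y \<bullet> (y - x)) / norm (y - x) ^ 2) \<longlongrightarrow> 0) (at x within frontier K)"
    by (simp add: F_def)
  have "\<forall>\<^sub>F y in F. nx \<bullet> (x - y) / norm (y - x) ^ 2 \<le> D / norm (w x)"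
    using Abd
  proof eventually_elim
    case (elim y)
    have "nx \<bullet> (x - y) / norm (y - x) ^ 2 = A y / norm (w x)" unfolding nx_eq A_def by simp
    also have "\<dots> \<le> D / norm (w x)" using elim by (intro divide_right_mono) auto
    finally show ?case .
  qed
  then show "\<exists>M. \<forall>\<^sub>F y in at x within frontier K. nx \<bullet> (x - y) / norm (y - x) ^ 2 \<le> M"
    unfolding F_def by blast
qed

end

context convex_body
begin

lemma C2_boundary_chart:
  assumes C2: "C2_boundary K" and x: "x \<in> frontier K"
  obtains f a k g U g' g'' where "boundary_chart K f a k g U g' g''" "x \<in> U"
proof -
  note C2[unfolded C2_boundary_def, THEN bspec, OF x]
  then obtain T k g U where *: "rigid_motion T \<and>
      (\<forall>y z. (\<forall>i. i \<noteq> k \<longrightarrow> y $ i = z $ i) \<longrightarrow> g y = (g z :: real)) \<and>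
      open U \<and> x \<in> U \<and> C2_on g (T ` U) \<and>
      (\<forall>y\<in>U. (y \<in> frontier K \<longleftrightarrow> T y $ k = g (T y)) \<and> (y \<in> K \<longleftrightarrow> T y $ k < g (T y)))"
    by (elim exE) (rule that)
  from * have T: "rigid_motion T" by (elim conjE)
  from * have indep: "\<forall>y z. (\<forall>i. i \<noteq> k \<longrightarrow> y $ i = z $ i) \<longrightarrow> g y = g z" by (elim conjE)
  from * have U: "open U" by (elim conjE)
  from * have xU: "x \<in> U" by (elim conjE)
  from * have g: "C2_on g (T ` U)" by (elim conjE)
  from * have gr: "\<forall>y\<in>U. (y \<in> frontier K \<longleftrightarrow> T y $ k = g (T y)) \<and> (y \<in> K \<longleftrightarrow> T y $ k < g (T y))"
    by (elim conjE)
  obtain f a where f: "orthogonal_transformation f" "\<And>y. T y = f y + a"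
    using T unfolding rigid_motion_def by blast
  obtain g' g'' where "\<forall>z\<in>T ` U. (g has_derivative blinfun_apply (g' z)) (at z)"
    "\<forall>z\<in>T ` U. (g' has_derivative blinfun_apply (g'' z)) (at z)"
    using g unfolding C2_on_def by blast
  then have "boundary_chart K f a k g U g' g''"
  proof (unfold_locales, goal_cases)
    case (2 y z)
    then show ?case using indep by blast
  next
    case (4 y)
    then show ?case unfolding f(2)[symmetric] by blast
  next
    case (5 y)
    then show ?case unfolding f(2)[symmetric] by blast
  next
    case (6 y)
    then show ?case unfolding f(2)[symmetric] using gr by blast
  next
    case (7 y)
    then show ?case unfolding f(2)[symmetric] using gr by blast
  qed (use f U in auto)
  then show ?thesis using xU by (rule that)
qed

lemma C2_normal:
  assumes C2: "C2_boundary K" and x: "x \<in> frontier K"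
  shows "\<exists>n. normal_at K x n"
proof -
  obtain f a k g U g' g'' where "boundary_chart K f a k g U g' g''" "x \<in> U"
    using C2_boundary_chart[OF assms] .
  then show ?thesis using boundary_chart.normal_at_w x by blast
qed

lemma C2_second_order:
  assumes C2: "C2_boundary K" and x: "x \<in> frontier K"
    and nx: "normal_at K x nx" and nu: "\<And>y. y \<in> frontier K \<Longrightarrow> normal_at K y (nu y)"
  shows "((\<lambda>y. (nx \<bullet> (x - y) - nu y \<bullet> (y - x)) / norm (y - x) ^ 2) \<longlongrightarrow> 0) (at x within frontier K)"
    and "\<exists>M. \<forall>\<^sub>F y in at x within frontier K. nx \<bullet> (x - y) / norm (y - x) ^ 2 \<le> M"
proof -
  obtain f a k g U g' g'' where c: "boundary_chart K f a k g U g' g''" "x \<in> U"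
    using C2_boundary_chart[OF C2 x] .
  show "((\<lambda>y. (nx \<bullet> (x - y) - nu y \<bullet> (y - x)) / norm (y - x) ^ 2) \<longlongrightarrow> 0) (at x within frontier K)"
    "\<exists>M. \<forall>\<^sub>F y in at x within frontier K. nx \<bullet> (x - y) / norm (y - x) ^ 2 \<le> M"
    using boundary_chart.second_order_at[OF c(1) c(2) x nx nu] by blast+
qed

end

section \<open>The body is a three-dimensional ball\<close>

text \<open>Completing the square. It identifies
  \<open>n \<bullet> (x - z) = M * norm (z - x) ^ 2\<close> as the sphere of radius
  \<open>1 / (2 * M)\<close> through \<open>x\<close> with outer normal \<open>n\<close>
  there.\<close>

lemma norm_diff_center:
  fixes x n z :: "'a::real_inner"
  assumes n: "norm n = 1" and M: "0 < M"
  shows "norm (z - (x - (1 / (2 * M)) *\<^sub>R n)) ^ 2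
    = (1 / (2 * M)) ^ 2 + (norm (z - x) ^ 2 - (n \<bullet> (x - z)) / M)"
proof -
  have "z - (x - (1 / (2 * M)) *\<^sub>R n) = (z - x) + (1 / (2 * M)) *\<^sub>R n" by simp
  then have "norm (z - (x - (1 / (2 * M)) *\<^sub>R n)) ^ 2 = ((z - x) + (1 / (2 * M)) *\<^sub>R n) \<bullet> ((z - x) + (1 / (2 * M)) *\<^sub>R n)"
    by (simp only: power2_norm_eq_inner)
  also have "\<dots> = (z - x) \<bullet> (z - x) + 2 * (1 / (2 * M)) * (n \<bullet> (z - x)) + (1 / (2 * M)) ^ 2 * (n \<bullet> n)"
    by (simp add: inner_add_left inner_add_right inner_commute power2_eq_square algebra_simps)
  also have "n \<bullet> n = 1" using n by (simp add: dot_square_norm)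
  also have "n \<bullet> (z - x) = - (n \<bullet> (x - z))" by (simp add: inner_diff_right)
  also have "2 * (1 / (2 * M)) = 1 / M" using M by simp
  finally show ?thesis by (simp add: power2_norm_eq_inner)
qed

lemma
  fixes x n z :: "'a::real_inner"
  assumes n: "norm n = 1" and M: "0 < M"
  shows dist_center_less: "norm (z - (x - (1 / (2 * M)) *\<^sub>R n)) < 1 / (2 * M) \<longleftrightarrow> M * norm (z - x) ^ 2 < n \<bullet> (x - z)"
    and dist_center_le: "norm (z - (x - (1 / (2 * M)) *\<^sub>R n)) \<le> 1 / (2 * M) \<longleftrightarrow> M * norm (z - x) ^ 2 \<le> n \<bullet> (x - z)"
proof -
  have \<rho>: "0 < 1 / (2 * M)" using M by simp
  have "norm (z - (x - (1 / (2 * M)) *\<^sub>R n)) < 1 / (2 * M) \<longleftrightarrow> norm (z - (x - (1 / (2 * M)) *\<^sub>R n)) ^ 2 < (1 / (2 * M)) ^ 2"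
    using \<rho> power_mono_iff[of "1 / (2 * M)" "norm (z - (x - (1 / (2 * M)) *\<^sub>R n))" 2]
    by (simp add: not_le[symmetric])
  then show "norm (z - (x - (1 / (2 * M)) *\<^sub>R n)) < 1 / (2 * M) \<longleftrightarrow> M * norm (z - x) ^ 2 < n \<bullet> (x - z)"
    unfolding norm_diff_center[OF n M] using M by (simp add: pos_less_divide_eq mult.commute)
  have "norm (z - (x - (1 / (2 * M)) *\<^sub>R n)) \<le> 1 / (2 * M) \<longleftrightarrow> norm (z - (x - (1 / (2 * M)) *\<^sub>R n)) ^ 2 \<le> (1 / (2 * M)) ^ 2"
    using \<rho> power_mono_iff[of "norm (z - (x - (1 / (2 * M)) *\<^sub>R n))" "1 / (2 * M)" 2] by simp
  then show "norm (z - (x - (1 / (2 * M)) *\<^sub>R n)) \<le> 1 / (2 * M) \<longleftrightarrow> M * norm (z - x) ^ 2 \<le> n \<bullet> (x - z)"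
    unfolding norm_diff_center[OF n M] using M by (simp add: pos_le_divide_eq mult.commute)
qed

context convex_body
begin

text \<open>The bound keeps the open ball off the frontier. Being connected and meeting
  \<open>K\<close> just below \<open>x\<close>, it lies in \<open>K\<close>.\<close>

lemma inner_ball:
  assumes x: "x \<in> frontier K" and n: "normal_at K x n" and M: "0 < M"
    and bd: "\<And>y. y \<in> frontier K \<Longrightarrow> n \<bullet> (x - y) \<le> M * norm (y - x) ^ 2"
  shows "ball (x - (1 / (2 * M)) *\<^sub>R n) (1 / (2 * M)) \<subseteq> K"
proof (rule ccontr)
  define Bo where "Bo = ball (x - (1 / (2 * M)) *\<^sub>R n) (1 / (2 * M))"
  assume "\<not> ball (x - (1 / (2 * M)) *\<^sub>R n) (1 / (2 * M)) \<subseteq> K"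
  then have "Bo - K \<noteq> {}" by (auto simp: Bo_def)
  have nn: "norm n = 1" using n by (simp add: normal_at_def)
  have Bo: "z \<in> Bo \<longleftrightarrow> M * norm (z - x) ^ 2 < n \<bullet> (x - z)" for z
    unfolding Bo_def mem_ball dist_norm norm_minus_commute[of _ z] by (rule dist_center_less[OF nn M])
  have n1: "n \<bullet> n = 1" using nn by (simp add: dot_square_norm)
  have xc: "x \<in> closure K" using x by (simp add: frontier_eq)
  have "n \<bullet> (- n) < 0" using n1 by simp
  then obtain e where e: "0 < e" "\<And>d v'. 0 < d \<Longrightarrow> d < e \<Longrightarrow> norm (v' - (- n)) < e \<Longrightarrow> x + d *\<^sub>R v' \<in> K"
    using normal_at_near[OF n xc] by metis
  \<comment> \<open>Below \<open>e\<close> the point \<open>x - d *\<^sub>R n\<close> is in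
    \<open>K\<close>; below the diameter \<open>1 / M\<close> it is in the ball.\<close>
  define m where "m = min e (1 / M)"
  define d where "d = m / 2"
  have m: "0 < m" "m \<le> e" "m \<le> 1 / M" using e M by (auto simp: m_def)
  then have "0 < d" "d < m" by (simp_all add: d_def)
  then have d: "0 < d" "d < e" "d < 1 / M" using m by (auto intro: less_le_trans)
  have "x + d *\<^sub>R (- n) \<in> K" using e(2)[of d "- n"] d e by simp
  moreover have "x + d *\<^sub>R (- n) \<in> Bo"
  proof -
    have "M * d < 1" using d M by (simp add: field_simps)
    then have "M * d * d < 1 * d" using d by (intro mult_strict_right_mono) auto
    then show ?thesis unfolding Bo using d nn n1 by (simp add: power2_eq_square inner_diff_right mult.assoc)
  qed
  ultimately have "Bo \<inter> K \<noteq> {}" by blast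
  moreover have "connected Bo" by (simp add: Bo_def convex_connected)
  ultimately have "Bo \<inter> frontier K \<noteq> {}" using \<open>Bo - K \<noteq> {}\<close> by (intro connected_Int_frontier)
  then obtain y where "y \<in> Bo" "y \<in> frontier K" by blast
  then show False using bd[of y] Bo[of y] by simp
qed

text \<open>A point of \<open>K\<close> lies on a chord, whose ends are on the frontier and hence in
  the convex ball.\<close>

lemma outer_ball:
  assumes n: "norm n = 1" and M: "0 < M"
    and bd: "\<And>y. y \<in> frontier K \<Longrightarrow> M * norm (y - x) ^ 2 \<le> n \<bullet> (x - y)"
  shows "K \<subseteq> cball (x - (1 / (2 * M)) *\<^sub>R n) (1 / (2 * M))"
proof
  define Cl where "Cl = cball (x - (1 / (2 * M)) *\<^sub>R n) (1 / (2 * M))"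
  have Cl: "z \<in> Cl \<longleftrightarrow> M * norm (z - x) ^ 2 \<le> n \<bullet> (x - z)" for z
    unfolding Cl_def mem_cball dist_norm norm_minus_commute[of _ z] by (rule dist_center_le[OF n M])
  fix z assume z: "z \<in> K"
  then have z0: "z + 0 *\<^sub>R n \<in> K" by simp
  have lh: "lo n z < 0" "0 < hi n z" using chord_K[OF n z0, of 0] z by auto
  have "z + lo n z *\<^sub>R n \<in> frontier K" "z + hi n z *\<^sub>R n \<in> frontier K"
    using chord_frontier(1)[OF n z0] by auto
  then have Cl2: "z + lo n z *\<^sub>R n \<in> Cl" "z + hi n z *\<^sub>R n \<in> Cl" using bd Cl by auto
  define s where "s = - lo n z / (hi n z - lo n z)"
  have s: "0 \<le> s" "s \<le> 1" using lh by (auto simp: s_def divide_simps)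
  have "(1 - s) * lo n z + s * hi n z = lo n z + s * (hi n z - lo n z)" by (simp add: algebra_simps)
  also have "\<dots> = 0" using lh by (simp add: s_def)
  finally have s0: "(1 - s) * lo n z + s * hi n z = 0" .
  have "convex Cl" by (simp add: Cl_def)
  then have "(1 - s) *\<^sub>R (z + lo n z *\<^sub>R n) + s *\<^sub>R (z + hi n z *\<^sub>R n) \<in> Cl"
    using Cl2 s by (rule convexD_alt)
  moreover have "(1 - s) *\<^sub>R (z + lo n z *\<^sub>R n) + s *\<^sub>R (z + hi n z *\<^sub>R n)
      = z + ((1 - s) * lo n z + s * hi n z) *\<^sub>R n" by (simp add: algebra_simps)
  ultimately show "z \<in> cball (x - (1 / (2 * M)) *\<^sub>R n) (1 / (2 * M))" using s0 by (simp add: Cl_def)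
qed

text \<open>The point \<open>q + \<rho> *\<^sub>R n\<close> of the closed ball must lie below the
  tangent plane of \<open>K\<close> at \<open>y\<close>, which forces equality in Cauchy-Schwarz for
  \<open>y - q\<close> and \<open>n\<close>.\<close>

lemma touch_inner:
  assumes sub: "ball q \<rho> \<subseteq> K" and \<rho>: "0 < \<rho>" and y: "norm (y - q) = \<rho>" and n: "normal_at K y n"
  shows "n = (1 / \<rho>) *\<^sub>R (y - q)"
proof -
  have nn: "norm n = 1" using n by (simp add: normal_at_def)
  then have n1: "n \<bullet> n = 1" by (simp add: dot_square_norm)
  have "closure (ball q \<rho>) \<subseteq> closure K" using sub by (rule closure_mono)
  moreover have "q + \<rho> *\<^sub>R n \<in> cball q \<rho>" using nn \<rho> by (simp add: dist_norm)
  ultimately have "q + \<rho> *\<^sub>R n \<in> closure K" using \<rho> by (auto simp: closure_ball)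
  then have "n \<bullet> (q + \<rho> *\<^sub>R n - y) \<le> 0" by (rule normal_at_closure[OF n])
  then have ge: "\<rho> \<le> n \<bullet> (y - q)" using n1 by (simp add: inner_diff_right inner_add_right)
  have "norm (y - q - \<rho> *\<^sub>R n) ^ 2 = norm (y - q) ^ 2 - 2 * \<rho> * (n \<bullet> (y - q)) + \<rho> ^ 2"
    unfolding power2_norm_eq_inner using n1
    by (simp add: inner_diff_left inner_diff_right inner_commute power2_eq_square algebra_simps)
  also have "\<dots> = 2 * \<rho> * (\<rho> - n \<bullet> (y - q))" using y by (simp add: power2_eq_square algebra_simps)
  also have "\<dots> \<le> 0" using ge \<rho> by (intro mult_nonneg_nonpos) auto
  finally have "y - q = \<rho> *\<^sub>R n" by simp
  then show ?thesis using \<rho> by simp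
qed

text \<open>The tangent plane of the ball at \<open>y\<close> supports \<open>K\<close>, and the
  supporting normal is unique.\<close>

lemma touch_outer:
  assumes sub: "K \<subseteq> cball q \<rho>" and \<rho>: "0 < \<rho>" and y: "norm (y - q) = \<rho>" and n: "normal_at K y n"
  shows "n = (1 / \<rho>) *\<^sub>R (y - q)"
proof (rule normal_at_unique[OF n, symmetric])
  show "norm ((1 / \<rho>) *\<^sub>R (y - q)) = 1" using y \<rho> by simp
  fix z assume "z \<in> K"
  then have "norm (z - q) \<le> \<rho>" using sub by (auto simp: dist_norm norm_minus_commute)
  have "(y - q) \<bullet> (z - q) \<le> norm (y - q) * norm (z - q)" by (rule norm_cauchy_schwarz)
  also have "\<dots> \<le> \<rho> * \<rho>" using \<open>norm (z - q) \<le> \<rho>\<close> y \<rho> by (intro mult_mono) auto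
  also have "\<rho> * \<rho> = (y - q) \<bullet> (y - q)" using y by (simp add: dot_square_norm power2_eq_square)
  finally have "(y - q) \<bullet> (z - y) \<le> 0" by (simp add: inner_diff_right)
  then show "(1 / \<rho>) *\<^sub>R (y - q) \<bullet> (z - y) \<le> 0" using \<rho> by (simp add: mult_le_0_iff divide_le_0_iff)
qed

text \<open>A sphere that is tangent to the boundary at both \<open>x\<close> and \<open>y\<close> makes equal angles with
  the chord from \<open>x\<close> to \<open>y\<close>.\<close>

lemma tangent_sphere_symmetric:
  fixes x y n m :: "real^'n"
  assumes n: "norm n = 1" and M: "0 < M" and y: "n \<bullet> (x - y) = M * norm (y - x) ^ 2"
    and m: "m = (1 / (1 / (2 * M))) *\<^sub>R (y - (x - (1 / (2 * M)) *\<^sub>R n))"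
  shows "m \<bullet> (y - x) = n \<bullet> (x - y)"
proof -
  have "n \<bullet> (y - x) = - (n \<bullet> (x - y))" by (simp add: inner_diff_right)
  moreover have "m = (2 * M) *\<^sub>R (y - x) + n" using M unfolding m by (simp add: algebra_simps)
  ultimately have "m \<bullet> (y - x) = 2 * M * norm (y - x) ^ 2 - n \<bullet> (x - y)"
    by (simp add: inner_add_left power2_norm_eq_inner)
  then show ?thesis using y by simp
qed

lemma farthest_point:
  obtains x where "x \<in> frontier K" "x \<noteq> 0" "\<And>z. z \<in> closure K \<Longrightarrow> norm z \<le> norm x"
proof -
  have "compact (closure K)" using bounded_K by (simp add: compact_closure)
  moreover have "closure K \<noteq> {}" using nonempty by simp
  ultimately have "\<exists>x\<in>closure K. \<forall>z\<in>closure K. norm z \<le> norm x"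
    by (rule continuous_attains_sup[OF _ _ continuous_on_norm_id])
  then obtain x where x: "x \<in> closure K" "\<And>z. z \<in> closure K \<Longrightarrow> norm z \<le> norm x" by blast
  have far: "\<exists>w\<in>K. norm z < norm w" if z: "z \<in> K" for z
  proof -
    obtain e where e: "0 < e" "ball z e \<subseteq> K" using z open_K open_contains_ball by blast
    obtain v :: "real^'n" where v: "norm v = 1" "norm (z + (e / 2) *\<^sub>R v) = norm z + e / 2"
    proof (cases "z = 0")
      case True
      obtain v :: "real^'n" where "norm v = 1" using vector_choose_size[of 1] by auto
      then show ?thesis using that[of v] True e by simp
    next
      case False
      have "z + (e / 2) *\<^sub>R sgn z = (1 + e / (2 * norm z)) *\<^sub>R z"
        by (simp add: sgn_div_norm algebra_simps inverse_eq_divide)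
      then have "norm (z + (e / 2) *\<^sub>R sgn z) = (1 + e / (2 * norm z)) * norm z" using e by simp
      also have "\<dots> = norm z + e / 2" using False by (simp add: field_simps)
      finally show ?thesis using that[of "sgn z"] False by (simp add: norm_sgn)
    qed
    have "z + (e / 2) *\<^sub>R v \<in> ball z e" using e v by (simp add: dist_norm)
    then show ?thesis using e v by (intro bexI[of _ "z + (e / 2) *\<^sub>R v"]) auto
  qed
  have "x \<notin> K" using far[of x] x(2) closure_subset[of K] by force
  moreover obtain z where "z \<in> K" using nonempty by blast
  then obtain w where "w \<in> K" "norm z < norm w" using far by blast
  then have "x \<noteq> 0" using x(2)[of w] closure_subset[of K] norm_ge_zero[of z] by force
  ultimately show ?thesis using that x by (simp add: frontier_eq)
qed

text \<open>In dimension at least 2 a punctured ball about \<open>x\<close> is connected and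
  contains points inside and outside \<open>K\<close>. This makes limits at \<open>x\<close> along
  the boundary meaningful.\<close>

lemma frontier_islimpt:
  assumes x: "x \<in> frontier K" and n: "normal_at K x n" and two: "2 \<le> CARD('n)"
  shows "x islimpt frontier K"
  unfolding islimpt_approachable
proof (intro allI impI)
  fix e :: real assume e: "0 < e"
  define S where "S = ball x e - {x}"
  have "connected S" unfolding S_def using two by (intro connected_punctured_ball) simp
  moreover have "S \<inter> K \<noteq> {}"
  proof -
    have "x \<in> closure K" "x \<notin> K" using x by (auto simp: frontier_eq)
    then obtain z where "z \<in> K" "dist z x < e" using e by (auto simp: closure_approachable)
    then show ?thesis using \<open>x \<notin> K\<close> by (auto simp: S_def dist_commute)
  qed
  moreover have "x + (e / 2) *\<^sub>R n \<in> S - K"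
  proof -
    have nn: "norm n = 1" "n \<bullet> n = 1" using n by (auto simp: normal_at_def dot_square_norm)
    have "x + (e / 2) *\<^sub>R n \<notin> K"
    proof
      assume "x + (e / 2) *\<^sub>R n \<in> K"
      then have "n \<bullet> (x + (e / 2) *\<^sub>R n - x) < 0" using n unfolding normal_at_def by blast
      then show False using e nn by simp
    qed
    moreover have "n \<noteq> 0" using nn by auto
    ultimately show ?thesis using e nn by (simp add: S_def dist_norm)
  qed
  ultimately have "S \<inter> frontier K \<noteq> {}" using connected_Int_frontier[of S K] by blast
  then show "\<exists>x'\<in>frontier K. x' \<noteq> x \<and> dist x' x < e" by (auto simp: S_def dist_commute)
qed

end

section \<open>Determining the dimension and the shape\<close>

context independent_body
begin

text \<open>In dimension 1 the blow-up factor is 1, so the blow-up at \<open>x\<close> makes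
  \<open>x\<close> an atom of \<open>\<sigma>\<close>; but no line starting at \<open>x\<close>
  exits at \<open>x\<close>, so \<open>exit_distribution\<close> gives it mass 0.\<close>

lemma dimension_not_1:
  assumes x: "x \<in> frontier K" and n: "normal_at K x n"
  shows "CARD('n) \<noteq> 1"
proof
  assume one: "CARD('n) = 1"
  interpret S: prob_space \<sigma> by (rule prob_space_\<sigma>)
  have nn: "norm n = 1" using n by (simp add: normal_at_def)
  define d where "d i = 1 / (real i + 1)" for i
  have d: "0 < d i" "d \<longlonglongrightarrow> 0" for i
    unfolding d_def using LIMSEQ_inverse_real_of_nat by (auto simp: inverse_eq_divide add.commute)
  interpret B: shrinking_patch K x n d "\<lambda>i. ball x (d i)" 1 norm by (rule ball_patch[OF x n d])
  have area: "B.area = disc_vol TYPE('n)"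
    using unit_disc_vol_disc_vol[OF nn] by (simp add: B.area_def unit_disc_vol_def)
  have 1: "(\<lambda>i. total_mass * emeasure \<sigma> (ball x (d i))) \<longlonglongrightarrow> cos_mean TYPE('n) * disc_vol TYPE('n)"
    using B.patch_limit one by (simp add: emeasure_hit_UNIV area cosine_mean_cos_mean[OF nn])
  have "(\<Inter>i. ball x (d i)) = {x}"
  proof (intro set_eqI iffI)
    fix z assume z: "z \<in> (\<Inter>i. ball x (d i))"
    show "z \<in> {x}"
    proof (rule ccontr)
      assume "z \<notin> {x}"
      then have "0 < dist x z" by simp
      then obtain i where "1 / real (Suc i) < dist x z" by (rule nat_approx_posE)
      moreover have "dist x z < d i" using z by simp
      ultimately show False by (simp add: d_def add.commute)
    qed
  qed (use d in auto)
  moreover have "decseq (\<lambda>i. ball x (d i))"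
  proof (rule decseq_SucI)
    fix i
    have "d (Suc i) \<le> d i" unfolding d_def by (intro frac_le) auto
    then show "ball x (d (Suc i)) \<subseteq> ball x (d i)" by (rule subset_ball)
  qed
  ultimately have "(\<lambda>i. emeasure \<sigma> (ball x (d i))) \<longlonglongrightarrow> emeasure \<sigma> {x}"
    using Lim_emeasure_decseq[of "\<lambda>i. ball x (d i)" \<sigma>] by (auto simp: image_subset_iff)
  moreover have "emeasure \<sigma> {x} = 0"
  proof -
    have "cos_mean TYPE('n) * emeasure \<sigma> {x}
      = (\<integral>\<^sup>+u. ennreal (- (u \<bullet> n)) * indicator {u. norm u = 1 \<and> u \<bullet> n < 0 \<and> exit_from x u \<in> {x}} u \<partial>sphere_prob)"
      by (rule exit_distribution[OF x n]) simp
    also have "{u. norm u = 1 \<and> u \<bullet> n < 0 \<and> exit_from x u \<in> {x}} = {}"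
      using exit_from[OF x n] by fastforce
    finally show ?thesis using cos_mean[where 'n='n] by simp
  qed
  ultimately have "(\<lambda>i. total_mass * emeasure \<sigma> (ball x (d i))) \<longlonglongrightarrow> total_mass * 0"
    using total_mass by (intro tendsto_mult_ennreal tendsto_const) auto
  from LIMSEQ_unique[OF 1 this] show False
    using cos_mean[where 'n='n] disc_vol[where 'n='n] by simp
qed

theorem ball_of_dimension_3:
  assumes C2: "C2_boundary K"
  shows "CARD('n) = 3 \<and> (\<exists>c r. r > 0 \<and> frontier K = {c + r *\<^sub>R u | u. u \<in> sphere 0 1})"
proof -
  obtain x where x: "x \<in> frontier K" "x \<noteq> 0" and far: "\<And>z. z \<in> closure K \<Longrightarrow> norm z \<le> norm x"
    using farthest_point by metis
  define R where "R = norm x"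
  have R: "0 < R" using x by (simp add: R_def)
  define nu where "nu y = (SOME n. normal_at K y n)" for y
  have nu: "normal_at K y (nu y)" if "y \<in> frontier K" for y
    unfolding nu_def using C2_normal[OF C2 that] by (rule someI_ex)
  define n where "n = nu x"
  have n: "normal_at K x n" unfolding n_def by (rule nu[OF x(1)])
  have nn: "norm n = 1" using n by (simp add: normal_at_def)
  have n_eq: "n = (1 / R) *\<^sub>R x"
  proof (rule normal_at_unique[OF n, symmetric])
    show "norm ((1 / R) *\<^sub>R x) = 1" using R by (simp add: R_def)
    fix z assume "z \<in> K"
    then have "norm z \<le> norm x" using far closure_subset by blast
    then have "x \<bullet> z \<le> R * R"
      using norm_cauchy_schwarz[of x z] R by (auto simp: R_def intro: order_trans mult_left_mono)
    then have "x \<bullet> (z - x) \<le> 0" by (simp add: inner_diff_right R_def dot_square_norm power2_eq_square)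
    then show "(1 / R) *\<^sub>R x \<bullet> (z - x) \<le> 0" using R by (simp add: divide_le_0_iff mult_le_0_iff)
  qed
  define fr where "fr = frontier K - {x}"
  \<comment> \<open>The closure lies in the ball of radius \<open>R\<close> about 0, whose boundary
    sphere touches at \<open>x\<close>.\<close>
  have low: "norm (y - x) ^ 2 / (2 * R) \<le> n \<bullet> (x - y)" if "y \<in> closure K" for y
  proof -
    have "2 * (x \<bullet> (x - y)) = norm x ^ 2 - norm y ^ 2 + norm (y - x) ^ 2"
      unfolding power2_norm_eq_inner by (simp add: inner_diff_left inner_diff_right inner_commute)
    moreover have "norm y ^ 2 \<le> norm x ^ 2" using far[OF that] by (intro power_mono) auto
    ultimately have "norm (y - x) ^ 2 \<le> 2 * (x \<bullet> (x - y))" by linarith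
    then have "norm (y - x) ^ 2 / (2 * R) \<le> (2 * (x \<bullet> (x - y))) / (2 * R)" using R by (intro divide_right_mono) auto
    then show ?thesis by (simp add: n_eq)
  qed
  define a where "a y = n \<bullet> (x - y)" for y
  define b where "b y = nu y \<bullet> (y - x)" for y
  define r where "r y = norm (y - x)" for y
  have r: "0 < r y" if "y \<in> fr" for y using that by (auto simp: fr_def r_def)
  have frK: "y \<in> frontier K" "y \<in> closure K" if "y \<in> fr" for y using that by (auto simp: fr_def frontier_eq)
  have a: "r y ^ 2 / (2 * R) \<le> a y" "0 < a y" if "y \<in> fr" for y
  proof -
    show 1: "r y ^ 2 / (2 * R) \<le> a y" using low frK[OF that] by (simp add: r_def a_def)
    have "0 < r y ^ 2 / (2 * R)" using r[OF that] R by simp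
    then show "0 < a y" using 1 by linarith
  qed
  \<comment> \<open>If \<open>x\<close> lay in the tangent plane at \<open>y\<close>, then
    \<open>nu y\<close> would support \<open>K\<close> at \<open>x\<close> as well and equal
    \<open>n\<close>, against \<open>0 < a y\<close>.\<close>
  have b: "0 < b y" if y: "y \<in> fr" for y
  proof (rule ccontr)
    assume "\<not> 0 < b y"
    moreover have "nu y \<bullet> (x - y) \<le> 0"
      using normal_at_closure[OF nu[OF frK(1)[OF y]]] x by (simp add: frontier_eq)
    ultimately have 0: "nu y \<bullet> (x - y) = 0" by (simp add: b_def inner_diff_right)
    have "nu y = n"
    proof (rule normal_at_unique[OF n])
      show "norm (nu y) = 1" using nu[OF frK(1)[OF y]] by (simp add: normal_at_def)
      fix z assume "z \<in> K"
      then have "nu y \<bullet> (z - y) < 0" using nu[OF frK(1)[OF y]] by (simp add: normal_at_def)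
      then show "nu y \<bullet> (z - x) \<le> 0" using 0 by (simp add: inner_diff_right)
    qed
    then show False using 0 a(2)[OF y] by (simp add: a_def)
  qed
  obtain c where c: "0 < c" and ident: "\<And>x y nx ny. \<lbrakk>x \<in> frontier K; normal_at K x nx; y \<in> frontier K; normal_at K y ny;
       nx \<bullet> (y - x) < 0; ny \<bullet> (x - y) < 0\<rbrakk>
     \<Longrightarrow> (nx \<bullet> (x - y)) * (ny \<bullet> (y - x)) = c * norm (y - x) ^ (CARD('n) + 1)"
    using density_identity by blast
  have ab: "a y * b y = c * r y ^ (CARD('n) + 1)" if y: "y \<in> fr" for y
  proof -
    have "n \<bullet> (y - x) < 0" using a(2)[OF y] by (simp add: a_def inner_diff_right)
    moreover have "nu y \<bullet> (x - y) < 0" using b[OF y] by (simp add: b_def inner_diff_right)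
    ultimately show ?thesis
      unfolding a_def b_def r_def by (rule ident[OF x(1) n frK(1)[OF y] nu[OF frK(1)[OF y]]])
  qed
  \<comment> \<open>\<open>\<alpha> y\<close> is the reciprocal diameter of the sphere through
    \<open>y\<close> that is tangent at \<open>x\<close>; \<open>\<beta> y\<close> is the same with
    \<open>x\<close> and \<open>y\<close> exchanged.\<close>
  define \<alpha> where "\<alpha> y = a y / r y ^ 2" for y
  define \<beta> where "\<beta> y = b y / r y ^ 2" for y
  have \<alpha>_low: "1 / (2 * R) \<le> \<alpha> y" if "y \<in> fr" for y
  proof -
    have "1 / (2 * R) = r y ^ 2 / (2 * R) / r y ^ 2" using r[OF that] by simp
    also have "\<dots> \<le> \<alpha> y" unfolding \<alpha>_def using a(1)[OF that] r[OF that] by (intro divide_right_mono) auto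
    finally show ?thesis .
  qed
  have \<alpha>\<beta>: "\<alpha> y * \<beta> y * r y ^ 3 = c * r y ^ CARD('n)" if y: "y \<in> fr" for y
  proof -
    have "\<alpha> y * \<beta> y * r y ^ 3 = (a y * b y) / r y"
      unfolding \<alpha>_def \<beta>_def using r[OF y] by (simp add: field_simps eval_nat_numeral)
    then show ?thesis unfolding ab[OF y] using r[OF y] by simp
  qed
  define F where "F = at x within frontier K"
  have two: "2 \<le> CARD('n)"
  proof -
    have "CARD('n) \<noteq> 0" by simp
    then show ?thesis using dimension_not_1[OF x(1) n] by linarith
  qed
  have F: "F \<noteq> bot"
    using frontier_islimpt[OF x(1) n two] by (simp add: F_def trivial_limit_within)
  have evfr: "\<forall>\<^sub>F y in F. y \<in> fr" by (simp add: F_def fr_def eventually_at_filter)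
  have diff: "((\<lambda>y. \<alpha> y - \<beta> y) \<longlongrightarrow> 0) F"
    using C2_second_order(1)[OF C2 x(1) n nu]
    by (simp add: F_def \<alpha>_def \<beta>_def a_def b_def r_def diff_divide_distrib)
  obtain D where D: "\<forall>\<^sub>F y in F. \<alpha> y \<le> D"
    using C2_second_order(2)[OF C2 x(1) n nu] by (auto simp: F_def \<alpha>_def a_def r_def)
  have \<alpha>bd: "\<forall>\<^sub>F y in F. 0 < \<alpha> y \<and> \<alpha> y \<le> D"
    using D evfr
  proof eventually_elim
    case (elim y)
    have "0 < 1 / (2 * R)" using R by simp
    then show ?case using \<alpha>_low[OF elim(2)] elim by linarith
  qed
  have small: "((\<lambda>y. \<alpha> y * (\<alpha> y - \<beta> y)) \<longlongrightarrow> 0) F"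
  proof (rule Lim_null_comparison)
    show "\<forall>\<^sub>F y in F. norm (\<alpha> y * (\<alpha> y - \<beta> y)) \<le> D * \<bar>\<alpha> y - \<beta> y\<bar>"
      using \<alpha>bd by eventually_elim (auto simp: abs_mult intro!: mult_right_mono)
    have "((\<lambda>y. D * \<bar>\<alpha> y - \<beta> y\<bar>) \<longlongrightarrow> D * \<bar>0\<bar>) F" by (intro tendsto_intros diff)
    then show "((\<lambda>y. D * \<bar>\<alpha> y - \<beta> y\<bar>) \<longlongrightarrow> 0) F" by simp
  qed
  have rlim: "(r \<longlongrightarrow> 0) F"
  proof -
    have "(r \<longlongrightarrow> norm (x - x)) F" unfolding r_def F_def by (intro tendsto_intros)
    then show ?thesis by simp
  qed
  \<comment> \<open>Trades the product, known from the identity, for the square of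
    \<open>\<alpha>\<close> up to a term that vanishes by \<open>small\<close>.\<close>
  have prod_eq: "\<alpha> y * \<beta> y = \<alpha> y ^ 2 - \<alpha> y * (\<alpha> y - \<beta> y)" for y by (simp add: power2_eq_square algebra_simps)
  have three: "CARD('n) = 3"
  proof (rule ccontr)
    assume "CARD('n) \<noteq> 3"
    then have "CARD('n) = 2 \<or> CARD('n) = Suc (CARD('n) - 4) + 3" using two by linarith
    then consider "CARD('n) = 2" | k where "CARD('n) = Suc k + 3" by blast
    then show False
    proof cases
      \<comment> \<open>Here \<open>\<alpha> y * \<beta> y * r y = c\<close>, while the left side
        tends to 0 because \<open>\<alpha>\<close> is bounded.\<close>
      case 1
      have bnd: "\<forall>\<^sub>F y in F. norm (\<alpha> y * \<beta> y * r y) \<le> (D ^ 2 + \<bar>\<alpha> y * (\<alpha> y - \<beta> y)\<bar>) * r y"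
        using \<alpha>bd evfr
      proof eventually_elim
        case (elim y)
        have "\<alpha> y ^ 2 \<le> D ^ 2" using elim by (intro power_mono) auto
        moreover have "0 \<le> \<alpha> y ^ 2" by simp
        ultimately have "\<bar>\<alpha> y * \<beta> y\<bar> \<le> D ^ 2 + \<bar>\<alpha> y * (\<alpha> y - \<beta> y)\<bar>" unfolding prod_eq by linarith
        then show ?case using r[OF elim(2)] by (simp add: abs_mult mult_right_mono)
      qed
      have "((\<lambda>y. (D ^ 2 + \<bar>\<alpha> y * (\<alpha> y - \<beta> y)\<bar>) * r y) \<longlongrightarrow> (D ^ 2 + \<bar>0\<bar>) * 0) F"
        by (intro tendsto_intros small rlim)
      then have "((\<lambda>y. (D ^ 2 + \<bar>\<alpha> y * (\<alpha> y - \<beta> y)\<bar>) * r y) \<longlongrightarrow> 0) F"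
        by (simp only: mult_zero_right)
      then have "((\<lambda>y. \<alpha> y * \<beta> y * r y) \<longlongrightarrow> 0) F" by (rule Lim_null_comparison[OF bnd])
      moreover have "\<forall>\<^sub>F y in F. \<alpha> y * \<beta> y * r y = c"
        using evfr
      proof eventually_elim
        case (elim y)
        have "(\<alpha> y * \<beta> y * r y) * r y ^ 2 = c * r y ^ 2"
          using \<alpha>\<beta>[OF elim] 1 by (simp add: power3_eq_cube power2_eq_square mult.assoc)
        then show ?case using r[OF elim] by simp
      qed
      ultimately have "((\<lambda>_. c) \<longlongrightarrow> 0) F" by (rule Lim_transform_eventually)
      then show False using F c by (simp add: tendsto_const_iff)
    next
      \<comment> \<open>Here \<open>\<alpha> y * \<beta> y = c * r y ^ Suc k\<close> tends to 0,
        hence so does \<open>\<alpha>\<close>, against its lower bound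
        \<open>1 / (2 * R)\<close>.\<close>
      case (2 k)
      have "\<forall>\<^sub>F y in F. c * r y ^ Suc k = \<alpha> y * \<beta> y"
        using evfr
      proof eventually_elim
        case (elim y)
        have "\<alpha> y * \<beta> y * r y ^ 3 = c * r y ^ Suc k * r y ^ 3"
          using \<alpha>\<beta>[OF elim] unfolding 2 by (simp only: power_add mult.assoc)
        moreover have "r y ^ 3 \<noteq> 0" using r[OF elim] by simp
        ultimately show ?case by (metis mult_right_cancel)
      qed
      moreover have "((\<lambda>y. c * r y ^ Suc k) \<longlongrightarrow> c * 0 ^ Suc k) F" by (intro tendsto_intros rlim)
      ultimately have "((\<lambda>y. \<alpha> y * \<beta> y) \<longlongrightarrow> c * 0 ^ Suc k) F" by (rule Lim_transform_eventually[rotated])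
      then have "((\<lambda>y. \<alpha> y * \<beta> y + \<alpha> y * (\<alpha> y - \<beta> y)) \<longlongrightarrow> c * 0 ^ Suc k + 0) F"
        by (rule tendsto_add) (rule small)
      then have "((\<lambda>y. \<alpha> y ^ 2) \<longlongrightarrow> 0) F" unfolding prod_eq by simp
      moreover have "\<forall>\<^sub>F y in F. (1 / (2 * R)) ^ 2 \<le> \<alpha> y ^ 2"
        using evfr by eventually_elim (use \<alpha>_low R in \<open>auto intro!: power_mono\<close>)
      ultimately have "(1 / (2 * R)) ^ 2 \<le> 0" using F by (intro tendsto_lowerbound)
      then show False using R by simp
    qed
  qed
  define s where "s = sqrt c"
  have s: "0 < s" "s ^ 2 = c" using c by (simp_all add: s_def)
  have \<alpha>\<beta>c: "\<alpha> y * \<beta> y = c" if "y \<in> fr" for y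
    using \<alpha>\<beta>[OF that] r[OF that] unfolding three by simp
  have \<alpha>lim: "(\<alpha> \<longlongrightarrow> s) F"
  proof -
    have "((\<lambda>y. c + \<alpha> y * (\<alpha> y - \<beta> y)) \<longlongrightarrow> c + 0) F" by (intro tendsto_intros small)
    then have "((\<lambda>y. sqrt (c + \<alpha> y * (\<alpha> y - \<beta> y))) \<longlongrightarrow> s) F" unfolding s_def by (intro tendsto_intros) simp
    moreover have "\<forall>\<^sub>F y in F. sqrt (c + \<alpha> y * (\<alpha> y - \<beta> y)) = \<alpha> y"
      using evfr \<alpha>bd
    proof eventually_elim
      case (elim y)
      have "c + \<alpha> y * (\<alpha> y - \<beta> y) = \<alpha> y ^ 2" using \<alpha>\<beta>c[OF elim(1)] prod_eq[of y] by simp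
      then show ?case using elim(2) by simp
    qed
    ultimately show ?thesis by (rule Lim_transform_eventually)
  qed
  \<comment> \<open>Filling in the limit at \<open>x\<close> makes \<open>\<phi>\<close> continuous
    on the compact boundary, so extrema are attained; if one is attained at \<open>x\<close>, its
    value is \<open>s\<close> by definition.\<close>
  define \<phi> where "\<phi> y = (if y = x then s else \<alpha> y)" for y
  have cont: "continuous_on (frontier K) \<phi>"
    unfolding continuous_on_def
  proof
    fix y assume y: "y \<in> frontier K"
    show "(\<phi> \<longlongrightarrow> \<phi> y) (at y within frontier K)"
    proof (cases "y = x")
      case True
      have "\<forall>\<^sub>F z in F. \<alpha> z = \<phi> z" using evfr by eventually_elim (simp add: \<phi>_def fr_def)
      with \<alpha>lim have "(\<phi> \<longlongrightarrow> s) F" by (rule Lim_transform_eventually)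
      moreover have "\<phi> x = s" by (simp add: \<phi>_def)
      ultimately show ?thesis by (simp only: True F_def)
    next
      case False
      have "((\<lambda>z. \<alpha> z) \<longlongrightarrow> \<alpha> y) (at y within frontier K)"
        unfolding \<alpha>_def a_def r_def using False by (intro tendsto_intros) auto
      moreover have "\<forall>\<^sub>F z in at y within frontier K. \<alpha> z = \<phi> z"
      proof -
        have "\<forall>\<^sub>F z in at y within frontier K. z \<in> - {x}"
          by (rule topological_tendstoD[OF tendsto_ident_at]) (use False in auto)
        then show ?thesis by eventually_elim (simp add: \<phi>_def)
      qed
      ultimately have "(\<phi> \<longlongrightarrow> \<alpha> y) (at y within frontier K)" by (rule Lim_transform_eventually)
      moreover have "\<phi> y = \<alpha> y" using False by (simp add: \<phi>_def)
      ultimately show ?thesis by simp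
    qed
  qed
  have comp: "compact (frontier K)" "frontier K \<noteq> {}"
    using bounded_K x by (auto simp: compact_frontier_bounded)
  have a_\<phi>: "n \<bullet> (x - y) = \<phi> y * norm (y - x) ^ 2" if "y \<in> frontier K" for y
  proof (cases "y = x")
    case False
    then have "y \<in> fr" using that by (simp add: fr_def)
    then show ?thesis using r[of y] False by (simp add: \<phi>_def \<alpha>_def a_def r_def)
  qed simp
  have \<phi>pos: "0 < \<phi> y" if "y \<in> frontier K" for y
  proof (cases "y = x")
    case False
    then have "y \<in> fr" using that by (simp add: fr_def)
    then show ?thesis using a(2)[of y] r[of y] False by (simp add: \<phi>_def \<alpha>_def)
  qed (simp add: \<phi>_def s)
  \<comment> \<open>The premise says that the sphere through \<open>y\<close> tangent at
    \<open>x\<close> is tangent at \<open>y\<close> too. Then \<open>\<alpha> y = \<beta> y\<close>,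
    and their product \<open>c\<close> leaves only the value \<open>s\<close>.\<close>
  have crit: "\<phi> y = s" if y: "y \<in> frontier K"
    and nuy: "y \<noteq> x \<Longrightarrow> nu y = (1 / (1 / (2 * \<phi> y))) *\<^sub>R (y - (x - (1 / (2 * \<phi> y)) *\<^sub>R n))" for y
  proof (cases "y = x")
    case False
    have yfr: "y \<in> fr" using y False by (simp add: fr_def)
    have "nu y \<bullet> (y - x) = n \<bullet> (x - y)"
      by (rule tangent_sphere_symmetric[OF nn \<phi>pos[OF y] a_\<phi>[OF y] nuy[OF False]])
    then have "\<alpha> y = \<beta> y" by (simp add: \<alpha>_def \<beta>_def a_def b_def)
    then have sq: "\<alpha> y ^ 2 = s ^ 2" using \<alpha>\<beta>c[OF yfr] s by (simp add: power2_eq_square)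
    have "0 < \<alpha> y" using \<phi>pos[OF y] False by (simp add: \<phi>_def)
    then have "\<alpha> y = s" using s(1) by (auto intro: power2_eq_imp_eq[OF sq])
    then show ?thesis using False by (simp add: \<phi>_def)
  qed (simp add: \<phi>_def)
  have touch: "norm (y - (x - (1 / (2 * \<phi> y)) *\<^sub>R n)) = 1 / (2 * \<phi> y)" if y: "y \<in> frontier K" for y
    using dist_center_less[OF nn \<phi>pos[OF y], of y x] dist_center_le[OF nn \<phi>pos[OF y], of y x] a_\<phi>[OF y] by linarith
  obtain y1 where y1: "y1 \<in> frontier K" "\<And>y. y \<in> frontier K \<Longrightarrow> \<phi> y \<le> \<phi> y1"
    using continuous_attains_sup[OF comp cont] by blast
  obtain y2 where y2: "y2 \<in> frontier K" "\<And>y. y \<in> frontier K \<Longrightarrow> \<phi> y2 \<le> \<phi> y"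
    using continuous_attains_inf[OF comp cont] by blast
  \<comment> \<open>The maximum of \<open>\<phi>\<close> belongs to the smallest of the tangent
    spheres, which is inscribed; the minimum belongs to the largest, which is circumscribed.\<close>
  have ball1: "ball (x - (1 / (2 * \<phi> y1)) *\<^sub>R n) (1 / (2 * \<phi> y1)) \<subseteq> K"
    by (rule inner_ball[OF x(1) n \<phi>pos[OF y1(1)]]) (auto simp: a_\<phi> intro!: mult_right_mono y1(2))
  have ball2: "K \<subseteq> cball (x - (1 / (2 * \<phi> y2)) *\<^sub>R n) (1 / (2 * \<phi> y2))"
    by (rule outer_ball[OF nn \<phi>pos[OF y2(1)]]) (auto simp: a_\<phi> intro!: mult_right_mono y2(2))
  have "\<phi> y1 = s"
    by (rule crit[OF y1(1)], rule touch_inner[OF ball1 _ touch[OF y1(1)] nu[OF y1(1)]]) (use \<phi>pos[OF y1(1)] in simp)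
  moreover have "\<phi> y2 = s"
    by (rule crit[OF y2(1)], rule touch_outer[OF ball2 _ touch[OF y2(1)] nu[OF y2(1)]]) (use \<phi>pos[OF y2(1)] in simp)
  moreover define \<rho> where "\<rho> = 1 / (2 * s)"
  moreover define q where "q = x - \<rho> *\<^sub>R n"
  ultimately have K: "ball q \<rho> \<subseteq> K" "K \<subseteq> cball q \<rho>"
    using ball1 ball2 by simp_all
  have \<rho>: "0 < \<rho>" using s by (simp add: \<rho>_def)
  have "K \<subseteq> interior (cball q \<rho>)" using K(2) open_K by (rule interior_maximal)
  then have "K = ball q \<rho>" using K(1) by (simp add: interior_cball)
  then have "frontier K = sphere q \<rho>" using \<rho> by simp
  also have "\<dots> = {q + \<rho> *\<^sub>R u | u. u \<in> sphere 0 1}"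
  proof (intro set_eqI iffI)
    fix z assume "z \<in> sphere q \<rho>"
    then have "norm ((1 / \<rho>) *\<^sub>R (z - q)) = 1" using \<rho> by (simp add: dist_norm norm_minus_commute)
    moreover have "z = q + \<rho> *\<^sub>R ((1 / \<rho>) *\<^sub>R (z - q))" using \<rho> by simp
    ultimately show "z \<in> {q + \<rho> *\<^sub>R u | u. u \<in> sphere 0 1}" by (metis (mono_tags, lifting) mem_Collect_eq mem_sphere_0)
  next
    fix z assume "z \<in> {q + \<rho> *\<^sub>R u | u. u \<in> sphere 0 1}"
    then show "z \<in> sphere q \<rho>" using \<rho> by (auto simp: dist_norm)
  qed
  finally show ?thesis using three \<rho> by blast
qed

end

theorem theorem2:
  fixes K :: "(real^'n) set"
  assumes "K \<noteq> {}" and "open K" and "bounded K" and "convex K"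
    and "C2_boundary K"
    and "distr (crofton_prob K) (borel \<Otimes>\<^sub>M borel) (\<lambda>l. (entry_point K l, exit_point K l)) =
         surface_prob (frontier K) \<Otimes>\<^sub>M surface_prob (frontier K)"
  shows "CARD('n) = 3 \<and> (\<exists>c r. r > 0 \<and> frontier K = {c + r *\<^sub>R u | u. u \<in> sphere 0 1})"
proof -
  interpret independent_body K
    by unfold_locales (use assms in auto)
  show ?thesis by (rule ball_of_dimension_3[OF assms(5)])
qed

end
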